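(* Let $N\ge 3$, $z_0\in\mathbb{C}\setminus\{0\}$, and set $\kappa_j=\frac{z_0^{2j+1}}{2j+1}$ for $1\le j\le N-1$. Assume (standing assumption) that the Adler–Moser polynomial $\Theta_N(z)$ with these parameters has $z_0$ as a root of multiplicity $\frac{N(N-1)}{2}$ and $N$ further simple roots. Let $A\in\mathbb{C}$ be a large parameter, and take the internal parameters of $q^{[N]}$ as $$a_{2j+1}=\kappa_j A^{2j+1}+\kappa_{j,1}A,\quad 1\le j\le N-1,$$ with complex constants $\kappa_{j,1}$ and $\kappa_{N-1,1}=0$. Define real $(x_0,t_0)$ by $x_0+2\mathrm{i}t_0=z_0A$. Consider the condition $$(\ast_j)\qquad \kappa_{j,1}=-\frac{\mathrm{Re}(z_0\mathrm{e}^{\mathrm{i}\arg A})+2^{2j}\mathrm{i}\,\mathrm{Im}(z_0\mathrm{e}^{\mathrm{i}\arg A})}{(2j+1)!}\,\mathrm{e}^{-\mathrm{i}\arg A}.$$ (1) If $(\ast_j)$ holds for all $1\le j\le N-2$, then as $|A|\to\infty$, uniformly for $(x-x_0,t-t_0)$ in any fixed bounded set, $$q^{[N]}(x,t)=\hat q^{[N-1]}(x-x_0,t-t_0)\,\mathrm{e}^{2\mathrm{i}t}+O(|A|^{-1}).$$ (2) Let $1\le m\le N-2$ and suppose $(\ast_j)$ holds for $1\le j\le m-1$ but not for $j=m$. Assume all nonzero roots of the Yablonskii–Vorob'ev polynomial $Q_{N-1}^{[m]}$ are simple. For each nonzero root $\bar z_0$ of $Q^{[m]}_{N-1}$ define real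 $(\tilde x_0,\tilde t_0)$ by $$\tilde x_0+2\mathrm{i}\tilde t_0=\bar z_0\left[-\frac{2m+1}{2^{2m}}\left(\frac{\mathrm{Re}(z_0A)+2^{2m}\mathrm{i}\,\mathrm{Im}(z_0A)}{(2m+1)!}+\kappa_{m,1}A\right)\right]^{1/(2m+1)}+z_0A$$ (with a fixed branch of the $(2m+1)$-th root). Then as $|A|\to\infty$, uniformly for $(x-\tilde x_0,t-\tilde t_0)$ in any fixed bounded set, $$q^{[N]}(x,t)=\hat q^{[1]}(x-\tilde x_0,t-\tilde t_0)\,\mathrm{e}^{2\mathrm{i}t}+O(|A|^{-1/(2m+1)}),$$ and, uniformly for $(x-x_0,t-t_0)$ in any fixed bounded set, $$q^{[N]}(x,t)=\hat q^{[N_0]}(x-x_0,t-t_0)\,\mathrm{e}^{2\mathrm{i}t}+O(|A|^{-1}),$$ where $N_0$ is defined from $N-1$ and $m$ as below. The number of such points $(\tilde x_0,\tilde t_0)$ is $\Gamma_{N-1}$.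
   Context: Schur polynomials: for $\mathbf{y}=(y_1,y_2,\dots)$, $\sum_{k\ge0}S_k(\mathbf y)\epsilon^k=\exp(\sum_{k\ge1}y_k\epsilon^k)$, $S_k=0$ for $k<0$. Let $\mathbf s=(0,s_2,0,s_4,\dots)$ with $\sum_{l\ge1}s_l\epsilon^l=\ln\!\big(\frac{2}{\epsilon}\tanh\frac{\epsilon}{2}\big)$. Rogue wave solutions of the NLS equation $\mathrm{i}q_t+q_{xx}+2|q|^2q=0$: for $N\ge1$, real $x,t$, and complex internal parameters $a_3,a_5,\dots,a_{2N-1}$, set $\mathbf x^{\pm}(n)=(x_1^{\pm}(n),0,x_3^{\pm},0,x_5^{\pm},0,\dots)$ ($n=0,1$) with $x_1^{+}(n)=x+2\mathrm{i}t+n$, $x_1^-(n)=x-2\mathrm{i}t-n$, $x_{2k+1}^+=\frac{x+2^{2k+1}\mathrm{i}t}{(2k+1)!}+a_{2k+1}$, $x_{2k+1}^-=\overline{x_{2k+1}^+}$ ($k\ge1$). Let $\tau^{(n)}_{i,j}=\sum_{v=0}^{\min(i,j)}4^{-v}S_{i-v}(\mathbf x^+(n)+v\mathbf s)S_{j-v}(\mathbf x^-(n)+v\mathbf s)$, $\tau^{(n)}=\det_{1\le i,j\le N}(\tau^{(n)}_{2i-1,2j-1})$, and $q^{[N]}(x,t)=\frac{\tau^{(1)}}{\tau^{(0)}}\mathrm{e}^{2\mathrm{i}t}$. The fundamental rogue wave $\hat q^{[M]}(x,t)$ is $q^{[M]}(x,t)\mathrm{e}^{-2\mathrm{i}t}$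 with all internal parameters $a_{2k+1}=0$; $\hat q^{[0]}\equiv1$ and $\hat q^{[1]}(x,t)=1-\frac{4(4\mathrm{i}t+1)}{4x^2+16t^2+1}$. Adler–Moser polynomials: for constants $\kappa_j$, $\sum_{k\ge0}\theta_k(z)\epsilon^k=\exp(z\epsilon+\sum_{j\ge1}\kappa_j\epsilon^{2j+1})$, $\theta_k=0$ for $k<0$, $\Theta_N(z)=c_N\det_{1\le i,j\le N}(\theta_{2i-j}(z))$, $c_N=\prod_{k=1}^N(2k-1)!!$. The Yablonskii–Vorob'ev polynomial $Q^{[m]}_N(z)$ is $\Theta_N(z)$ with $\kappa_m=-\frac{2^{2m}}{2m+1}$ and all other $\kappa_j=0$. For $M\ge1$, $m\ge1$: let $r=M \bmod (2m+1)$; $N_0=r$ if $r\le m$ and $N_0=2m-r$ if $r>m$; $\Gamma_M=\frac12\big(M(M+1)-N_0(N_0+1)\big)$. Then $Q^{[m]}_M$ has a zero root of multiplicity $N_0(N_0+1)/2$ and $\Gamma_M$ nonzero roots. In the theorem, $N_0,\Gamma_{N-1}$ are these quantities with $M=N-1$. *)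

theory Defs
  imports "HOL-Analysis.Analysis" "HOL-Computational_Algebra.Computational_Algebra"
          "Jordan_Normal_Form.Determinant"
begin

definition schur :: "(nat \<Rightarrow> complex) \<Rightarrow> int \<Rightarrow> complex" where
  "schur y k = (if k < 0 then 0 else
     fps_nth (fps_exp 1 oo Abs_fps (\<lambda>n. if n = 0 then 0 else y n)) (nat k))"

text \<open>The vector s: sum_l s_l eps^l = ln((2/eps) tanh(eps/2)),
  where (2/eps) tanh(eps/2) = 2 (e^eps - 1) / (eps (e^eps + 1)).\<close>
definition tanh_ratio_fps :: "complex fps" where
  "tanh_ratio_fps = fps_const 2 * (fps_exp 1 - 1) / (fps_X * (fps_exp 1 + 1))"

definition svec :: "nat \<Rightarrow> complex" where
  "svec l = fps_nth (fps_ln 1 oo (tanh_ratio_fps - 1)) l"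

text \<open>x^+(n) and x^-(n); a k stands for the internal parameter a_{2k+1}.\<close>
definition xplus :: "(nat \<Rightarrow> complex) \<Rightarrow> real \<Rightarrow> real \<Rightarrow> nat \<Rightarrow> nat \<Rightarrow> complex" where
  "xplus a x t n k = (if k = 1 then of_real x + 2 * \<i> * of_real t + of_nat n
     else if odd k then (of_real x + 2 ^ k * \<i> * of_real t) / fact k + a ((k - 1) div 2)
     else 0)"

definition xminus :: "(nat \<Rightarrow> complex) \<Rightarrow> real \<Rightarrow> real \<Rightarrow> nat \<Rightarrow> nat \<Rightarrow> complex" where
  "xminus a x t n k = (if k = 1 then of_real x - 2 * \<i> * of_real t - of_nat n
     else if odd k then cnj (xplus a x t n k)
     else 0)"

definition tau_entry :: "(nat \<Rightarrow> complex) \<Rightarrow> real \<Rightarrow> real \<Rightarrow> nat \<Rightarrow> nat \<Rightarrow> nat \<Rightarrow> complex" where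
  "tau_entry a x t n i j = (\<Sum>v = 0..min i j. (1/4) ^ v *
      schur (\<lambda>k. xplus a x t n k + of_nat v * svec k) (int i - int v) *
      schur (\<lambda>k. xminus a x t n k + of_nat v * svec k) (int j - int v))"

definition tau :: "nat \<Rightarrow> (nat \<Rightarrow> complex) \<Rightarrow> real \<Rightarrow> real \<Rightarrow> nat \<Rightarrow> complex" where
  "tau N a x t n = det (mat N N (\<lambda>(i, j). tau_entry a x t n (2 * i + 1) (2 * j + 1)))"

definition rw :: "nat \<Rightarrow> (nat \<Rightarrow> complex) \<Rightarrow> real \<Rightarrow> real \<Rightarrow> complex" where
  "rw N a x t = tau N a x t 1 / tau N a x t 0 * exp (2 * \<i> * of_real t)"

definition hatq :: "nat \<Rightarrow> real \<Rightarrow> real \<Rightarrow> complex" where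
  "hatq M x t = rw M (\<lambda>_. 0) x t * exp (- 2 * \<i> * of_real t)"

definition am_theta :: "(nat \<Rightarrow> complex) \<Rightarrow> int \<Rightarrow> complex \<Rightarrow> complex" where
  "am_theta kappa k z = schur (\<lambda>l. if l = 1 then z
       else if odd l \<and> l \<ge> 3 then kappa ((l - 1) div 2) else 0) k"

definition dfact_odd :: "nat \<Rightarrow> complex" where
  "dfact_odd k = (\<Prod>i = 1..k. of_nat (2 * i - 1))"

definition adler_moser :: "(nat \<Rightarrow> complex) \<Rightarrow> nat \<Rightarrow> complex \<Rightarrow> complex" where
  "adler_moser kappa N z = (\<Prod>k = 1..N. dfact_odd k) *
     det (mat N N (\<lambda>(i, j). am_theta kappa (2 * (int i + 1) - (int j + 1)) z))"

definition yablonskii_vorobev :: "nat \<Rightarrow> nat \<Rightarrow> complex \<Rightarrow> complex" where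
  "yablonskii_vorobev m N = adler_moser
     (\<lambda>j. if j = m then - (2 ^ (2 * m)) / of_nat (2 * m + 1) else 0) N"

definition N0_of :: "nat \<Rightarrow> nat \<Rightarrow> nat" where
  "N0_of M m = (let r = M mod (2 * m + 1) in if r \<le> m then r else 2 * m - r)"

definition Gamma_of :: "nat \<Rightarrow> nat \<Rightarrow> nat" where
  "Gamma_of M m = (M * (M + 1) - N0_of M m * (N0_of M m + 1)) div 2"

end

theory Submission
  imports Defs "HOL-Library.Landau_Symbols"
begin

text \<open>
  By multilinearity every tau function is a Gram determinant \<open>det (C P\<^sup>+ (C' P\<^sup>-)\<^sup>T)\<close>, where the
  coefficient matrix \<open>C\<close> is a Toeplitz matrix carrying the large parameter and \<open>P\<^sup>\<plusminus>\<close> stays bounded.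
  Even power series act on the odd rows by unitriangular row operations, so the factor
  \<open>exp (\<Sum> (\<alpha> r \<epsilon>)\<^sup>2\<^sup>j\<^sup>+\<^sup>1 / (2 j + 1))\<close> produced by \<open>\<kappa>\<^sub>j = z\<^sub>0\<^sup>2\<^sup>j\<^sup>+\<^sup>1 / (2 j + 1)\<close> may be replaced by \<open>1 + \<alpha> r \<epsilon>\<close>.

  Near the centre, \<open>C\<close> is normalised by the minor on the staircase columns
  \<open>0, \<dots>, K - 1, K + 1, K + 3, \<dots>\<close>. Under the scaling \<open>\<epsilon> \<rightarrow> r\<^sup>-\<^sup>1\<^sup>/\<^sup>(\<^sup>2\<^sup>m\<^sup>+\<^sup>1\<^sup>) \<epsilon>\<close> the minors converge, the staircase
  minor to a nonzero number (a Vandermonde argument in each residue class modulo \<open>2 m + 1\<close>). An entry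
  of the normalised matrix is a quotient of two minors, hence a rational function of \<open>r\<close> of degree
  less than \<open>1\<close>; where the degree could be \<open>0\<close> the function is odd. So every entry off the staircase is
  \<open>O(1/r)\<close>, and the staircase alone gives the fundamental tau function of order \<open>N\<^sub>0\<close>.

  Near \<open>z\<^sub>0 A + zb B\<close> with \<open>zb\<close> a simple root, the two leading terms of the Cauchy-Binet expansion have
  the same order and share the factor \<open>Q'(zb)\<close>; they add up to the first-order tau function.
\<close>


section \<open>Determinants and the Cauchy-Binet formula\<close>

text \<open>Multiplication by \<open>1 + \<alpha> r \<epsilon>\<close> adds to row
  \<open>2 i + 1\<close> the multiple \<open>\<alpha> r\<close> of row \<open>2 i\<close>. The even
  rows dominate, and because row 0 is trivial they form the matrix of the Yablonskii-Vorob'ev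
  polynomial of index \<open>N - 1\<close>, not \<open>N\<close>. This explains
  \<open>N0_of (N - 1) m\<close> and the roots that occur. The detour through rational functions of
  \<open>r\<close> is forced by the error term \<open>1/r\<close> at the centre: the scaling alone
  yields fractional powers of \<open>r\<close>, whereas a rational function can only grow or decay
  with an integral exponent. Quotients of tau functions can be taken for two reasons: tau for
  \<open>n = 0\<close> is bounded away from zero uniformly in all parameters, and every large
  prefactor is the same for \<open>n = 0\<close> and \<open>n = 1\<close>. Part (1) is the centre
  argument with \<open>m = N - 1\<close>: the index \<open>2 m + 1\<close> then exceeds every even
  row index, and \<open>N0_of (N - 1) (N - 1) = N - 1\<close>.\<close>

definition fdet :: "nat \<Rightarrow> (nat \<Rightarrow> nat \<Rightarrow> 'a::comm_ring_1) \<Rightarrow> 'a" where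
  "fdet n A = det (mat n n (\<lambda>(i, j). A i j))"

lemma fdet_cong:
  assumes "\<And>i j. i < n \<Longrightarrow> j < n \<Longrightarrow> A i j = B i j"
  shows "fdet n A = fdet n B"
  unfolding fdet_def by (rule arg_cong[where f = det], rule eq_matI) (auto simp: assms)

lemma fdet_leibniz: "fdet n A = (\<Sum>p | p permutes {..<n}. signof p * (\<Prod>i<n. A i (p i)))"
  unfolding fdet_def
  by (subst det_def'[of _ n]) (auto simp: atLeast0LessThan intro!: sum.cong prod.cong dest: permutes_in_image)

lemma fdet_transpose: "fdet n (\<lambda>i j. A j i) = fdet n A"
proof -
  have "mat n n (\<lambda>(i, j). A j i) = (mat n n (\<lambda>(i, j). A i j))\<^sup>T"
    by (rule eq_matI) auto
  thus ?thesis by (simp add: fdet_def det_transpose[of _ n])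
qed

lemma fdet_leibniz_col: "fdet n A = (\<Sum>p | p permutes {..<n}. signof p * (\<Prod>j<n. A (p j) j))"
  using fdet_leibniz[of n "\<lambda>i j. A j i"] fdet_transpose[of n A] by simp

lemma fdet_mult: "fdet n (\<lambda>i j. \<Sum>k<n. A i k * B k j) = fdet n A * fdet n B"
proof -
  have "mat n n (\<lambda>(i, j). \<Sum>k<n. A i k * B k j) = mat n n (\<lambda>(i, j). A i j) * mat n n (\<lambda>(i, j). B i j)"
    by (rule eq_matI) (auto simp: scalar_prod_def atLeast0LessThan)
  thus ?thesis by (simp add: fdet_def det_mult[of _ n])
qed

lemma fdet_permute_cols:
  assumes "\<pi> permutes {..<n}"
  shows "fdet n (\<lambda>i j. A i (\<pi> j)) = signof \<pi> * fdet n A"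
proof -
  have "fdet n (\<lambda>i j. A j (\<pi> i)) = signof \<pi> * fdet n (\<lambda>i j. A j i)"
  proof -
    have "mat n n (\<lambda>(i, j). mat n n (\<lambda>(i, j). A j i) $$ (\<pi> i, j)) = mat n n (\<lambda>(i, j). A j (\<pi> i))"
      using permutes_in_image[OF assms] by (intro eq_matI) auto
    thus ?thesis
      using det_permute_rows[of "mat n n (\<lambda>(i, j). A j i)" n \<pi>] assms
      by (simp add: fdet_def atLeast0LessThan)
  qed
  thus ?thesis using fdet_transpose[of n "\<lambda>i j. A i (\<pi> j)"] fdet_transpose[of n A] by simp
qed

lemma fdet_lower_triangular:
  assumes "\<And>i j. i < j \<Longrightarrow> j < n \<Longrightarrow> A i j = 0"
  shows "fdet n A = (\<Prod>i<n. A i i)"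
  unfolding fdet_def
  by (subst det_lower_triangular[of n])
     (auto simp: assms prod_list_diag_prod atLeast0LessThan intro!: prod.cong)

lemma fdet_scale: "fdet n (\<lambda>i j. c i * A i j * d j) = (\<Prod>i<n. c i) * (\<Prod>j<n. d j) * fdet n A"
proof -
  have "(\<Prod>i<n. c i * A i (p i) * d (p i)) = (\<Prod>i<n. c i) * (\<Prod>j<n. d j) * (\<Prod>i<n. A i (p i))"
    if "p permutes {..<n}" for p
    using prod.permute[OF that, of d] by (simp add: prod.distrib o_def mult_ac)
  thus ?thesis by (simp add: fdet_leibniz sum_distrib_left mult_ac)
qed

lemma fdet_identical_cols:
  assumes "j < n" "k < n" "j \<noteq> k" "\<And>i. i < n \<Longrightarrow> A i j = A i k"
  shows "fdet n A = 0"
  unfolding fdet_def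
  by (rule det_identical_columns[of _ n j k]) (use assms in \<open>auto simp: col_def\<close>)

lemma fdet_first_row:
  assumes "\<And>j. 0 < j \<Longrightarrow> j \<le> n \<Longrightarrow> A 0 j = 0"
  shows "fdet (Suc n) A = A 0 0 * fdet n (\<lambda>i j. A (Suc i) (Suc j))"
proof -
  let ?M = "mat (Suc n) (Suc n) (\<lambda>(i, j). A i j)"
  have "fdet (Suc n) A = (\<Sum>j<Suc n. ?M $$ (0, j) * cofactor ?M 0 j)"
    unfolding fdet_def by (rule laplace_expansion_row) auto
  also have "\<dots> = (\<Sum>j<Suc n. if j = 0 then A 0 0 * cofactor ?M 0 0 else 0)"
    by (intro sum.cong) (auto simp: assms)
  also have "\<dots> = A 0 0 * cofactor ?M 0 0" by simp
  also have "cofactor ?M 0 0 = fdet n (\<lambda>i j. A (Suc i) (Suc j))"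
    unfolding cofactor_def fdet_def mat_delete_def
    by (simp, rule arg_cong[where f = det], rule eq_matI, auto)
  finally show ?thesis .
qed

lemma fdet_nonzeroI:
  fixes A :: "nat \<Rightarrow> nat \<Rightarrow> 'a::field"
  assumes "\<And>y j. (\<And>i. i < n \<Longrightarrow> (\<Sum>k<n. A i k * y k) = 0) \<Longrightarrow> j < n \<Longrightarrow> y j = 0"
  shows "fdet n A \<noteq> 0"
proof
  let ?M = "mat n n (\<lambda>(i, j). A i j)"
  assume "fdet n A = 0"
  then obtain v where v: "v \<in> carrier_vec n" "v \<noteq> 0\<^sub>v n" "?M *\<^sub>v v = 0\<^sub>v n"
    using det_0_iff_vec_prod_zero_field[of ?M n] by (auto simp: fdet_def)
  have "(\<Sum>k<n. A i k * vec_index v k) = 0" if "i < n" for i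
    using arg_cong[OF v(3), of "\<lambda>w. vec_index w i"] that v(1)
    by (simp add: scalar_prod_def atLeast0LessThan)
  hence "vec_index v j = 0" if "j < n" for j
    using assms[of "vec_index v"] that by blast
  hence "v = 0\<^sub>v n" using v(1) by (intro eq_vecI) auto
  with v(2) show False by simp
qed

text \<open>Cramer's rule without division: replacing column \<open>k\<close> by \<open>b\<close>
  gives entry \<open>k\<close> of the adjugate applied to \<open>b\<close>, and \<open>A\<close>
  times its adjugate is scalar. It expresses an arbitrary column through chosen ones, with minors as
  coefficients.\<close>

lemma fdet_cramer:
  fixes A :: "nat \<Rightarrow> nat \<Rightarrow> 'a::comm_ring_1"
  assumes "i < n"
  shows "(\<Sum>k<n. A i k * fdet n (\<lambda>i' j. if j = k then b i' else A i' j)) = fdet n A * b i"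
proof -
  let ?M = "mat n n (\<lambda>(i, j). A i j)"
  let ?R = "\<lambda>k. mat n n (\<lambda>(i', j). if j = k then b i' else A i' j)"
  have *: "fdet n (\<lambda>i' j. if j = k then b i' else A i' j) = (\<Sum>l<n. b l * cofactor ?M l k)"
    if k: "k < n" for k
  proof -
    have "det (?R k) = (\<Sum>l<n. ?R k $$ (l, k) * cofactor (?R k) l k)"
      by (rule laplace_expansion_column) (use k in auto)
    also have "\<dots> = (\<Sum>l<n. b l * cofactor ?M l k)"
    proof (intro sum.cong refl)
      fix l assume l: "l \<in> {..<n}"
      have "mat_delete (?R k) l k = mat_delete ?M l k"
        unfolding mat_delete_def by (rule eq_matI) (use k in auto)
      thus "?R k $$ (l, k) * cofactor (?R k) l k = b l * cofactor ?M l k"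
        using l k by (simp add: cofactor_def)
    qed
    finally show ?thesis by (simp add: fdet_def)
  qed
  have adj: "(\<Sum>k<n. A i k * cofactor ?M l k) = (if i = l then fdet n A else 0)" if "l < n" for l
    using arg_cong[OF adj_mat(2)[of ?M n], of "\<lambda>B. B $$ (i, l)"] assms that
    by (simp add: scalar_prod_def atLeast0LessThan adj_mat_def fdet_def)
  have "(\<Sum>k<n. A i k * fdet n (\<lambda>i' j. if j = k then b i' else A i' j))
      = (\<Sum>k<n. \<Sum>l<n. A i k * cofactor ?M l k * b l)"
    by (intro sum.cong) (auto simp: * sum_distrib_left mult_ac)
  also have "\<dots> = (\<Sum>l<n. (\<Sum>k<n. A i k * cofactor ?M l k) * b l)"
    by (subst sum.swap) (simp add: sum_distrib_right)
  also have "\<dots> = (\<Sum>l<n. if i = l then fdet n A * b l else 0)"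
    by (intro sum.cong) (auto simp: adj)
  also have "\<dots> = fdet n A * b i" using assms by simp
  finally show ?thesis .
qed

lemma poly_signof [simp]: "poly (signof p) x = signof p"
  by (simp add: sign_def)

lemma poly_fdet: "poly (fdet n A) x = fdet n (\<lambda>i j. poly (A i j) x)"
  by (simp add: fdet_leibniz poly_sum poly_prod)

section \<open>Gram determinants of rectangular matrices\<close>

definition gram :: "nat \<Rightarrow> nat \<Rightarrow> (nat \<Rightarrow> nat \<Rightarrow> 'a) \<Rightarrow> (nat \<Rightarrow> nat \<Rightarrow> 'a) \<Rightarrow> 'a::comm_ring_1" where
  "gram n p A B = fdet n (\<lambda>i j. \<Sum>v<p. A i v * B j v)"

lemma gram_cong:
  assumes "\<And>i v. i < n \<Longrightarrow> v < p \<Longrightarrow> A i v = A' i v" "\<And>i v. i < n \<Longrightarrow> v < p \<Longrightarrow> B i v = B' i v"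
  shows "gram n p A B = gram n p A' B'"
  unfolding gram_def by (intro fdet_cong sum.cong) (auto simp: assms)

lemma gram_commute: "gram n p A B = gram n p B A"
  using fdet_transpose[of n "\<lambda>i j. \<Sum>v<p. A i v * B j v"] by (simp add: gram_def mult.commute)

lemma gram_left:
  assumes "\<And>i v. i < n \<Longrightarrow> v < p \<Longrightarrow> A i v = (\<Sum>k<n. U i k * A' k v)"
  shows "gram n p A B = fdet n U * gram n p A' B"
proof -
  have "gram n p A B = fdet n (\<lambda>i j. \<Sum>k<n. U i k * (\<Sum>v<p. A' k v * B j v))"
    unfolding gram_def
  proof (intro fdet_cong)
    fix i j assume "i < n" "j < n"
    have "(\<Sum>v<p. A i v * B j v) = (\<Sum>v<p. \<Sum>k<n. U i k * (A' k v * B j v))"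
      using \<open>i < n\<close> by (intro sum.cong) (auto simp: assms sum_distrib_right mult.assoc)
    also have "\<dots> = (\<Sum>k<n. U i k * (\<Sum>v<p. A' k v * B j v))"
      by (subst sum.swap) (simp add: sum_distrib_left)
    finally show "(\<Sum>v<p. A i v * B j v) = (\<Sum>k<n. U i k * (\<Sum>v<p. A' k v * B j v))" .
  qed
  also have "\<dots> = fdet n U * gram n p A' B" unfolding gram_def by (rule fdet_mult)
  finally show ?thesis .
qed

lemma gram_right:
  assumes "\<And>i v. i < n \<Longrightarrow> v < p \<Longrightarrow> B i v = (\<Sum>k<n. U i k * B' k v)"
  shows "gram n p A B = fdet n U * gram n p A B'"
  using gram_left[of n p B U B' A] assms by (simp add: gram_commute[of n p A])

lemma gram_more_cols:
  assumes "p \<le> p'" "\<And>i v. i < n \<Longrightarrow> p \<le> v \<Longrightarrow> v < p' \<Longrightarrow> A i v = 0"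
  shows "gram n p' A B = gram n p A B"
  unfolding gram_def
  by (intro fdet_cong sum.mono_neutral_right) (use assms in auto)

text \<open>Both first rows live in column 0, so column 0 can be cleared from the other rows of both
  factors; after that the product matrix splits off its corner entry.\<close>

lemma gram_first_row:
  fixes A B :: "nat \<Rightarrow> nat \<Rightarrow> 'a::field"
  assumes A: "\<And>v. 0 < v \<Longrightarrow> v \<le> p \<Longrightarrow> A 0 v = 0" and B: "\<And>v. 0 < v \<Longrightarrow> v \<le> p \<Longrightarrow> B 0 v = 0"
    and nz: "A 0 0 \<noteq> 0" "B 0 0 \<noteq> 0"
  shows "gram (Suc n) (Suc p) A B = A 0 0 * B 0 0 * gram n p (\<lambda>i v. A (Suc i) (Suc v)) (\<lambda>i v. B (Suc i) (Suc v))"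
proof -
  \<comment> \<open>\<open>U A\<close> adds back the multiple \<open>A i 0 / A 0 0\<close> of row 0
    to row \<open>i\<close>, so \<open>A\<close> is \<open>U A\<close> times \<open>R A\<close>,
    where \<open>R A\<close> is cleared in column 0 below the corner and \<open>U A\<close> is
    unitriangular.\<close>
  define U where "U = (\<lambda>(A::nat \<Rightarrow> nat \<Rightarrow> 'a) i k. if i = k then 1 else if k = 0 then A i 0 / A 0 0 else 0)"
  define R where "R = (\<lambda>(A::nat \<Rightarrow> nat \<Rightarrow> 'a) i v. if i = 0 \<or> v > 0 then A i v else 0)"
  have U: "fdet (Suc n) (U A) = 1" for A
    by (subst fdet_lower_triangular) (auto simp: U_def)
  have R: "A i v = (\<Sum>k<Suc n. U A i k * R A k v)"
    if "A 0 0 \<noteq> 0" "\<And>v. 0 < v \<Longrightarrow> v \<le> p \<Longrightarrow> A 0 v = 0" "i < Suc n" "v < Suc p" for A i v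
  proof (cases i)
    case 0
    have "(\<Sum>k<Suc n. U A i k * R A k v) = (\<Sum>k<Suc n. if k = 0 then A 0 v else 0)"
      by (intro sum.cong) (auto simp: U_def R_def 0)
    thus ?thesis by (simp add: 0)
  next
    case (Suc i')
    have "(\<Sum>k<Suc n. U A i k * R A k v) = (\<Sum>k\<in>{0, i}. U A i k * R A k v)"
      using that(3) by (intro sum.mono_neutral_right) (auto simp: U_def)
    also have "\<dots> = A i v" using that Suc by (auto simp: U_def R_def)
    finally show ?thesis by simp
  qed
  have "gram (Suc n) (Suc p) A B = fdet (Suc n) (U A) * gram (Suc n) (Suc p) (R A) B"
    by (rule gram_left) (rule R[of A], use assms in auto)
  also have "gram (Suc n) (Suc p) (R A) B = fdet (Suc n) (U B) * gram (Suc n) (Suc p) (R A) (R B)"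
    by (rule gram_right) (rule R[of B], use assms in auto)
  finally have "gram (Suc n) (Suc p) A B = gram (Suc n) (Suc p) (R A) (R B)"
    by (simp add: U)
  also have "\<dots> = (\<Sum>v<Suc p. R A 0 v * R B 0 v) *
      fdet n (\<lambda>i j. \<Sum>v<Suc p. R A (Suc i) v * R B (Suc j) v)"
    unfolding gram_def
  proof (rule fdet_first_row)
    fix j assume "0 < j" "j \<le> n"
    show "(\<Sum>v<Suc p. R A 0 v * R B j v) = 0"
      by (intro sum.neutral) (use \<open>0 < j\<close> A in \<open>auto simp: R_def\<close>)
  qed
  also have "(\<Sum>v<Suc p. R A 0 v * R B 0 v) = A 0 0 * B 0 0"
    using A by (simp add: sum.lessThan_Suc_shift R_def del: sum.lessThan_Suc)
  also have "fdet n (\<lambda>i j. \<Sum>v<Suc p. R A (Suc i) v * R B (Suc j) v) =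
      gram n p (\<lambda>i v. A (Suc i) (Suc v)) (\<lambda>i v. B (Suc i) (Suc v))"
    unfolding gram_def by (intro fdet_cong) (simp add: sum.lessThan_Suc_shift R_def del: sum.lessThan_Suc)
  finally show ?thesis .
qed

lemma gram_lower_triangular_block:
  fixes A B :: "nat \<Rightarrow> nat \<Rightarrow> 'a::field"
  assumes "\<And>i v. i < k \<Longrightarrow> i < v \<Longrightarrow> v < k + p \<Longrightarrow> A i v = 0" "\<And>i v. i < k \<Longrightarrow> i < v \<Longrightarrow> v < k + p \<Longrightarrow> B i v = 0"
    and "\<And>i. i < k \<Longrightarrow> A i i \<noteq> 0" "\<And>i. i < k \<Longrightarrow> B i i \<noteq> 0"
  shows "gram (k + n) (k + p) A B =
    (\<Prod>i<k. A i i * B i i) * gram n p (\<lambda>i v. A (k + i) (k + v)) (\<lambda>i v. B (k + i) (k + v))"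
  using assms
proof (induction k arbitrary: A B)
  case (Suc k)
  have "gram (Suc (k + n)) (Suc (k + p)) A B = A 0 0 * B 0 0 *
      gram (k + n) (k + p) (\<lambda>i v. A (Suc i) (Suc v)) (\<lambda>i v. B (Suc i) (Suc v))"
    by (rule gram_first_row) (use Suc.prems in auto)
  also have "gram (k + n) (k + p) (\<lambda>i v. A (Suc i) (Suc v)) (\<lambda>i v. B (Suc i) (Suc v)) =
     (\<Prod>i<k. A (Suc i) (Suc i) * B (Suc i) (Suc i)) *
     gram n p (\<lambda>i v. A (Suc (k + i)) (Suc (k + v))) (\<lambda>i v. B (Suc (k + i)) (Suc (k + v)))"
    by (rule Suc.IH) (use Suc.prems in auto)
  finally show ?case by (simp add: prod.lessThan_Suc_shift mult_ac del: prod.lessThan_Suc)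
qed simp

text \<open>Multilinearity in the rows: \<open>f\<close> records which column each row of
  \<open>A\<close> contributes.\<close>

lemma gram_expand:
  fixes A B :: "nat \<Rightarrow> nat \<Rightarrow> 'a::comm_ring_1"
  shows "gram n p A B = (\<Sum>f\<in>{..<n} \<rightarrow>\<^sub>E {..<p}. (\<Prod>i<n. A i (f i)) * fdet n (\<lambda>i j. B i (f j)))"
proof -
  let ?P = "{\<pi>. \<pi> permutes {..<n}}"
  have "gram n p A B = (\<Sum>\<pi>\<in>?P. signof \<pi> * (\<Prod>i<n. \<Sum>v<p. A i v * B (\<pi> i) v))"
    by (simp add: gram_def fdet_leibniz)
  also have "\<dots> = (\<Sum>\<pi>\<in>?P. \<Sum>f\<in>{..<n} \<rightarrow>\<^sub>E {..<p}. signof \<pi> * (\<Prod>i<n. A i (f i) * B (\<pi> i) (f i)))"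
    by (intro sum.cong refl) (subst prod_sum_PiE, auto simp: sum_distrib_left)
  also have "\<dots> = (\<Sum>f\<in>{..<n} \<rightarrow>\<^sub>E {..<p}. (\<Prod>i<n. A i (f i)) * fdet n (\<lambda>i j. B i (f j)))"
    by (subst sum.swap) (simp add: fdet_leibniz_col prod.distrib sum_distrib_left mult_ac)
  finally show ?thesis .
qed

text \<open>Summing over all maps \<open>f\<close> instead of column subsets avoids increasing
  enumerations: non-injective maps give zero, and each subset is met by all its orderings with the
  same product of minors, which \<open>fact n\<close> compensates.\<close>

theorem cauchy_binet:
  fixes A B :: "nat \<Rightarrow> nat \<Rightarrow> 'a::field_char_0"
  shows "gram n p A B = (\<Sum>f\<in>{..<n} \<rightarrow>\<^sub>E {..<p}. fdet n (\<lambda>i j. A i (f j)) * fdet n (\<lambda>i j. B i (f j))) / fact n"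
proof -
  let ?P = "{\<pi>. \<pi> permutes {..<n}}" and ?F = "{..<n} \<rightarrow>\<^sub>E {..<p}"
  \<comment> \<open>For a fixed permutation, \<open>f\<close> is replaced by its composite with the
    permutation, and the minor of \<open>B\<close> picks up the sign. Summation over all
    permutations then reconstitutes the minor of \<open>A\<close>.\<close>
  have eq: "gram n p A B = (\<Sum>f\<in>?F. signof \<pi> * (\<Prod>i<n. A i (f (\<pi> i))) * fdet n (\<lambda>i j. B i (f j)))"
    if \<pi>: "\<pi> permutes {..<n}" for \<pi>
  proof -
    have inv: "Hilbert_Choice.inv \<pi> permutes {..<n}" using \<pi> by (rule permutes_inv)
    have "gram n p A B = (\<Sum>f\<in>?F. (\<Prod>i<n. A i ((f \<circ> \<pi>) i)) * fdet n (\<lambda>i j. B i ((f \<circ> \<pi>) j)))"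
      unfolding gram_expand
    proof (rule sum.reindex_bij_witness[of _ "\<lambda>f. f \<circ> \<pi>" "\<lambda>f. f \<circ> Hilbert_Choice.inv \<pi>"], goal_cases)
      case (1 f) show ?case by (simp add: o_def permutes_inverses[OF \<pi>])
    next
      case (2 f) show ?case
      proof (rule PiE_I)
        fix x assume "x \<in> {..<n}"
        hence "Hilbert_Choice.inv \<pi> x \<in> {..<n}" using permutes_in_image[OF inv] by blast
        thus "(f \<circ> Hilbert_Choice.inv \<pi>) x \<in> {..<p}" using 2 by (auto simp: PiE_iff)
      next
        fix x assume "x \<notin> {..<n}"
        thus "(f \<circ> Hilbert_Choice.inv \<pi>) x = undefined" using permutes_not_in[OF inv] 2
          by (auto simp: PiE_iff extensional_def)
      qed
    next
      case (3 f) show ?case by (simp add: o_def permutes_inverses[OF \<pi>])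
    next
      case (4 f) show ?case
      proof (rule PiE_I)
        fix x assume "x \<in> {..<n}"
        hence "\<pi> x \<in> {..<n}" using permutes_in_image[OF \<pi>] by blast
        thus "(f \<circ> \<pi>) x \<in> {..<p}" using 4 by (auto simp: PiE_iff)
      next
        fix x assume "x \<notin> {..<n}"
        thus "(f \<circ> \<pi>) x = undefined" using permutes_not_in[OF \<pi>] 4
          by (auto simp: PiE_iff extensional_def)
      qed
    next
      case (5 f) show ?case by (simp add: o_def permutes_inverses[OF \<pi>])
    qed
    also have "\<dots> = (\<Sum>f\<in>?F. signof \<pi> * (\<Prod>i<n. A i (f (\<pi> i))) * fdet n (\<lambda>i j. B i (f j)))"
    proof (intro sum.cong refl)
      fix f
      show "(\<Prod>i<n. A i ((f \<circ> \<pi>) i)) * fdet n (\<lambda>i j. B i ((f \<circ> \<pi>) j)) =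
          signof \<pi> * (\<Prod>i<n. A i (f (\<pi> i))) * fdet n (\<lambda>i j. B i (f j))"
        using fdet_permute_cols[OF \<pi>, of "\<lambda>i j. B i (f j)"] by (simp add: o_def mult_ac)
    qed
    finally show ?thesis .
  qed
  have "fact n * gram n p A B = (\<Sum>\<pi>\<in>?P. gram n p A B)"
    using card_permutations[of "{..<n}" n] by simp
  also have "\<dots> = (\<Sum>\<pi>\<in>?P. \<Sum>f\<in>?F. signof \<pi> * (\<Prod>i<n. A i (f (\<pi> i))) * fdet n (\<lambda>i j. B i (f j)))"
    by (intro sum.cong refl eq) auto
  also have "\<dots> = (\<Sum>f\<in>?F. fdet n (\<lambda>i j. A i (f j)) * fdet n (\<lambda>i j. B i (f j)))"
  proof (subst sum.swap, intro sum.cong refl)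
    fix f
    show "(\<Sum>\<pi>\<in>?P. signof \<pi> * (\<Prod>i<n. A i (f (\<pi> i))) * fdet n (\<lambda>i j. B i (f j))) =
        fdet n (\<lambda>i j. A i (f j)) * fdet n (\<lambda>i j. B i (f j))"
      by (simp only: fdet_leibniz[of n "\<lambda>i j. A i (f j)"] sum_distrib_right)
  qed
  finally show ?thesis by (simp add: field_simps)
qed

section \<open>Elementary Schur polynomials\<close>

definition schur_fps :: "(nat \<Rightarrow> complex) \<Rightarrow> complex fps" where
  "schur_fps y = fps_exp 1 oo Abs_fps (\<lambda>n. if n = 0 then 0 else y n)"

lemma schur_fps_0 [simp]: "fps_nth (schur_fps y) 0 = 1"
  by (simp add: schur_fps_def)

lemma schur_fps_deriv: "fps_deriv (schur_fps y) = schur_fps y * fps_deriv (Abs_fps (\<lambda>n. if n = 0 then 0 else y n))"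
  unfolding schur_fps_def by (subst fps_compose_deriv) auto

text \<open>Coefficientwise form of \<open>F' = Y' F\<close> for \<open>F = exp Y\<close>.\<close>

lemma schur_fps_rec:
  "of_nat (Suc n) * fps_nth (schur_fps y) (Suc n) = (\<Sum>k\<le>n. of_nat (Suc k) * y (Suc k) * fps_nth (schur_fps y) (n - k))"
proof -
  have "of_nat (Suc n) * fps_nth (schur_fps y) (Suc n) = fps_nth (fps_deriv (schur_fps y)) n" by simp
  also have "\<dots> = (\<Sum>k\<le>n. of_nat (Suc k) * y (Suc k) * fps_nth (schur_fps y) (n - k))"
    unfolding schur_fps_deriv by (subst mult.commute) (simp add: fps_mult_nth atLeast0AtMost)
  finally show ?thesis .
qed

text \<open>The recursion together with the constant term 1 determines the series, so identities
  between exponentials reduce to checking the recursion.\<close>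

lemma schur_fps_uniqueI:
  assumes "fps_nth f 0 = 1"
    and "\<And>n. of_nat (Suc n) * fps_nth f (Suc n) = (\<Sum>k\<le>n. of_nat (Suc k) * y (Suc k) * fps_nth f (n - k))"
  shows "f = schur_fps y"
proof (rule fps_ext)
  fix n show "fps_nth f n = fps_nth (schur_fps y) n"
  proof (induction n rule: less_induct)
    case (less n)
    show ?case
    proof (cases n)
      case (Suc m)
      have "of_nat (Suc m) * fps_nth f (Suc m) = of_nat (Suc m) * fps_nth (schur_fps y) (Suc m)"
        unfolding assms(2) schur_fps_rec by (intro sum.cong refl) (simp add: less Suc)
      thus ?thesis unfolding Suc by (simp del: of_nat_Suc)
    qed (simp add: assms(1))
  qed
qed

lemma schur_fps_cong:
  assumes "\<And>k. 1 \<le> k \<Longrightarrow> k \<le> n \<Longrightarrow> y k = y' k"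
  shows "fps_nth (schur_fps y) n = fps_nth (schur_fps y') n"
  using assms
proof (induction n rule: less_induct)
  case (less n)
  show ?case
  proof (cases n)
    case (Suc m)
    have "of_nat (Suc m) * fps_nth (schur_fps y) (Suc m) = of_nat (Suc m) * fps_nth (schur_fps y') (Suc m)"
      unfolding schur_fps_rec
    proof (intro sum.cong refl)
      fix k assume "k \<in> {..m}"
      thus "of_nat (Suc k) * y (Suc k) * fps_nth (schur_fps y) (m - k) =
          of_nat (Suc k) * y' (Suc k) * fps_nth (schur_fps y') (m - k)"
        using less.IH[of "m - k"] less.prems by (simp add: Suc)
    qed
    thus ?thesis unfolding Suc by (simp del: of_nat_Suc)
  qed simp
qed

lemma schur_fps_add: "schur_fps (\<lambda>k. y k + y' k) = schur_fps y * schur_fps y'"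
proof (rule sym, rule schur_fps_uniqueI)
  fix n
  define Y where "Y = (\<lambda>y. Abs_fps (\<lambda>n. if n = 0 then 0 else y n :: complex))"
  have "fps_deriv (schur_fps y * schur_fps y') = fps_deriv (Y y + Y y') * (schur_fps y * schur_fps y')"
    by (simp add: schur_fps_deriv Y_def algebra_simps)
  hence "of_nat (Suc n) * fps_nth (schur_fps y * schur_fps y') (Suc n)
      = fps_nth (fps_deriv (Y y + Y y') * (schur_fps y * schur_fps y')) n"
    by (metis fps_deriv_nth Suc_eq_plus1)
  thus "of_nat (Suc n) * fps_nth (schur_fps y * schur_fps y') (Suc n) =
      (\<Sum>k\<le>n. of_nat (Suc k) * (y (Suc k) + y' (Suc k)) * fps_nth (schur_fps y * schur_fps y') (n - k))"
    unfolding fps_mult_nth[of _ "schur_fps y * schur_fps y'"] by (simp add: Y_def atLeast0AtMost algebra_simps)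
qed simp

text \<open>Substitution of \<open>s \<epsilon>\<close> for \<open>\<epsilon>\<close>; the source of
  the later parity and rescaling arguments.\<close>

lemma schur_fps_scale: "fps_nth (schur_fps (\<lambda>k. s ^ k * y k)) n = s ^ n * fps_nth (schur_fps y) n"
proof -
  have "Abs_fps (\<lambda>n. s ^ n * fps_nth (schur_fps y) n) = schur_fps (\<lambda>k. s ^ k * y k)"
  proof (rule schur_fps_uniqueI)
    fix n
    have "of_nat (Suc n) * fps_nth (Abs_fps (\<lambda>n. s ^ n * fps_nth (schur_fps y) n)) (Suc n)
        = s ^ Suc n * (of_nat (Suc n) * fps_nth (schur_fps y) (Suc n))"
      by (simp add: algebra_simps)
    also have "\<dots> = (\<Sum>k\<le>n. s ^ Suc n * (of_nat (Suc k) * y (Suc k) * fps_nth (schur_fps y) (n - k)))"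
      unfolding schur_fps_rec by (rule sum_distrib_left)
    also have "\<dots> = (\<Sum>k\<le>n. of_nat (Suc k) * (s ^ Suc k * y (Suc k)) *
        fps_nth (Abs_fps (\<lambda>n. s ^ n * fps_nth (schur_fps y) n)) (n - k))"
    proof (intro sum.cong refl)
      fix k assume "k \<in> {..n}"
      hence *: "s ^ Suc n = s ^ Suc k * s ^ (n - k)" by (simp flip: power_add)
      show "s ^ Suc n * (of_nat (Suc k) * y (Suc k) * fps_nth (schur_fps y) (n - k)) =
        of_nat (Suc k) * (s ^ Suc k * y (Suc k)) * fps_nth (Abs_fps (\<lambda>n. s ^ n * fps_nth (schur_fps y) n)) (n - k)"
        unfolding * by (simp only: fps_nth_Abs_fps mult_ac)
    qed
    finally show "of_nat (Suc n) * fps_nth (Abs_fps (\<lambda>n. s ^ n * fps_nth (schur_fps y) n)) (Suc n) =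
      (\<Sum>k\<le>n. of_nat (Suc k) * (s ^ Suc k * y (Suc k)) *
        fps_nth (Abs_fps (\<lambda>n. s ^ n * fps_nth (schur_fps y) n)) (n - k))" .
  qed simp
  from arg_cong[OF this, of "\<lambda>f. fps_nth f n"] show ?thesis by simp
qed

lemma schur_fps_even:
  assumes "\<And>k. odd k \<Longrightarrow> y k = 0" "odd n"
  shows "fps_nth (schur_fps y) n = 0"
proof -
  have "(-1) ^ k * y k = y k" for k using assms(1)[of k] by (cases "even k") auto
  hence "(\<lambda>k. (-1) ^ k * y k) = y" by (rule ext)
  from schur_fps_scale[of "-1" y n, unfolded this] assms(2) show ?thesis by simp
qed

lemma schur_fps_cnj: "fps_nth (schur_fps (\<lambda>k. cnj (y k))) n = cnj (fps_nth (schur_fps y) n)"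
proof -
  have "Abs_fps (\<lambda>n. cnj (fps_nth (schur_fps y) n)) = schur_fps (\<lambda>k. cnj (y k))"
  proof (rule schur_fps_uniqueI)
    fix n
    show "of_nat (Suc n) * fps_nth (Abs_fps (\<lambda>n. cnj (fps_nth (schur_fps y) n))) (Suc n) =
      (\<Sum>k\<le>n. of_nat (Suc k) * cnj (y (Suc k)) * fps_nth (Abs_fps (\<lambda>n. cnj (fps_nth (schur_fps y) n))) (n - k))"
      using arg_cong[OF schur_fps_rec[of n y], of cnj] by (simp add: cnj_sum)
  qed simp
  from arg_cong[OF this, of "\<lambda>f. fps_nth f n"] show ?thesis by simp
qed

text \<open>This is \<open>exp (ln (1 + a \<epsilon>))\<close> with the logarithm written out as a
  series.\<close>

lemma schur_fps_ln: "schur_fps (\<lambda>k. - ((- a) ^ k) / of_nat k) = 1 + fps_const a * fps_X"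
proof (rule sym, rule schur_fps_uniqueI)
  fix n
  let ?f = "1 + fps_const a * fps_X"
  have nth: "fps_nth ?f k = (if k = 0 then 1 else if k = 1 then a else 0)" for k
    by (cases k) auto
  show "of_nat (Suc n) * fps_nth ?f (Suc n) =
      (\<Sum>k\<le>n. of_nat (Suc k) * (- ((- a) ^ Suc k) / of_nat (Suc k)) * fps_nth ?f (n - k))"
  proof (cases n)
    case (Suc m)
    have "(\<Sum>k\<le>n. of_nat (Suc k) * (- ((- a) ^ Suc k) / of_nat (Suc k)) * fps_nth ?f (n - k))
        = (\<Sum>k\<in>{m, n}. - ((- a) ^ Suc k) * fps_nth ?f (n - k))"
      by (rule sum.mono_neutral_cong_right) (auto simp: nth Suc simp del: of_nat_Suc)
    thus ?thesis by (simp add: nth Suc)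
  qed (simp add: nth)
qed (simp)

lemma schur_fps_single:
  assumes "J \<ge> 1"
  shows "fps_nth (schur_fps (\<lambda>k. if k = J then b else 0)) n = (if J dvd n then b ^ (n div J) / fact (n div J) else 0)"
proof -
  have Y: "Abs_fps (\<lambda>n. if n = 0 then 0 else if n = J then b else 0) = fps_const b * fps_X ^ J"
    using assms by (intro fps_ext) (auto simp: fps_X_power_nth)
  have "fps_nth (schur_fps (\<lambda>k. if k = J then b else 0)) n = (\<Sum>i=0..n. b ^ i / fact i * (if n = J * i then 1 else 0))"
    unfolding schur_fps_def Y fps_compose_nth
  proof (intro sum.cong refl)
    fix i
    have "(fps_const b * fps_X ^ J) ^ i = fps_const (b ^ i) * fps_X ^ (J * i)"
      by (simp only: power_mult_distrib fps_const_power power_mult)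
    thus "fps_nth (fps_exp 1) i * fps_nth ((fps_const b * fps_X ^ J) ^ i) n =
        b ^ i / fact i * (if n = J * i then 1 else 0)"
      by (simp only:) (simp add: fps_X_power_nth)
  qed
  also have "\<dots> = (if J dvd n then b ^ (n div J) / fact (n div J) else 0)"
  proof (cases "J dvd n")
    case True
    then obtain i where i: "n = J * i" by blast
    have "i \<le> n" using assms i by (cases J) auto
    have "(\<Sum>j=0..n. b ^ j / fact j * (if n = J * j then 1 else 0)) = (\<Sum>j=0..n. if j = i then b ^ i / fact i else 0)"
      using assms by (intro sum.cong) (auto simp: i)
    thus ?thesis using assms True \<open>i \<le> n\<close> i by simp
  qed (auto intro!: sum.neutral)
  finally show ?thesis .
qed

text \<open>Exhibits the coefficient as a polynomial in \<open>r\<close>; this is what makes the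
  minors polynomials.\<close>

lemma schur_fps_smult:
  "fps_nth (schur_fps (\<lambda>k. r * y k)) n =
    (\<Sum>i\<le>n. r ^ i * (fps_nth (Abs_fps (\<lambda>n. if n = 0 then 0 else y n) ^ i) n / fact i))"
proof -
  have Y: "Abs_fps (\<lambda>n. if n = 0 then 0 else r * y n) = fps_const r * Abs_fps (\<lambda>n. if n = 0 then 0 else y n)"
    by (rule fps_ext) auto
  show ?thesis unfolding schur_fps_def Y fps_compose_nth power_mult_distrib fps_const_power atLeast0AtMost
    by (intro sum.cong refl) simp
qed

lemma schur_fps_linear:
  "fps_nth (schur_fps (\<lambda>k. (if k = 1 then z else 0) + y k)) n = (\<Sum>i\<le>n. z ^ i / fact i * fps_nth (schur_fps y) (n - i))"
  using schur_fps_single[of 1 z] by (simp add: schur_fps_add fps_mult_nth atLeast0AtMost)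

section \<open>Lower triangular Toeplitz matrices of power series\<close>

definition toep :: "complex fps \<Rightarrow> nat \<Rightarrow> nat \<Rightarrow> complex" where
  "toep F i v = (if v \<le> i then fps_nth F (i - v) else 0)"

lemma toep_schur: "schur y (int i - int v) = toep (schur_fps y) i v"
  by (auto simp: schur_def toep_def schur_fps_def simp flip: of_nat_diff)

lemma toep_shift [simp]: "toep F (k + i) (k + v) = toep F i v"
  by (simp add: toep_def)

text \<open>Products of series are products of Toeplitz matrices; cutting the sum at
  \<open>n\<close> loses nothing because \<open>toep F i k\<close> vanishes for
  \<open>k > i\<close>.\<close>

lemma toep_mult:
  assumes "i < n"
  shows "toep (F * G) i v = (\<Sum>k<n. toep F i k * toep G k v)"
proof (cases "v \<le> i")
  case True
  have "toep (F * G) i v = (\<Sum>j=0..i-v. fps_nth F (i - v - j) * fps_nth G j)"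
    using True fps_mult_nth[of G F "i - v"] by (simp add: toep_def mult.commute)
  also have "\<dots> = (\<Sum>k\<in>{v..i}. toep F i k * toep G k v)"
    by (rule sum.reindex_bij_witness[of _ "\<lambda>k. k - v" "\<lambda>j. j + v"]) (use True in \<open>auto simp: toep_def add.commute\<close>)
  also have "\<dots> = (\<Sum>k<n. toep F i k * toep G k v)"
    using assms by (intro sum.mono_neutral_left) (auto simp: toep_def)
  finally show ?thesis .
next
  case False
  hence "(\<Sum>k<n. toep F i k * toep G k v) = 0"
    by (intro sum.neutral) (auto simp: toep_def)
  thus ?thesis using False by (simp add: toep_def)
qed

text \<open>An even series relates only indices of equal parity, and after the common shift by
  \<open>c\<close> both parities see the same matrix. So multiplication by an even series is a row
  operation within the rows of one parity.\<close>

lemma toep_even_mult: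
  assumes "i < n" "c < 2" "\<And>k. odd k \<Longrightarrow> fps_nth V k = 0"
  shows "toep (V * F) (2 * i + c) v = (\<Sum>k<n. toep V (2 * i) (2 * k) * toep F (2 * k + c) v)"
proof -
  have "toep (V * F) (2 * i + c) v = (\<Sum>k<2*n. toep V (2 * i + c) k * toep F k v)"
    using assms by (intro toep_mult) auto
  also have "\<dots> = (\<Sum>k\<in>(\<lambda>k. 2 * k + c) ` {..<n}. toep V (2 * i + c) k * toep F k v)"
  proof (intro sum.mono_neutral_right ballI)
    fix k assume k: "k \<in> {..<2*n} - (\<lambda>k. 2 * k + c) ` {..<n}"
    have "odd (2 * i + c - k)" if "k \<le> 2 * i + c"
    proof (rule ccontr)
      assume "\<not> odd (2 * i + c - k)"
      with that have "even (c + k)" by presburger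
      hence "k = 2 * (k div 2) + c" using assms(2) by presburger
      moreover have "k div 2 < n" using k by auto
      ultimately show False using k by blast
    qed
    thus "toep V (2 * i + c) k * toep F k v = 0" using assms(3) by (auto simp: toep_def)
  qed (use assms in auto)
  also have "\<dots> = (\<Sum>k<n. toep V (2 * i) (2 * k) * toep F (2 * k + c) v)"
  proof (subst sum.reindex)
    have "toep V (2 * i + c) (2 * k + c) = toep V (2 * i) (2 * k)" for k
      using toep_shift[of V c "2 * i" "2 * k"] by (simp only: add.commute)
    thus "sum ((\<lambda>k. toep V (2 * i + c) k * toep F k v) \<circ> (\<lambda>k. 2 * k + c)) {..<n} =
        (\<Sum>k<n. toep V (2 * i) (2 * k) * toep F (2 * k + c) v)"
      by simp
  qed (auto simp: inj_on_def)
  finally show ?thesis .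
qed

lemma fdet_toep_even:
  assumes "fps_nth V 0 = 1"
  shows "fdet n (\<lambda>i k. toep V (2 * i) (2 * k)) = 1"
  by (subst fdet_lower_triangular) (auto simp: toep_def assms)

text \<open>Origin of the even rows: with \<open>w\<close> large, the multiple \<open>w\<close> of
  row \<open>2 i\<close> dominates row \<open>2 i + 1\<close>.\<close>

lemma toep_linear_mult:
  "toep ((1 + fps_const w * fps_X) * G) (2 * i + 1) l = toep G (2 * i + 1) l + w * toep G (2 * i) l"
proof -
  have nth: "fps_nth ((1 + fps_const w * fps_X) * G) n = fps_nth G n + w * (if n = 0 then 0 else fps_nth G (n - 1))" for n
    by (simp add: distrib_right mult.assoc)
  show ?thesis
  proof (cases "l \<le> 2 * i")
    case True
    thus ?thesis by (simp add: toep_def nth Suc_diff_le)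
  qed (auto simp: toep_def nth)
qed

section \<open>Gram form of the tau functions\<close>

lemma tanh_ratio_mult: "tanh_ratio_fps * (fps_X * (fps_exp 1 + 1)) = fps_const 2 * (fps_exp 1 - 1)"
proof -
  let ?D = "fps_X * (fps_exp 1 + 1) :: complex fps" and ?A = "fps_const 2 * (fps_exp 1 - 1) :: complex fps"
  have "fps_nth ?D 1 \<noteq> 0" "fps_nth ?A 1 \<noteq> 0" by simp_all
  hence nz: "?D \<noteq> 0" "?A \<noteq> 0" by (metis fps_zero_nth)+
  \<comment> \<open>The division defining \<open>tanh_ratio_fps\<close> is exact because the
    subdegree of the divisor does not exceed that of the dividend.\<close>
  have "subdegree ?D \<le> 1" using \<open>fps_nth ?D 1 \<noteq> 0\<close> by (rule subdegree_leI)
  also have "1 \<le> subdegree ?A" using nz(2) by (intro subdegree_geI) auto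
  finally have "?D dvd ?A" using fps_dvd_iff[OF nz] by simp
  thus ?thesis unfolding tanh_ratio_fps_def by (rule dvd_div_mult_self)
qed

lemma tanh_ratio_eqI:
  assumes "f * (fps_X * (fps_exp 1 + 1)) = fps_const 2 * (fps_exp 1 - 1)"
  shows "f = tanh_ratio_fps"
proof -
  have "fps_nth (fps_X * (fps_exp 1 + 1) :: complex fps) 1 \<noteq> 0" by simp
  hence "fps_X * (fps_exp 1 + 1) \<noteq> (0 :: complex fps)" by (metis fps_zero_nth)
  thus ?thesis using assms tanh_ratio_mult by (metis mult_right_cancel)
qed

text \<open>The sign change of \<open>\<epsilon>\<close>, followed by multiplication by
  \<open>- exp \<epsilon>\<close>, maps the defining equation to itself, and that equation has only
  one solution.\<close>

lemma tanh_ratio_odd: "odd n \<Longrightarrow> fps_nth tanh_ratio_fps n = 0"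
proof -
  define \<sigma> where "\<sigma> = (\<lambda>F. Abs_fps (\<lambda>n. (-1) ^ n * fps_nth F n :: complex))"
  have \<sigma>_mult: "\<sigma> (F * G) = \<sigma> F * \<sigma> G" for F G
  proof (rule fps_ext)
    fix n
    have "(-1) ^ n * fps_nth (F * G) n = (\<Sum>i=0..n. (-1) ^ n * (fps_nth F i * fps_nth G (n - i)))"
      by (simp add: fps_mult_nth sum_distrib_left)
    also have "\<dots> = (\<Sum>i=0..n. ((-1) ^ i * fps_nth F i) * ((-1) ^ (n - i) * fps_nth G (n - i)))"
    proof (intro sum.cong refl)
      fix i assume "i \<in> {0..n}"
      hence "(-1) ^ n = (-1) ^ i * ((-1) ^ (n - i) :: complex)" by (simp flip: power_add)
      thus "(-1) ^ n * (fps_nth F i * fps_nth G (n - i)) =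
        ((-1) ^ i * fps_nth F i) * ((-1) ^ (n - i) * fps_nth G (n - i))" by simp
    qed
    finally show "fps_nth (\<sigma> (F * G)) n = fps_nth (\<sigma> F * \<sigma> G) n" by (simp add: \<sigma>_def fps_mult_nth)
  qed
  have e: "\<sigma> (fps_exp 1) = fps_exp (-1)" by (rule fps_ext) (simp add: \<sigma>_def)
  have inv: "fps_exp 1 * fps_exp (-1) = (1 :: complex fps)"
    using fps_exp_add_mult[of 1 "-1 :: complex"] by simp
  have D: "\<sigma> (fps_X * (fps_exp 1 + 1)) = - (fps_X * (fps_exp (-1) + 1))"
  proof -
    have "\<sigma> fps_X = - fps_X" by (rule fps_ext) (simp add: \<sigma>_def fps_X_def)
    moreover have "\<sigma> (fps_exp 1 + 1) = fps_exp (-1) + 1" by (rule fps_ext) (simp add: \<sigma>_def)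
    ultimately show ?thesis by (simp add: \<sigma>_mult)
  qed
  have A: "\<sigma> (fps_const 2 * (fps_exp 1 - 1)) = fps_const 2 * (fps_exp (-1) - 1)"
    by (rule fps_ext) (simp add: \<sigma>_def)
  have "\<sigma> tanh_ratio_fps * (- (fps_X * (fps_exp (-1) + 1))) = fps_const 2 * (fps_exp (-1) - 1)"
    using arg_cong[OF tanh_ratio_mult, of \<sigma>] unfolding \<sigma>_mult[of tanh_ratio_fps] D A .
  hence "\<sigma> tanh_ratio_fps * (- (fps_X * (fps_exp (-1) + 1))) * (- fps_exp 1) =
      fps_const 2 * (fps_exp (-1) - 1) * (- fps_exp 1)" by simp
  also have "\<sigma> tanh_ratio_fps * (- (fps_X * (fps_exp (-1) + 1))) * (- fps_exp 1) =
      \<sigma> tanh_ratio_fps * (fps_X * (fps_exp 1 * fps_exp (-1) + fps_exp 1))" by (simp add: algebra_simps)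
  also have "\<dots> = \<sigma> tanh_ratio_fps * (fps_X * (fps_exp 1 + 1))" unfolding inv by (simp add: algebra_simps)
  also have "fps_const 2 * (fps_exp (-1) - 1) * (- fps_exp 1) = fps_const 2 * (fps_exp 1 - fps_exp 1 * fps_exp (-1 :: complex))"
    by (simp add: algebra_simps)
  also have "\<dots> = fps_const 2 * (fps_exp 1 - 1)" unfolding inv ..
  finally have "\<sigma> tanh_ratio_fps = tanh_ratio_fps" by (rule tanh_ratio_eqI)
  hence "fps_nth (\<sigma> tanh_ratio_fps) n = fps_nth tanh_ratio_fps n" by (rule arg_cong)
  moreover assume "odd n"
  ultimately show ?thesis by (simp add: \<sigma>_def)
qed

definition cnj_fps :: "complex fps \<Rightarrow> complex fps" where
  "cnj_fps F = Abs_fps (\<lambda>n. cnj (fps_nth F n))"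

lemma cnj_fps_mult: "cnj_fps (F * G) = cnj_fps F * cnj_fps G"
  by (rule fps_ext) (simp add: cnj_fps_def fps_mult_nth cnj_sum)

lemma cnj_fps_power: "cnj_fps (F ^ i) = cnj_fps F ^ i"
  by (induction i) (simp_all add: cnj_fps_mult, simp add: cnj_fps_def fps_eq_iff)

lemma cnj_fps_tanh_ratio: "cnj_fps tanh_ratio_fps = tanh_ratio_fps"
proof (rule tanh_ratio_eqI)
  have D: "cnj_fps (fps_X * (fps_exp 1 + 1)) = fps_X * (fps_exp 1 + 1)"
    unfolding cnj_fps_mult by (intro arg_cong2[where f = times] fps_ext) (simp_all add: cnj_fps_def fps_X_def)
  have A: "cnj_fps (fps_const 2 * (fps_exp 1 - 1)) = fps_const 2 * (fps_exp 1 - 1)"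
    by (rule fps_ext) (simp add: cnj_fps_def)
  show "cnj_fps tanh_ratio_fps * (fps_X * (fps_exp 1 + 1)) = fps_const 2 * (fps_exp 1 - 1)"
    using arg_cong[OF tanh_ratio_mult, of cnj_fps] unfolding cnj_fps_mult[of tanh_ratio_fps] D A .
qed

lemma fps_ln_1_nth: "fps_nth (fps_ln 1) i = (of_real (if i = 0 then 0 else (-1) ^ (i - 1) / real i) :: complex)"
  by (simp add: fps_ln_def)

lemma svec_eq: "svec l = (\<Sum>i=0..l. fps_nth (fps_ln 1) i * fps_nth ((tanh_ratio_fps - 1) ^ i) l)"
  by (simp add: svec_def fps_compose_nth)

lemma svec_odd:
  assumes "odd l" shows "svec l = 0"
proof -
  have odd1: "odd n \<Longrightarrow> fps_nth (tanh_ratio_fps - 1) n = 0" for n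
    by (cases n) (auto simp: tanh_ratio_odd)
  have "odd n \<Longrightarrow> fps_nth ((tanh_ratio_fps - 1) ^ i) n = 0" for i n
  proof (induction i arbitrary: n)
    case 0 thus ?case by (cases n) auto
  next
    case (Suc i)
    have "fps_nth (tanh_ratio_fps - 1) k * fps_nth ((tanh_ratio_fps - 1) ^ i) (n - k) = 0" if "k \<le> n" for k
      using odd1[of k] Suc.IH[of "n - k"] Suc.prems that by (cases "odd k") auto
    thus ?case by (auto simp: fps_mult_nth simp del: fps_sub_nth intro!: sum.neutral)
  qed
  thus ?thesis using assms by (simp add: svec_eq)
qed

lemma cnj_svec: "cnj (svec l) = svec l"
proof -
  have "cnj_fps (tanh_ratio_fps - 1) = tanh_ratio_fps - 1"
    using arg_cong[OF cnj_fps_tanh_ratio, of "\<lambda>F. F - 1"] by (simp add: cnj_fps_def fps_eq_iff)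
  hence "cnj_fps ((tanh_ratio_fps - 1) ^ i) = (tanh_ratio_fps - 1) ^ i" for i
    by (simp add: cnj_fps_power)
  hence "cnj (fps_nth ((tanh_ratio_fps - 1) ^ i) l) = fps_nth ((tanh_ratio_fps - 1) ^ i) l" for i
    by (metis cnj_fps_def fps_nth_Abs_fps)
  thus ?thesis by (simp add: svec_eq cnj_sum fps_ln_1_nth)
qed

text \<open>The power \<open>((2/\<epsilon>) tanh (\<epsilon>/2))^v\<close>, an even series.\<close>

definition svec_exp :: "nat \<Rightarrow> complex fps" where
  "svec_exp v = schur_fps (\<lambda>k. of_nat v * svec k)"

lemma svec_exp_0 [simp]: "fps_nth (svec_exp v) 0 = 1"
  by (simp add: svec_exp_def)

lemma svec_exp_odd: "odd n \<Longrightarrow> fps_nth (svec_exp v) n = 0"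
  unfolding svec_exp_def by (rule schur_fps_even) (auto simp: svec_odd)

lemma svec_exp_add: "svec_exp (v + w) = svec_exp v * svec_exp w"
  by (simp add: svec_exp_def distrib_right flip: schur_fps_add)

text \<open>The factor \<open>4^(-v)\<close> of the tau entries is split evenly between the two
  sides. Column \<open>v\<close> carries its own twist \<open>svec_exp v\<close>, so the matrix is
  not Toeplitz; factors of \<open>F\<close> nevertheless act from the left as row
  operations.\<close>

definition schur_mat :: "complex fps \<Rightarrow> nat \<Rightarrow> nat \<Rightarrow> complex" where
  "schur_mat F i v = (1/2) ^ v * toep (F * svec_exp v) i v"

definition odd_row :: "complex fps \<Rightarrow> nat \<Rightarrow> nat \<Rightarrow> complex" where
  "odd_row F i = schur_mat F (2 * i + 1)"

lemma schur_mat_eq_0: "i < v \<Longrightarrow> schur_mat F i v = 0"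
  by (simp add: schur_mat_def toep_def)

lemma schur_mat_diag: "fps_nth F 0 = 1 \<Longrightarrow> schur_mat F i i = (1/2) ^ i"
  by (simp add: schur_mat_def toep_def)

lemma schur_mat_mult:
  assumes "i < n"
  shows "schur_mat (F * G) i v = (\<Sum>k<n. toep F i k * schur_mat G k v)"
  using toep_mult[OF assms, of F "G * svec_exp v" v] by (simp add: schur_mat_def mult.assoc sum_distrib_left mult.left_commute)

lemma schur_mat_cong:
  assumes "\<And>k. k \<le> i \<Longrightarrow> fps_nth F k = fps_nth G k"
  shows "schur_mat F i v = schur_mat G i v"
  using assms by (auto simp: schur_mat_def toep_def fps_mult_nth intro!: sum.cong)

text \<open>Terms with \<open>v\<close> above a row index vanish, so the sum up to
  \<open>min i j\<close> extends to all \<open>2 N\<close> columns \<open>0, ..., 2 N - 1\<close>,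
  where \<open>2 N - 1\<close> is the largest row index.\<close>

lemma tau_gram: "tau N a x t n = gram N (2 * N) (odd_row (schur_fps (xplus a x t n))) (odd_row (schur_fps (xminus a x t n)))"
proof -
  have "tau_entry a x t n (2 * i + 1) (2 * j + 1) =
      (\<Sum>v<2*N. odd_row (schur_fps (xplus a x t n)) i v * odd_row (schur_fps (xminus a x t n)) j v)"
    if "i < N" "j < N" for i j
  proof -
    have half: "(1/4 :: complex) ^ v = (1/2) ^ v * (1/2) ^ v" for v
      by (simp flip: power_mult_distrib)
    have "tau_entry a x t n (2 * i + 1) (2 * j + 1) = (\<Sum>v=0..min (2*i+1) (2*j+1).
        odd_row (schur_fps (xplus a x t n)) i v * odd_row (schur_fps (xminus a x t n)) j v)"
      unfolding tau_entry_def toep_schur odd_row_def schur_mat_def svec_exp_def half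
      by (intro sum.cong refl) (simp add: mult_ac flip: schur_fps_add)
    also have "\<dots> = (\<Sum>v<2*N. odd_row (schur_fps (xplus a x t n)) i v * odd_row (schur_fps (xminus a x t n)) j v)"
      using that by (intro sum.mono_neutral_left) (auto simp: odd_row_def schur_mat_eq_0 min_def split: if_splits)
    finally show ?thesis .
  qed
  thus ?thesis unfolding tau_def gram_def fdet_def[symmetric] by (intro fdet_cong) auto
qed

lemma gram_odd_row_even_left:
  assumes "fps_nth V 0 = 1" "\<And>k. odd k \<Longrightarrow> fps_nth V k = 0"
  shows "gram N p (odd_row (V * F)) B = gram N p (odd_row F) B"
proof -
  have "gram N p (odd_row (V * F)) B = fdet N (\<lambda>i k. toep V (2 * i) (2 * k)) * gram N p (odd_row F) B"
  proof (rule gram_left)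
    fix i v assume "i < N"
    thus "odd_row (V * F) i v = (\<Sum>k<N. toep V (2 * i) (2 * k) * odd_row F k v)"
      using toep_even_mult[of i N 1 V "F * svec_exp v" v] assms(2)
      by (simp add: odd_row_def schur_mat_def mult.assoc sum_distrib_left mult.left_commute)
  qed
  thus ?thesis using assms(1) by (simp add: fdet_toep_even)
qed

lemma gram_odd_row_even_right:
  assumes "fps_nth V 0 = 1" "\<And>k. odd k \<Longrightarrow> fps_nth V k = 0"
  shows "gram N p A (odd_row (V * F)) = gram N p A (odd_row F)"
  using gram_odd_row_even_left[OF assms, where N = N and p = p and F = F and B = A]
  by (subst (1 2) gram_commute) simp

text \<open>\<open>exp (artanh (w \<epsilon>))\<close> equals
  \<open>(1 - w^2 \<epsilon>^2)^(-1/2) (1 + w \<epsilon>)\<close>; the even factor \<open>V\<close>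
  is the exponential of the even part of \<open>- ln (1 - w \<epsilon>)\<close>.\<close>

lemma schur_fps_artanh:
  obtains V where "fps_nth V 0 = 1" "\<And>k. odd k \<Longrightarrow> fps_nth V k = 0"
    "schur_fps (\<lambda>k. if odd k then w ^ k / of_nat k else 0) = V * (1 + fps_const w * fps_X)"
proof
  define V where "V = schur_fps (\<lambda>k. if even k then w ^ k / of_nat k else 0)"
  show "fps_nth V 0 = 1" by (simp add: V_def)
  show "fps_nth V k = 0" if "odd k" for k unfolding V_def by (rule schur_fps_even) (use that in auto)
  have "(\<lambda>k. if odd k then w ^ k / of_nat k else 0) =
      (\<lambda>k. (if even k then w ^ k / of_nat k else 0) + - ((- w) ^ k) / of_nat k)"
    by (auto simp: fun_eq_iff)
  thus "schur_fps (\<lambda>k. if odd k then w ^ k / of_nat k else 0) = V * (1 + fps_const w * fps_X)"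
    by (simp only: schur_fps_add schur_fps_ln V_def)
qed

text \<open>Knowing \<open>y\<close> below \<open>2 N\<close> is enough because no row index exceeds
  \<open>2 N - 1\<close>.\<close>

lemma gram_odd_row_reduce:
  assumes "\<And>k. 1 \<le> k \<Longrightarrow> k < 2 * N \<Longrightarrow> y k = (if odd k then w ^ k / of_nat k else 0) + e k"
  shows "gram N p (odd_row (schur_fps y)) B = gram N p (odd_row ((1 + fps_const w * fps_X) * schur_fps e)) B"
    and "gram N p B (odd_row (schur_fps y)) = gram N p B (odd_row ((1 + fps_const w * fps_X) * schur_fps e))"
proof -
  obtain V where V: "fps_nth V 0 = 1" "\<And>k. odd k \<Longrightarrow> fps_nth V k = 0"
    "schur_fps (\<lambda>k. if odd k then w ^ k / of_nat k else 0) = V * (1 + fps_const w * fps_X)"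
    using schur_fps_artanh[of w] by metis
  have eq: "odd_row (schur_fps y) i v = odd_row (V * ((1 + fps_const w * fps_X) * schur_fps e)) i v" if "i < N" for i v
    unfolding odd_row_def
  proof (rule schur_mat_cong)
    fix k assume "k \<le> 2 * i + 1"
    hence "fps_nth (schur_fps y) k = fps_nth (schur_fps (\<lambda>k. (if odd k then w ^ k / of_nat k else 0) + e k)) k"
      using that by (intro schur_fps_cong assms) auto
    thus "fps_nth (schur_fps y) k = fps_nth (V * ((1 + fps_const w * fps_X) * schur_fps e)) k"
      by (simp only: schur_fps_add V(3) mult.assoc)
  qed
  show "gram N p (odd_row (schur_fps y)) B = gram N p (odd_row ((1 + fps_const w * fps_X) * schur_fps e)) B"
    by (subst gram_cong[OF eq refl], assumption, rule gram_odd_row_even_left) (fact V(1), erule V(2))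
  show "gram N p B (odd_row (schur_fps y)) = gram N p B (odd_row ((1 + fps_const w * fps_X) * schur_fps e))"
    by (subst gram_cong[OF refl eq], assumption, rule gram_odd_row_even_right) (fact V(1), erule V(2))
qed

section \<open>Staircase rows and the tau function of lower order\<close>

definition iota :: "nat \<Rightarrow> nat \<Rightarrow> nat" where
  "iota K i = (if i < K then i else K + 1 + 2 * (i - K))"

lemma gram_scale:
  "gram n p (\<lambda>i v. c i * A i v) (\<lambda>i v. d i * B i v) = (\<Prod>i<n. c i) * (\<Prod>i<n. d i) * gram n p A B"
proof -
  have "gram n p (\<lambda>i v. c i * A i v) (\<lambda>i v. d i * B i v) = fdet n (\<lambda>i j. c i * (\<Sum>v<p. A i v * B j v) * d j)"
    unfolding gram_def by (intro fdet_cong) (simp add: sum_distrib_left mult_ac)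
  thus ?thesis by (simp add: fdet_scale gram_def)
qed

text \<open>The powers of \<open>1/4\<close> come from the diagonal entries \<open>2^(-i)\<close> of
  both factors and from the factor \<open>2^(-K)\<close> in each of the \<open>M\<close> remaining
  rows on both sides.\<close>

definition iota_const :: "nat \<Rightarrow> nat \<Rightarrow> complex" where
  "iota_const K M = (\<Prod>i<K. (1/4) ^ i) * (1/4) ^ (K * M)"

lemma iota_const_nonzero: "iota_const K M \<noteq> 0"
  by (simp add: iota_const_def)

text \<open>The rows \<open>0, ..., K - 1\<close> form a triangular block and split off. With the
  origin moved by \<open>K\<close>, the rows \<open>K + 1 + 2 i\<close> become odd rows again; the
  column twists change by \<open>svec_exp K\<close>, which is even and drops out. This is why the
  staircase yields a tau function of order \<open>M\<close>.\<close>

lemma gram_iota: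
  assumes "fps_nth F 0 = 1" "fps_nth G 0 = 1"
  shows "gram (K + M) (2 * (K + M)) (\<lambda>i. schur_mat F (iota K i)) (\<lambda>i. schur_mat G (iota K i)) =
    iota_const K M * gram M (2 * M) (odd_row F) (odd_row G)"
proof -
  have half: "(1/2 :: complex) ^ v * (1/2) ^ v = (1/4) ^ v" for v
    by (simp flip: power_mult_distrib)
  have shift: "schur_mat F (iota K (K + i)) (K + v) = (1/2) ^ K * odd_row (svec_exp K * F) i v" for F i v
  proof -
    have "iota K (K + i) = K + (2 * i + 1)" by (simp add: iota_def)
    thus ?thesis
      by (simp only: schur_mat_def odd_row_def toep_shift svec_exp_add power_add mult_ac)
  qed
  have "gram (K + M) (K + (K + 2 * M)) (\<lambda>i. schur_mat F (iota K i)) (\<lambda>i. schur_mat G (iota K i)) =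
     (\<Prod>i<K. schur_mat F (iota K i) i * schur_mat G (iota K i) i) *
     gram M (K + 2 * M) (\<lambda>i v. schur_mat F (iota K (K + i)) (K + v)) (\<lambda>i v. schur_mat G (iota K (K + i)) (K + v))"
    by (rule gram_lower_triangular_block) (auto simp: iota_def schur_mat_eq_0 schur_mat_diag assms)
  also have "(\<Prod>i<K. schur_mat F (iota K i) i * schur_mat G (iota K i) i) = (\<Prod>i<K. (1/4) ^ i)"
    by (intro prod.cong) (auto simp: iota_def schur_mat_diag assms half)
  also have "gram M (K + 2 * M) (\<lambda>i v. schur_mat F (iota K (K + i)) (K + v)) (\<lambda>i v. schur_mat G (iota K (K + i)) (K + v)) =
      (1/4) ^ (K * M) * gram M (K + 2 * M) (odd_row (svec_exp K * F)) (odd_row (svec_exp K * G))"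
    unfolding shift gram_scale by (simp add: power_mult flip: half, simp add: power_mult_distrib)
  also have "gram M (K + 2 * M) (odd_row (svec_exp K * F)) (odd_row (svec_exp K * G)) = gram M (K + 2 * M) (odd_row F) (odd_row G)"
    by (simp add: gram_odd_row_even_left gram_odd_row_even_right svec_exp_odd)
  also have "\<dots> = gram M (2 * M) (odd_row F) (odd_row G)"
    by (rule gram_more_cols) (auto simp: odd_row_def schur_mat_eq_0)
  finally show ?thesis by (simp add: iota_const_def mult_2 mult_ac add_ac)
qed

text \<open>Special to \<open>n = 0\<close>: the shift by \<open>n\<close> enters the two first
  components with opposite signs, so for \<open>n = 1\<close> the vectors are not conjugate.\<close>

lemma xminus_cnj: "xminus a x t 0 k = cnj (xplus a x t 0 k)"
  by (simp add: xminus_def xplus_def)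

lemma odd_row_cnj: "odd_row (schur_fps (\<lambda>k. cnj (y k))) i v = cnj (odd_row (schur_fps y) i v)"
proof -
  have "schur_fps (\<lambda>k. cnj (y k)) * svec_exp v = cnj_fps (schur_fps y * svec_exp v)"
    unfolding cnj_fps_mult
    by (intro arg_cong2[where f = times] fps_ext) (simp_all add: cnj_fps_def schur_fps_cnj svec_exp_def cnj_svec flip: schur_fps_cnj)
  thus ?thesis by (simp add: odd_row_def schur_mat_def toep_def cnj_fps_def)
qed

lemma cnj_fdet: "cnj (fdet n A) = fdet n (\<lambda>i j. cnj (A i j))"
  by (simp add: fdet_leibniz cnj_sum cnj_prod)

text \<open>Cauchy-Binet writes the tau function for \<open>n = 0\<close> as a sum of squares, one of which is constant.\<close>

lemma tau_0_lower_bound: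
  obtains c where "c > 0" "\<And>a x t. c \<le> cmod (tau N a x t 0)"
proof
  define c where "c = (\<Prod>i<N. (1/2 :: real) ^ (2 * i + 1)) ^ 2 / fact N"
  show "c > 0" by (simp add: c_def prod_pos)
  fix a x t
  define A where "A = odd_row (schur_fps (xplus a x t 0))"
  \<comment> \<open>The columns \<open>2 i + 1\<close> are the diagonal positions of the odd rows:
    this minor is triangular with diagonal \<open>2^(-(2 i + 1))\<close>, whatever the
    parameters.\<close>
  define f0 where "f0 = (\<lambda>i\<in>{..<N}. 2 * i + 1)"
  let ?d = "\<lambda>f. fdet N (\<lambda>i j. A i (f j))"
  have f0: "f0 \<in> {..<N} \<rightarrow>\<^sub>E {..<2*N}" by (auto simp: f0_def)
  have "?d f0 = (\<Prod>i<N. (1/2) ^ (2 * i + 1))"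
  proof -
    have "?d f0 = (\<Prod>i<N. A i (f0 i))"
      by (rule fdet_lower_triangular) (auto simp: A_def odd_row_def f0_def schur_mat_eq_0)
    also have "\<dots> = (\<Prod>i<N. (1/2) ^ (2 * i + 1))"
      by (rule prod.cong) (auto simp: A_def odd_row_def f0_def schur_mat_diag simp del: power_Suc)
    finally show ?thesis .
  qed
  hence "cmod (?d f0) = (\<Prod>i<N. (1/2) ^ (2 * i + 1))"
    by (simp add: norm_power norm_divide norm_mult flip: prod_norm)
  hence c: "c = cmod (?d f0) ^ 2 / fact N" by (simp add: c_def)
  have B: "odd_row (schur_fps (xminus a x t 0)) = (\<lambda>i v. cnj (A i v))"
    unfolding A_def odd_row_cnj[symmetric] by (simp add: xminus_cnj[abs_def])
  have "tau N a x t 0 = (\<Sum>f\<in>{..<N} \<rightarrow>\<^sub>E {..<2*N}. ?d f * cnj (?d f)) / fact N"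
    unfolding tau_gram B cauchy_binet A_def[symmetric] cnj_fdet ..
  also have "\<dots> = of_real ((\<Sum>f\<in>{..<N} \<rightarrow>\<^sub>E {..<2*N}. cmod (?d f) ^ 2) / fact N)"
    by (simp only: of_real_divide of_real_sum complex_norm_square of_real_fact)
  finally have "cmod (tau N a x t 0) = (\<Sum>f\<in>{..<N} \<rightarrow>\<^sub>E {..<2*N}. cmod (?d f) ^ 2) / fact N"
    by (simp only: norm_of_real) (simp add: sum_nonneg)
  moreover have "cmod (?d f0) ^ 2 \<le> (\<Sum>f\<in>{..<N} \<rightarrow>\<^sub>E {..<2*N}. cmod (?d f) ^ 2)"
    by (rule member_le_sum[OF f0]) (auto intro: finite_PiE)
  ultimately show "c \<le> cmod (tau N a x t 0)" unfolding c by (simp add: divide_right_mono)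
qed

section \<open>Uniform asymptotic comparison\<close>

text \<open>Boundedness is part of the relation so that it is compatible with products.\<close>

definition close :: "'a filter \<Rightarrow> ('a \<Rightarrow> complex) \<Rightarrow> ('a \<Rightarrow> complex) \<Rightarrow> ('a \<Rightarrow> complex) \<Rightarrow> bool" where
  "close F h f g \<longleftrightarrow> f \<in> O[F](\<lambda>_. 1) \<and> g \<in> O[F](\<lambda>_. 1) \<and> (\<lambda>x. f x - g x) \<in> O[F](h)"

lemma close_refl: "f \<in> O[F](\<lambda>_. 1) \<Longrightarrow> close F h f f"
  by (simp add: close_def)

lemma close_const [simp]: "close F h (\<lambda>_. c) (\<lambda>_. c)"
  by (rule close_refl) simp

lemma close_add:
  assumes "close F h f f'" "close F h g g'"
  shows "close F h (\<lambda>x. f x + g x) (\<lambda>x. f' x + g' x)"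
proof -
  have "(\<lambda>x. (f x - f' x) + (g x - g' x)) \<in> O[F](h)"
    using assms sum_in_bigo(1)[of "\<lambda>x. f x - f' x" F h "\<lambda>x. g x - g' x"] by (simp add: close_def)
  thus ?thesis using assms unfolding close_def by (auto intro: sum_in_bigo simp: algebra_simps)
qed

lemma close_mult:
  assumes "close F h f f'" "close F h g g'"
  shows "close F h (\<lambda>x. f x * g x) (\<lambda>x. f' x * g' x)"
proof -
  have mult1: "(\<lambda>x. a x * b x) \<in> O[F](h)" if "a \<in> O[F](\<lambda>_. 1)" "b \<in> O[F](h)" for a b
    using landau_o.big.mult[OF that] by simp
  have "(\<lambda>x. f x * (g x - g' x)) \<in> O[F](h)" "(\<lambda>x. g' x * (f x - f' x)) \<in> O[F](h)"
    using assms by (auto intro!: mult1 simp: close_def)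
  hence "(\<lambda>x. f x * (g x - g' x) + g' x * (f x - f' x)) \<in> O[F](h)" by (rule sum_in_bigo)
  hence "(\<lambda>x. f x * g x - f' x * g' x) \<in> O[F](h)" by (simp add: algebra_simps)
  moreover have "(\<lambda>x. a x * b x) \<in> O[F](\<lambda>_. 1)" if "a \<in> O[F](\<lambda>_. 1)" "b \<in> O[F](\<lambda>_. 1)" for a b
    using landau_o.big.mult[OF that] by simp
  ultimately show ?thesis using assms unfolding close_def by blast
qed

lemma close_sum:
  assumes "\<And>i. i \<in> A \<Longrightarrow> close F h (f i) (g i)"
  shows "close F h (\<lambda>x. \<Sum>i\<in>A. f i x) (\<lambda>x. \<Sum>i\<in>A. g i x)"
  using assms by (induction A rule: infinite_finite_induct) (auto intro!: close_add)

lemma close_prod: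
  assumes "\<And>i. i \<in> A \<Longrightarrow> close F h (f i) (g i)"
  shows "close F h (\<lambda>x. \<Prod>i\<in>A. f i x) (\<lambda>x. \<Prod>i\<in>A. g i x)"
  using assms by (induction A rule: infinite_finite_induct) (auto intro!: close_mult)

lemma close_fdet:
  assumes "\<And>i j. i < n \<Longrightarrow> j < n \<Longrightarrow> close F h (\<lambda>x. A x i j) (\<lambda>x. B x i j)"
  shows "close F h (\<lambda>x. fdet n (A x)) (\<lambda>x. fdet n (B x))"
  unfolding fdet_leibniz
  by (intro close_sum close_mult close_const close_prod assms) (auto dest: permutes_in_image)

lemma close_gram:
  assumes "\<And>i v. i < n \<Longrightarrow> v < p \<Longrightarrow> close F h (\<lambda>x. A x i v) (\<lambda>x. A' x i v)"
    and "\<And>i v. i < n \<Longrightarrow> v < p \<Longrightarrow> close F h (\<lambda>x. B x i v) (\<lambda>x. B' x i v)"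
  shows "close F h (\<lambda>x. gram n p (A x) (B x)) (\<lambda>x. gram n p (A' x) (B' x))"
  unfolding gram_def by (intro close_fdet close_sum close_mult assms) auto

lemma close_schur_fps:
  assumes "\<And>k. 1 \<le> k \<Longrightarrow> k \<le> n \<Longrightarrow> close F h (\<lambda>x. y x k) (\<lambda>x. y' x k)"
  shows "close F h (\<lambda>x. fps_nth (schur_fps (y x)) n) (\<lambda>x. fps_nth (schur_fps (y' x)) n)"
  using assms
proof (induction n rule: less_induct)
  case (less n)
  show ?case
  proof (cases n)
    case (Suc m)
    have rec: "fps_nth (schur_fps y) (Suc m) =
        1 / of_nat (Suc m) * (\<Sum>k\<le>m. of_nat (Suc k) * y (Suc k) * fps_nth (schur_fps y) (m - k))" for y
      unfolding schur_fps_rec[symmetric] by (simp del: of_nat_Suc)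
    show ?thesis unfolding Suc rec
    proof (intro close_mult close_sum close_const)
      fix k assume "k \<in> {..m}"
      thus "close F h (\<lambda>x. y x (Suc k)) (\<lambda>x. y' x (Suc k))"
        and "close F h (\<lambda>x. fps_nth (schur_fps (y x)) (m - k)) (\<lambda>x. fps_nth (schur_fps (y' x)) (m - k))"
        using less Suc by auto
    qed
  qed simp
qed

lemma close_toep:
  assumes "\<And>k. close F h (\<lambda>x. fps_nth (f x) k) (\<lambda>x. fps_nth (g x) k)"
  shows "close F h (\<lambda>x. toep (f x) i v) (\<lambda>x. toep (g x) i v)"
  by (cases "v \<le> i") (simp_all add: toep_def assms)

lemma close_cong:
  assumes "close F h f g" "eventually (\<lambda>x. f x = f' x) F" "eventually (\<lambda>x. g x = g' x) F"
  shows "close F h f' g'"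
proof -
  have "f \<in> O[F](\<lambda>_. 1) \<longleftrightarrow> f' \<in> O[F](\<lambda>_. 1)" "g \<in> O[F](\<lambda>_. 1) \<longleftrightarrow> g' \<in> O[F](\<lambda>_. 1)"
    using assms by (auto intro!: landau_o.big.in_cong)
  moreover have "(\<lambda>x. f x - g x) \<in> O[F](h) \<longleftrightarrow> (\<lambda>x. f' x - g' x) \<in> O[F](h)"
    using assms(2,3) by (intro landau_o.big.in_cong) (auto elim: eventually_elim2)
  ultimately show ?thesis using assms(1) by (simp add: close_def)
qed

lemma close_mono:
  assumes "close F h f g" "h \<in> O[F](h')" shows "close F h' f g"
  using assms landau_o.big_trans unfolding close_def by blast

lemma close_filtermap:
  assumes "close F h f g" "filterlim k F G"
  shows "close G (\<lambda>x. h (k x)) (\<lambda>x. f (k x)) (\<lambda>x. g (k x))"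
  using assms landau_o.big.compose[OF _ assms(2)] unfolding close_def by blast

lemma bigo_tendsto_0:
  fixes f h :: "'a \<Rightarrow> complex"
  assumes "f \<in> O[F](h)" "(h \<longlongrightarrow> 0) F"
  shows "(f \<longlongrightarrow> 0) F"
proof -
  obtain C where C: "eventually (\<lambda>x. cmod (f x) \<le> C * cmod (h x)) F"
    using assms(1) by (elim landau_o.bigE)
  have "((\<lambda>x. C * cmod (h x)) \<longlongrightarrow> C * cmod 0) F"
    by (intro tendsto_mult tendsto_const tendsto_norm assms(2))
  thus ?thesis using C by (intro Lim_null_comparison[of f]) auto
qed

lemma close_tendsto:
  assumes "close F h f (\<lambda>_. c)" "(h \<longlongrightarrow> 0) F"
  shows "(f \<longlongrightarrow> c) F"
proof -
  have "(\<lambda>x. f x - c) \<in> O[F](h)" using assms(1) by (simp add: close_def)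
  hence "((\<lambda>x. f x - c) \<longlongrightarrow> 0) F" using assms(2) by (rule bigo_tendsto_0)
  thus ?thesis by (simp add: LIM_zero_iff)
qed

lemma bigo_1_inverse:
  fixes f :: "'a \<Rightarrow> complex"
  assumes "c > 0" "eventually (\<lambda>x. c \<le> cmod (f x)) F"
  shows "(\<lambda>x. 1 / f x) \<in> O[F](\<lambda>_. 1)"
proof (rule bigoI[of _ "1 / c"])
  show "eventually (\<lambda>x. cmod (1 / f x) \<le> 1 / c * cmod 1) F"
    using assms(2) by eventually_elim (use assms(1) in \<open>simp add: norm_divide frac_le\<close>)
qed

text \<open>The difference is \<open>(f1 g0 - g1 f0) / (f0 g0)\<close>: the numerator is of order
  \<open>h\<close> because \<open>close\<close> respects products, and \<open>f0\<close> inherits a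
  lower bound from \<open>g0\<close>.\<close>

lemma close_ratio:
  assumes f: "close F h f1 g1" "close F h f0 g0" and h: "(h \<longlongrightarrow> 0) F"
    and c: "c > 0" "eventually (\<lambda>x. c \<le> cmod (g0 x)) F"
  shows "(\<lambda>x. f1 x / f0 x - g1 x / g0 x) \<in> O[F](h)"
proof -
  have "((\<lambda>x. f0 x - g0 x) \<longlongrightarrow> 0) F" using f(2) h by (auto simp: close_def intro: bigo_tendsto_0)
  hence "eventually (\<lambda>x. cmod (f0 x - g0 x) < c / 2) F"
    using c(1) by (auto simp: tendsto_iff dist_norm dest: spec[of _ "c/2"])
  with c(2) have f0: "eventually (\<lambda>x. c / 2 \<le> cmod (f0 x)) F"
  proof eventually_elim
    case (elim x)
    have "cmod (g0 x) \<le> cmod (f0 x) + cmod (f0 x - g0 x)"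
      using norm_triangle_ineq4[of "f0 x" "f0 x - g0 x"] by simp
    with elim show ?case by simp
  qed
  have "close F h (\<lambda>x. f1 x * g0 x) (\<lambda>x. g1 x * g0 x)" "close F h (\<lambda>x. g1 x * f0 x) (\<lambda>x. g1 x * g0 x)"
    using f by (auto intro!: close_mult close_refl simp: close_def[of F h f1] close_def[of F h f0])
  hence "(\<lambda>x. (f1 x * g0 x - g1 x * g0 x) - (g1 x * f0 x - g1 x * g0 x)) \<in> O[F](h)"
    using sum_in_bigo(2)[of "\<lambda>x. f1 x * g0 x - g1 x * g0 x" F h "\<lambda>x. g1 x * f0 x - g1 x * g0 x"]
    by (simp add: close_def)
  hence num: "(\<lambda>x. f1 x * g0 x - g1 x * f0 x) \<in> O[F](h)" by simp
  have "(\<lambda>x. 1 / f0 x * (1 / g0 x)) \<in> O[F](\<lambda>_. 1 * 1)"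
    using c f0 bigo_1_inverse[of "c/2" f0 F] bigo_1_inverse[of c g0 F] by (intro landau_o.big.mult) auto
  hence "(\<lambda>x. (f1 x * g0 x - g1 x * f0 x) * (1 / f0 x * (1 / g0 x))) \<in> O[F](\<lambda>x. h x * (1 * 1))"
    by (rule landau_o.big.mult[OF num])
  moreover have "eventually (\<lambda>x. (f1 x * g0 x - g1 x * f0 x) * (1 / f0 x * (1 / g0 x)) = f1 x / f0 x - g1 x / g0 x) F"
    using f0 c(2)
  proof eventually_elim
    case (elim x)
    hence "f0 x \<noteq> 0" "g0 x \<noteq> 0" using c(1) by auto
    thus ?case by (simp add: field_simps)
  qed
  ultimately show ?thesis using landau_o.big.in_cong by fastforce
qed

lemma poly_asymp:
  fixes p :: "complex poly"
  shows "((\<lambda>r::real. poly p (of_real r) / of_real r ^ degree p) \<longlongrightarrow> lead_coeff p) at_top"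
proof -
  have "((\<lambda>r::real. \<Sum>i\<le>degree p. coeff p i * (of_real r ^ i / of_real r ^ degree p)) \<longlongrightarrow>
      (\<Sum>i\<le>degree p. coeff p i * (if i = degree p then 1 else 0))) at_top"
  proof (intro tendsto_sum tendsto_mult tendsto_const)
    fix i assume i: "i \<in> {..degree p}"
    show "((\<lambda>r::real. of_real r ^ i / of_real r ^ degree p :: complex) \<longlongrightarrow> (if i = degree p then 1 else 0)) at_top"
    proof (cases "i = degree p")
      case True
      show ?thesis unfolding True
        by (rule Lim_transform_eventually[OF tendsto_const])
           (rule eventually_mono[OF eventually_gt_at_top[of "0::real"]], simp)
    next
      case False
      have "((\<lambda>r::real. inverse r ^ (degree p - i)) \<longlongrightarrow> 0 ^ (degree p - i)) at_top"
        by (intro tendsto_intros tendsto_inverse_0_at_top filterlim_ident)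
      hence "((\<lambda>r::real. of_real (inverse r ^ (degree p - i)) :: complex) \<longlongrightarrow> of_real 0) at_top"
        using False i by (intro tendsto_of_real) (auto simp: power_0_left)
      hence "((\<lambda>r::real. of_real (inverse r ^ (degree p - i)) :: complex) \<longlongrightarrow> 0) at_top" by simp
      thus ?thesis
      proof (rule Lim_transform_eventually[THEN tendsto_eq_rhs])
        show "\<forall>\<^sub>F r in at_top. of_real (inverse r ^ (degree p - i)) = (of_real r ^ i / of_real r ^ degree p :: complex)"
          using eventually_gt_at_top[of "0::real"]
        proof eventually_elim
          case (elim r)
          have "of_real r ^ degree p = of_real r ^ i * (of_real r ^ (degree p - i) :: complex)"
            using i by (simp flip: power_add)
          thus ?case using elim by (simp add: field_simps)
        qed
      qed (use False in simp)
    qed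
  qed
  moreover have "(\<Sum>i\<le>degree p. coeff p i * (if i = degree p then 1 else 0)) =
      (\<Sum>i\<le>degree p. if i = degree p then lead_coeff p else 0)"
    by (intro sum.cong) auto
  ultimately show ?thesis by (simp add: poly_altdef sum_divide_distrib)
qed

text \<open>The growth bound forces \<open>degree p \<le> degree q\<close>, and an odd quotient excludes equality.\<close>

lemma poly_ratio_bigo:
  fixes p q :: "complex poly"
  assumes q: "q \<noteq> 0"
    and s: "s < 1" "(\<lambda>r. poly p (of_real r) / poly q (of_real r)) \<in> O(\<lambda>r::real. of_real (r powr s))"
    and odd: "s < 0 \<or> (\<forall>x. poly p (- x) * poly q x = - (poly p x * poly q (- x)))"
  shows "(\<lambda>r::real. poly p (of_real r) / poly q (of_real r)) \<in> O(\<lambda>r. of_real (1 / r))"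
proof (cases "p = 0")
  case False
  define P where "P = (\<lambda>r::real. (poly p (of_real r) / of_real r ^ degree p) / (poly q (of_real r) / of_real r ^ degree q))"
  define L where "L = lead_coeff p / lead_coeff q"
  have L: "L \<noteq> 0" using False q by (simp add: L_def)
  have PL: "(P \<longlongrightarrow> L) at_top"
    unfolding P_def L_def by (intro tendsto_divide poly_asymp) (use q in auto)
  have eq: "eventually (\<lambda>r. poly p (of_real r) / poly q (of_real r) =
      P r * (of_real r ^ degree p / of_real r ^ degree q)) at_top"
    using eventually_gt_at_top[of 0] by eventually_elim (simp add: P_def field_simps)
  have "degree p < degree q"
  proof (rule ccontr)
    assume "\<not> degree p < degree q"
    then obtain e where e: "degree p = degree q + e" by (metis le_iff_add not_less)
    have "e = 0 \<Longrightarrow> s < 0"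
    proof (rule ccontr)
      assume e0: "e = 0" and "\<not> s < 0"
      with odd have *: "poly p (- x) * poly q x = - (poly p x * poly q (- x))" for x by blast
      \<comment> \<open>For equal degrees, \<open>x -> - x\<close> changes both products of leading
        coefficients by the same sign, which contradicts the oddness of the quotient.\<close>
      have "pcompose p [:0, -1:] * q = - (p * pcompose q [:0, -1:])"
        by (rule poly_ext) (simp add: poly_pcompose *)
      from arg_cong[OF this, of lead_coeff]
      have "lead_coeff p * lead_coeff q * ((-1) ^ degree p + (-1) ^ degree q) = 0"
        by (simp only: lead_coeff_mult lead_coeff_minus)
           (simp add: lead_coeff_comp algebra_simps)
      moreover have "(-1) ^ degree p + (-1) ^ degree q \<noteq> (0 :: complex)" using e e0 by simp
      ultimately have "lead_coeff p * lead_coeff q = 0" by (metis mult_eq_0_iff)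
      thus False using False q by (metis mult_eq_0_iff leading_coeff_0_iff)
    qed
    hence es: "s < real e" using s(1) by (cases "e = 0") auto
    obtain C where C: "C > 0" "eventually (\<lambda>r. cmod (poly p (of_real r) / poly q (of_real r)) \<le> C * cmod (of_real (r powr s))) at_top"
      using s(2) by (auto elim: landau_o.bigE)
    \<comment> \<open>A degree excess \<open>e > s\<close> would force the nonzero limit
      \<open>L\<close> of \<open>P\<close> to vanish.\<close>
    have "eventually (\<lambda>r. cmod (P r) \<le> C * r powr (s - real e)) at_top"
      using C(2) eq eventually_gt_at_top[of 0]
    proof eventually_elim
      case (elim r)
      hence "cmod (P r) * r ^ e \<le> C * r powr s"
        by (simp add: e power_add norm_mult norm_divide norm_power)
      thus ?case using elim(3) by (simp add: powr_diff powr_realpow field_simps)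
    qed
    moreover have "((\<lambda>r. C * r powr (s - real e)) \<longlongrightarrow> C * 0) at_top"
      using es by (intro tendsto_intros tendsto_neg_powr filterlim_ident) auto
    moreover have "((\<lambda>r. cmod (P r)) \<longlongrightarrow> cmod L) at_top" by (intro tendsto_norm PL)
    ultimately have "cmod L \<le> C * 0" by (intro tendsto_le[of at_top]) auto
    thus False using L by simp
  qed
  then obtain e where e: "degree q = degree p + Suc e" by (metis less_iff_Suc_add add_Suc_right)
  have "P \<in> O(\<lambda>_. 1)" using PL by (intro bigoI_tendsto[of _ _ L]) auto
  moreover have "(\<lambda>r::real. of_real r ^ degree p / of_real r ^ degree q) \<in> O(\<lambda>r. of_real (1 / r) :: complex)"
  proof (rule bigoI[of _ 1])
    show "eventually (\<lambda>r::real. cmod (of_real r ^ degree p / of_real r ^ degree q) \<le> 1 * cmod (of_real (1 / r))) at_top"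
      using eventually_ge_at_top[of 1]
    proof eventually_elim
      case (elim r)
      have "r ^ degree p / r ^ degree q = 1 / r * (1 / r ^ e)" using elim by (simp add: e power_add)
      also have "\<dots> \<le> 1 / r * 1" using elim by (intro mult_left_mono) auto
      finally show ?case using elim by (simp add: norm_divide norm_power)
    qed
  qed
  ultimately have "(\<lambda>r. P r * (of_real r ^ degree p / of_real r ^ degree q)) \<in> O(\<lambda>r::real. 1 * of_real (1 / r))"
    by (rule landau_o.big.mult)
  thus ?thesis using landau_o.big.in_cong[OF eq] by simp
qed simp

section \<open>The staircase minor\<close>

text \<open>Up to the factor \<open>p!\<close> the sum is a polynomial in \<open>p\<close> of degree \<open>L\<close>, written in the falling factorial basis.\<close>

lemma reciprocal_factorials_independent:
  fixes a :: "nat \<Rightarrow> complex"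
  assumes S: "finite S" "L < card S"
    and zero: "\<And>p. p \<in> S \<Longrightarrow> (\<Sum>l\<le>L. a l * (if l \<le> p then 1 / fact (p - l) else 0)) = 0"
  shows "a L = 0"
proof (rule ccontr)
  assume "a L \<noteq> 0"
  define ff :: "nat \<Rightarrow> complex poly" where "ff = (\<lambda>l. \<Prod>i<l. [:- of_nat i, 1:])"
  have deg: "degree (ff l) = l" for l
    unfolding ff_def by (subst degree_prod_eq_sum_degree) auto
  have lead: "coeff (ff l) l = 1" for l
    using lead_coeff_prod[of "\<lambda>i. [:- of_nat i, 1 :: complex:]" "{..<l}"] deg[of l] by (simp add: ff_def)
  have val: "poly (ff l) (of_nat p) = (if l \<le> p then fact p / fact (p - l) else 0)" for l p
  proof (induction l)
    case (Suc l)
    have "poly (ff (Suc l)) (of_nat p) = poly (ff l) (of_nat p) * (of_nat p - of_nat l)"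
      by (simp add: ff_def algebra_simps)
    also have "\<dots> = (if Suc l \<le> p then fact p / fact (p - Suc l) else 0)"
    proof (cases "l < p")
      case True
      have f: "fact (p - l) = of_nat (p - l) * (fact (p - Suc l) :: complex)"
        using True fact_Suc[of "p - Suc l", where ?'a = complex] by (simp add: Suc_diff_Suc)
      have A: "poly (ff l) (of_nat p) = fact p / (of_nat (p - l) * fact (p - Suc l))"
        unfolding Suc f[symmetric] using True by simp
      have B: "of_nat p - of_nat l = (of_nat (p - l) :: complex)" using True by (simp add: of_nat_diff)
      have C: "of_nat (p - l) \<noteq> (0 :: complex)" using True by (simp del: of_nat_diff)
      show ?thesis unfolding A B using C True by (simp del: of_nat_diff)
    qed (use Suc in auto)
    finally show ?case .
  qed (simp add: ff_def)
  define P where "P = (\<Sum>l\<le>L. Polynomial.smult (a l) (ff l))"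
  have "coeff P L = (\<Sum>l\<le>L. if l = L then a L else 0)"
    unfolding P_def coeff_sum by (intro sum.cong) (auto simp: lead coeff_eq_0 deg)
  hence "P \<noteq> 0" using \<open>a L \<noteq> 0\<close> by auto
  have "poly P (of_nat p) = 0" if "p \<in> S" for p
  proof -
    have "poly P (of_nat p) = fact p * (\<Sum>l\<le>L. a l * (if l \<le> p then 1 / fact (p - l) else 0))"
      by (simp add: P_def poly_sum val sum_distrib_left) (intro sum.cong; simp)
    thus ?thesis using zero[OF that] by simp
  qed
  hence "of_nat ` S \<subseteq> {x. poly P x = 0}" by auto
  hence "card (of_nat ` S :: complex set) \<le> card {x. poly P x = 0}"
    using \<open>P \<noteq> 0\<close> by (intro card_mono poly_roots_finite)
  also have "\<dots> \<le> degree P" using \<open>P \<noteq> 0\<close> by (rule card_poly_roots_bound)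
  also have "\<dots> \<le> L" unfolding P_def
    by (intro degree_sum_le) (auto intro: order_trans[OF degree_smult_le] simp: deg)
  also have "card (of_nat ` S :: complex set) = card S" by (rule card_image) (simp add: inj_on_def)
  finally show False using S(2) by simp
qed

lemma iota_less: "i < j \<Longrightarrow> iota K i < iota K j"
  by (auto simp: iota_def)

lemma iota_inj: "iota K i = iota K j \<longleftrightarrow> i = j"
  using iota_less[of i j K] iota_less[of j i K] by (cases i j rule: linorder_cases) auto

lemma iota_bound: "M \<le> N \<Longrightarrow> k < N \<Longrightarrow> iota (N - M) k < 2 * N"
  by (auto simp: iota_def)

lemma N0_of_le: "N0_of M m \<le> m" "N0_of M m \<le> M"
proof -
  define r where "r = M mod (2 * m + 1)"
  have "r \<le> M" "r < 2 * m + 1" by (auto simp: r_def)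
  moreover have "N0_of M m = (if r \<le> m then r else 2 * m - r)"
    by (simp add: N0_of_def Let_def r_def)
  ultimately show "N0_of M m \<le> m" "N0_of M m \<le> M" by auto
qed

text \<open>With \<open>K = N - M\<close>, the columns missing below the last step are
  \<open>K, K + 2, ...\<close>. Each lies an odd distance below every later step, and the last step
  is only \<open>2 M - 1\<close> above \<open>K\<close>.\<close>

lemma iota_gap:
  assumes "M \<le> m" "M \<le> N" "k < N" "l \<notin> iota (N - M) ` {..<N}" "l < iota (N - M) k"
  shows "odd (iota (N - M) k - l)" "iota (N - M) k - l < 2 * m + 1"
proof -
  have "l \<ge> N - M"
  proof (rule ccontr)
    assume "\<not> l \<ge> N - M"
    hence "iota (N - M) l = l" "l < N" by (auto simp: iota_def)
    thus False using assms(4) by (metis imageI lessThan_iff)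
  qed
  moreover have "even (l - (N - M))"
  proof (rule ccontr)
    assume "odd (l - (N - M))"
    then obtain t where t: "l = N - M + 2 * t + 1" using \<open>l \<ge> N - M\<close> by (metis oddE add.assoc le_add_diff_inverse)
    hence "iota (N - M) (N - M + t) = l" by (simp add: iota_def)
    moreover have "N - M + t < k" using assms(5) iota_less[of k "N - M + t" "N - M"] calculation
      by (metis linorder_neqE_nat less_asym less_irrefl)
    ultimately show False using assms(3,4) by (metis imageI lessThan_iff less_trans)
  qed
  then obtain t where "l = N - M + 2 * t" using \<open>l \<ge> N - M\<close> by (metis evenE le_add_diff_inverse)
  ultimately show "odd (iota (N - M) k - l)" "iota (N - M) k - l < 2 * m + 1"
    using assms by (auto simp: iota_def split: if_splits)
qed

text \<open>In the residue class of \<open>c\<close> modulo \<open>2 m + 1\<close> there are more even row indices than column indices up to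
  \<open>c + (2 m + 1) l\<close>, so the independence lemma applies to each class.\<close>

lemma iota_residue:
  assumes "m \<ge> 1" "N \<ge> 1" "k < N" "c < 2 * m + 1"
    and d: "iota (N - N0_of (N - 1) m) k = c + (2 * m + 1) * l"
  shows "c + (2 * m + 1) * (2 * l + c mod 2) \<le> 2 * N - 2"
proof -
  define J where "J = 2 * m + 1"
  define q \<rho> where "q = (N - 1) div J" and "\<rho> = (N - 1) mod J"
  have N: "N - 1 = J * q + \<rho>" by (simp add: q_def \<rho>_def)
  have \<rho>: "\<rho> < J" by (simp add: \<rho>_def J_def)
  define K where "K = N - N0_of (N - 1) m"
  have N0: "N0_of (N - 1) m = (if \<rho> \<le> m then \<rho> else 2 * m - \<rho>)"
    by (simp add: N0_of_def Let_def \<rho>_def J_def)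
  have K: "K = N - (if \<rho> \<le> m then \<rho> else 2 * m - \<rho>)" unfolding K_def N0 ..
  have dJ: "iota K k = c + J * l" using d by (simp add: J_def K_def)
  have cJ: "c < J" using assms(4) by (simp add: J_def)
  \<comment> \<open>If \<open>\<rho> \<le> m\<close>, the steps are \<open>0, ..., J q\<close> and
    then even offsets from \<open>J q\<close> up to \<open>2 \<rho>\<close>. Otherwise they are
    \<open>0, ..., J q + 2 (\<rho> - m)\<close> and then even offsets up to \<open>2 m\<close>. Only
    this last, incomplete block of length \<open>J\<close> is delicate.\<close>
  have bound: "iota K k \<le> J * q + 2 * m \<and> (iota K k > J * q \<longrightarrow>
      (even (iota K k - J * q) \<longrightarrow> iota K k - J * q \<le> 2 * \<rho>) \<and>
      (odd (iota K k - J * q) \<longrightarrow> iota K k - J * q + J \<le> 2 * \<rho>))"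
  proof (cases "\<rho> \<le> m")
    case True
    hence K: "K = J * q + 1" using N assms(2) by (simp add: K)
    have "k \<le> J * q + \<rho>" using N assms(2,3) by simp
    thus ?thesis using True by (auto simp: iota_def K)
  next
    case False
    hence K: "K = J * q + 1 + (2 * \<rho> - 2 * m)" using N assms(2) \<rho> by (simp add: K J_def)
    have k: "k \<le> J * q + \<rho>" using N assms(2,3) by simp
    show ?thesis
    proof (cases "k < K")
      case True
      hence "iota K k = k" by (simp add: iota_def)
      moreover have "odd (k - J * q) \<longrightarrow> k - J * q + J \<le> 2 * \<rho>" if "k > J * q"
      proof
        assume "odd (k - J * q)"
        moreover have "k - J * q \<le> 2 * \<rho> - 2 * m" using True K by simp
        moreover have "even (2 * \<rho> - 2 * m)" by simp
        ultimately have "k - J * q < 2 * \<rho> - 2 * m" by (metis le_neq_implies_less)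
        thus "k - J * q + J \<le> 2 * \<rho>" using False by (simp add: J_def)
      qed
      ultimately show ?thesis using True K \<rho> by (auto simp: J_def)
    next
      case False
      then obtain s where s: "k = K + s" by (metis le_iff_add not_less)
      hence "iota K k = J * q + 2 * (\<rho> - m + 1 + s)" using K by (simp add: iota_def)
      moreover have "\<rho> - m + 1 + s \<le> m" using k s K \<open>\<not> \<rho> \<le> m\<close> by simp
      ultimately show ?thesis using \<rho> \<open>\<not> \<rho> \<le> m\<close> by auto
    qed
  qed
  have lq: "l \<le> q"
  proof (rule ccontr)
    assume "\<not> l \<le> q"
    hence "J * (q + 1) \<le> J * l" by (intro mult_le_mono) auto
    thus False using bound dJ by (simp add: J_def)
  qed
  have goal: "c + J * (2 * l + c mod 2) \<le> 2 * (J * q + \<rho>)"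
  proof (cases "l = q")
    case True
    show ?thesis
    proof (cases "c = 0")
      case False
      hence "even c \<longrightarrow> c \<le> 2 * \<rho>" "odd c \<longrightarrow> c + J \<le> 2 * \<rho>" using bound dJ True by auto
      thus ?thesis using True by (cases "even c") (auto simp: algebra_simps odd_iff_mod_2_eq_one)
    qed (use True in simp)
  next
    case False
    hence "J * (l + 1) \<le> J * q" using lq by (intro mult_le_mono) auto
    hence 1: "J * l + J \<le> J * q" by (simp add: algebra_simps)
    have "J * (c mod 2) \<le> J * 1" by (intro mult_le_mono) auto
    hence 2: "J * (c mod 2) \<le> J" by simp
    have "c + J * (2 * l + c mod 2) = c + 2 * (J * l) + J * (c mod 2)" by (simp add: algebra_simps)
    also have "\<dots> \<le> J + 2 * (J * l) + J" using cJ 2 by (intro add_mono) auto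
    also have "\<dots> \<le> 2 * (J * q + \<rho>)" using 1 by simp
    finally show ?thesis .
  qed
  have "2 * (J * q + \<rho>) = 2 * N - 2" using N by simp
  thus ?thesis using goal unfolding J_def by simp
qed

text \<open>A kernel vector is tested at its last nonzero entry. In the rows of the residue class of
  that column modulo \<open>2 m + 1\<close> only columns of the same class occur, with coefficients
  \<open>\<gamma>^(p - l) / (p - l)!\<close>, and there are enough such rows for the independence
  lemma to force the entry to vanish.\<close>

lemma iota_minor_nonzero:
  assumes m: "m \<ge> 1" "N \<ge> 1" and \<beta>: "\<beta> \<noteq> 0 \<or> 2 * N - 2 < 2 * m + 1"
  shows "fdet N (\<lambda>i k. toep (schur_fps (\<lambda>k. if k = 2 * m + 1 then \<beta> else 0)) (2 * i)
      (iota (N - N0_of (N - 1) m) k)) \<noteq> 0"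
proof (rule fdet_nonzeroI)
  fix y :: "nat \<Rightarrow> complex" and j
  define J where "J = 2 * m + 1"
  let ?E = "schur_fps (\<lambda>k. if k = 2 * m + 1 then \<beta> else 0)" and ?\<iota> = "iota (N - N0_of (N - 1) m)"
  assume eq: "\<And>i. i < N \<Longrightarrow> (\<Sum>k<N. toep ?E (2 * i) (?\<iota> k) * y k) = 0" and j: "j < N"
  \<comment> \<open>If \<open>\<beta> = 0\<close>, then \<open>J\<close> exceeds all index
    differences in play and only the constant term counts; \<open>\<gamma> = 1\<close> is then a
    substitute by which one may divide.\<close>
  obtain \<gamma> where \<gamma>: "\<gamma> \<noteq> 0"
    "\<And>n. n \<le> 2 * N - 2 \<Longrightarrow> fps_nth ?E n = (if J dvd n then \<gamma> ^ (n div J) / fact (n div J) else 0)"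
  proof (cases "\<beta> = 0")
    case True
    have "fps_nth ?E n = (if J dvd n then 1 ^ (n div J) / fact (n div J) else 0)" if n: "n \<le> 2 * N - 2" for n
    proof -
      have "n < J" using n \<beta> True by (simp add: J_def)
      hence "J dvd n \<Longrightarrow> n = 0" by (auto dest: dvd_imp_le)
      moreover have "fps_nth ?E n = (if J dvd n then \<beta> ^ (n div J) / fact (n div J) else 0)"
        unfolding J_def by (rule schur_fps_single) simp
      ultimately show ?thesis by auto
    qed
    thus ?thesis using that[of 1] by simp
  next
    case False
    show ?thesis
    proof (rule that[OF False])
      fix n show "fps_nth ?E n = (if J dvd n then \<beta> ^ (n div J) / fact (n div J) else 0)"
        unfolding J_def by (rule schur_fps_single) simp
    qed
  qed
  show "y j = 0"
  proof (rule ccontr)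
    assume "y j \<noteq> 0"
    define k0 where "k0 = Max {k. k < N \<and> y k \<noteq> 0}"
    have "k0 \<in> {k. k < N \<and> y k \<noteq> 0}" unfolding k0_def
      by (rule Max_in) (use j \<open>y j \<noteq> 0\<close> in auto)
    hence k0: "k0 < N" "y k0 \<noteq> 0" by auto
    have max: "y k = 0" if "k0 < k" "k < N" for k
      using Max_ge[of "{k. k < N \<and> y k \<noteq> 0}" k] that unfolding k0_def[symmetric] by auto
    \<comment> \<open>\<open>Y\<close> transfers the weights from positions \<open>k\<close> to
      column numbers, with zero on the columns that are not steps.\<close>
    define Y where "Y = (\<lambda>d. \<Sum>k<N. if ?\<iota> k = d then y k else 0)"
    have Y0: "Y (?\<iota> k0) = y k0" using k0(1) by (simp add: Y_def iota_inj)
    have Y_above: "Y d = 0" if "d > ?\<iota> k0" for d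
      unfolding Y_def
    proof (intro sum.neutral ballI)
      fix k assume "k \<in> {..<N}"
      thus "(if ?\<iota> k = d then y k else 0) = 0"
        using max[of k] that iota_less[of k k0 "N - N0_of (N - 1) m"] by (cases k k0 rule: linorder_cases) auto
    qed
    define c L where "c = ?\<iota> k0 mod J" and "L = ?\<iota> k0 div J"
    have cL: "?\<iota> k0 = c + J * L" by (simp add: c_def L_def)
    have cJ: "c < J" by (simp add: c_def J_def)
    have res: "c + J * (2 * L + c mod 2) \<le> 2 * N - 2"
      using iota_residue[OF m k0(1), of c L] cJ cL by (simp add: J_def)
    \<comment> \<open>Since \<open>J\<close> is odd, \<open>c + J p\<close> is an even row index
      exactly when \<open>p\<close> and \<open>c\<close> have the same parity.\<close>
    define S where "S = (\<lambda>t. 2 * t + c mod 2) ` {..L}"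
    have card: "card S = Suc L" unfolding S_def by (subst card_image) (auto simp: inj_on_def)
    have "(inverse \<gamma>) ^ L * Y (c + J * L) = 0"
    proof (rule reciprocal_factorials_independent[where S = S and a = "\<lambda>l. (inverse \<gamma>) ^ l * Y (c + J * l)"])
      fix p assume "p \<in> S"
      then obtain t where t: "p = 2 * t + c mod 2" "t \<le> L" by (auto simp: S_def)
      have "J * p \<le> J * (2 * L + c mod 2)" using t by (intro mult_le_mono) auto
      hence le: "c + J * p \<le> 2 * N - 2" using res by linarith
      have "even (c + J * p)" unfolding t J_def by simp
      then obtain i where i: "c + J * p = 2 * i" by blast
      have iN: "i < N" using le i m(2) by linarith
      have "0 = (\<Sum>k<N. toep ?E (2 * i) (?\<iota> k) * y k)" using eq[OF iN] by simp
      also have "\<dots> = (\<Sum>k<N. \<Sum>d<2*N. toep ?E (2 * i) d * (if ?\<iota> k = d then y k else 0))"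
      proof (intro sum.cong refl)
        fix k assume "k \<in> {..<N}"
        hence "?\<iota> k < 2 * N" using iota_bound[of "N0_of (N - 1) m" N k] N0_of_le(2)[of "N - 1" m] by simp
        thus "toep ?E (2 * i) (?\<iota> k) * y k = (\<Sum>d<2*N. toep ?E (2 * i) d * (if ?\<iota> k = d then y k else 0))"
          by (simp add: if_distrib cong: if_cong)
      qed
      also have "\<dots> = (\<Sum>d<2*N. toep ?E (2 * i) d * Y d)"
        by (subst sum.swap) (simp add: Y_def sum_distrib_left)
      also have "\<dots> = (\<Sum>d\<in>(\<lambda>l. c + J * l) ` {l. l \<le> L \<and> l \<le> p}. toep ?E (2 * i) d * Y d)"
      proof (intro sum.mono_neutral_right ballI)
        show "(\<lambda>l. c + J * l) ` {l. l \<le> L \<and> l \<le> p} \<subseteq> {..<2*N}"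
        proof safe
          fix l assume "l \<le> p"
          hence "J * l \<le> J * p" by simp
          thus "c + J * l < 2 * N" using le m(2) by linarith
        qed
        fix d assume d: "d \<in> {..<2*N} - (\<lambda>l. c + J * l) ` {l. l \<le> L \<and> l \<le> p}"
        show "toep ?E (2 * i) d * Y d = 0"
        proof (cases "d \<le> 2 * i \<and> J dvd 2 * i - d \<and> d \<le> ?\<iota> k0")
          case True
          then obtain u where u: "2 * i - d = J * u" by blast
          have eqd: "c + J * p = d + J * u" using u True i by linarith
          have "u \<le> p"
          proof (rule ccontr)
            assume "\<not> u \<le> p"
            hence "J * (p + 1) \<le> J * u" by (intro mult_le_mono) auto
            thus False using eqd cJ by simp
          qed
          hence "J * p = J * (p - u) + J * u" by (simp flip: distrib_left)
          hence dd: "d = c + J * (p - u)" using eqd by simp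
          hence "J * (p - u) \<le> J * L" using True cL by simp
          moreover have "J > 0" by (simp add: J_def)
          ultimately have "p - u \<le> L" by simp
          hence False using d dd by auto
          thus ?thesis ..
        next
          case False
          thus ?thesis using \<gamma>(2)[of "2 * i - d"] le i Y_above[of d] by (auto simp: toep_def)
        qed
      qed auto
      also have "\<dots> = (\<Sum>l | l \<le> L \<and> l \<le> p. toep ?E (2 * i) (c + J * l) * Y (c + J * l))"
      proof (subst sum.reindex)
        have "J > 0" by (simp add: J_def)
        thus "inj_on (\<lambda>l. c + J * l) {l. l \<le> L \<and> l \<le> p}" by (auto simp: inj_on_def)
      qed simp
      also have "\<dots> = (\<Sum>l | l \<le> L \<and> l \<le> p. \<gamma> ^ (p - l) / fact (p - l) * Y (c + J * l))"
      proof (intro sum.cong refl)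
        fix l assume "l \<in> {l. l \<le> L \<and> l \<le> p}"
        hence "J * p = J * (p - l) + J * l" by (simp flip: distrib_left)
        hence "2 * i = J * (p - l) + (c + J * l)" using i by simp
        hence "toep ?E (2 * i) (c + J * l) = fps_nth ?E (J * (p - l))" by (simp add: toep_def)
        also have "\<dots> = \<gamma> ^ (p - l) / fact (p - l)"
        proof -
          have "J * (p - l) \<le> 2 * N - 2" "J > 0" using le \<open>J * p = _\<close> by (auto simp: J_def)
          thus ?thesis using \<gamma>(2)[of "J * (p - l)"] by simp
        qed
        finally show "toep ?E (2 * i) (c + J * l) * Y (c + J * l) = \<gamma> ^ (p - l) / fact (p - l) * Y (c + J * l)" by simp
      qed
      also have "\<dots> = (\<Sum>l\<le>L. if l \<le> p then \<gamma> ^ (p - l) / fact (p - l) * Y (c + J * l) else 0)"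
        by (intro sum.mono_neutral_cong_left) auto
      also have "\<dots> = \<gamma> ^ p * (\<Sum>l\<le>L. (inverse \<gamma>) ^ l * Y (c + J * l) * (if l \<le> p then 1 / fact (p - l) else 0))"
        unfolding sum_distrib_left
      proof (intro sum.cong refl)
        fix l
        have "\<gamma> ^ (p - l) = \<gamma> ^ p * inverse \<gamma> ^ l" if "l \<le> p"
          using that \<gamma>(1) by (simp add: power_diff divide_inverse power_inverse)
        thus "(if l \<le> p then \<gamma> ^ (p - l) / fact (p - l) * Y (c + J * l) else 0) =
          \<gamma> ^ p * ((inverse \<gamma>) ^ l * Y (c + J * l) * (if l \<le> p then 1 / fact (p - l) else 0))"
          by simp
      qed
      finally show "(\<Sum>l\<le>L. (inverse \<gamma>) ^ l * Y (c + J * l) * (if l \<le> p then 1 / fact (p - l) else 0)) = 0"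
        using \<gamma>(1) by simp
    qed (use card in \<open>auto simp: S_def\<close>)
    thus False using \<gamma>(1) Y0 cL k0(2) by simp
  qed
qed

section \<open>Row reduction of the coefficient matrix\<close>

lemma powr_pow: "(r::real) > 0 \<Longrightarrow> (r powr a) ^ n = r powr (a * real n)"
  by (simp add: powr_powr flip: powr_realpow)

text \<open>\<open>\<alpha> r\<close> is the coefficient of the linear factor and \<open>r b\<close>
  the remaining drift, which starts at index \<open>2 m + 1\<close>. The second alternative in
  \<open>b_nondeg\<close> says that no even row reaches this index; it serves the case where all
  conditions \<open>star\<close> hold. The \<open>x^+\<close> and \<open>x^-\<close> sides are two
  instances of the locale.\<close>

locale spiral =
  fixes N m :: nat and \<alpha> :: complex and b :: "nat \<Rightarrow> complex"
  assumes N_pos: "N \<ge> 1" and m_pos: "m \<ge> 1" and \<alpha>_nz: "\<alpha> \<noteq> 0"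
    and b_even: "even k \<Longrightarrow> b k = 0" and b_low: "k < 2 * m + 1 \<Longrightarrow> b k = 0"
    and b_nondeg: "b (2 * m + 1) \<noteq> 0 \<or> 2 * N - 2 < 2 * m + 1"
begin

definition \<iota> :: "nat \<Rightarrow> nat" where "\<iota> = iota (N - N0_of (N - 1) m)"

definition spiral_fps :: "complex \<Rightarrow> complex fps" where
  "spiral_fps r = (1 + fps_const (\<alpha> * r) * fps_X) * schur_fps (\<lambda>k. r * b k)"

definition minor :: "(nat \<Rightarrow> nat) \<Rightarrow> complex \<Rightarrow> complex" where
  "minor f r = fdet N (\<lambda>i k. toep (spiral_fps r) (2 * i + 1) (f k))"

lemma toep_spiral_fps:
  "toep (spiral_fps r) (2 * i + 1) l = toep (schur_fps (\<lambda>k. r * b k)) (2 * i + 1) l + \<alpha> * r * toep (schur_fps (\<lambda>k. r * b k)) (2 * i) l"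
  unfolding spiral_fps_def by (rule toep_linear_mult)

lemma minor_poly: "\<exists>P. \<forall>r. poly P r = minor f r"
proof -
  define HP where "HP = (\<lambda>n. \<Sum>i\<le>n. monom (fps_nth (Abs_fps (\<lambda>n. if n = 0 then 0 else b n) ^ i) n / fact i) i)"
  have HP: "poly (HP n) r = fps_nth (schur_fps (\<lambda>k. r * b k)) n" for n r
    by (simp add: HP_def schur_fps_smult poly_sum poly_monom mult.commute)
  define TP where "TP = (\<lambda>i l. if l \<le> i then HP (i - l) else 0)"
  have TP: "poly (TP i l) r = toep (schur_fps (\<lambda>k. r * b k)) i l" for i l r
    by (simp add: TP_def toep_def HP)
  have "poly (fdet N (\<lambda>i k. TP (2 * i + 1) (f k) + [:0, \<alpha>:] * TP (2 * i) (f k))) r = minor f r" for r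
    unfolding poly_fdet minor_def toep_spiral_fps poly_add poly_mult TP by (simp add: mult_ac)
  thus ?thesis by blast
qed

text \<open>As \<open>b\<close> is odd, changing the sign of \<open>r\<close> amounts to changing
  that of \<open>\<epsilon>\<close>: the odd rows and the columns \<open>f k\<close> contribute
  their parities.\<close>

lemma minor_parity: "minor f (- r) = (-1) ^ N * (-1) ^ (\<Sum>k<N. f k) * minor f r"
proof -
  have H: "fps_nth (schur_fps (\<lambda>k. - r * b k)) n = (-1) ^ n * fps_nth (schur_fps (\<lambda>k. r * b k)) n" for n
  proof -
    have "- r * b k = (-1) ^ k * (r * b k)" for k by (cases "even k") (auto simp: b_even)
    thus ?thesis by (simp only: schur_fps_scale)
  qed
  have T: "toep (schur_fps (\<lambda>k. - r * b k)) i l = (-1) ^ i * (-1) ^ l * toep (schur_fps (\<lambda>k. r * b k)) i l" for i l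
  proof (cases "l \<le> i")
    case True
    hence "(-1) ^ (i - l) = (-1) ^ i * ((-1) ^ l :: complex)" by (simp add: minus_one_power_iff)
    thus ?thesis using True by (simp only: toep_def H if_True)
  qed (simp add: toep_def)
  have "minor f (- r) = fdet N (\<lambda>i k. (-1) * toep (spiral_fps r) (2 * i + 1) (f k) * (-1) ^ f k)"
    unfolding minor_def
  proof (intro fdet_cong)
    fix i k
    show "toep (spiral_fps (- r)) (2 * i + 1) (f k) = (-1) * toep (spiral_fps r) (2 * i + 1) (f k) * (-1) ^ f k"
      unfolding toep_spiral_fps T by (simp add: algebra_simps)
  qed
  also have "\<dots> = (-1) ^ N * (-1) ^ (\<Sum>k<N. f k) * minor f r"
    by (subst fdet_scale) (simp add: minor_def power_sum)
  finally show ?thesis .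
qed

text \<open>Chosen so that \<open>sc^(2 m + 1) r = 1\<close>: rescaling \<open>\<epsilon>\<close> by
  \<open>sc\<close> keeps the leading drift term fixed and sends all later ones to zero.\<close>

definition sc :: "real \<Rightarrow> complex" where "sc r = of_real (r powr (- 1 / real (2 * m + 1)))"

lemma sc_power:
  assumes "r > 0" shows "sc r ^ (2 * m + 1) * of_real r = 1"
proof -
  have "(r powr (- 1 / real (2 * m + 1))) ^ (2 * m + 1) = r powr (- 1 / real (2 * m + 1) * real (2 * m + 1))"
    using assms by (rule powr_pow)
  also have "\<dots> * r = 1" using assms by (simp add: powr_minus del: of_nat_add of_nat_mult of_nat_Suc)
  finally show ?thesis unfolding sc_def by (metis of_real_1 of_real_mult of_real_power)
qed

lemma sc_nonzero: "r > 0 \<Longrightarrow> sc r \<noteq> 0"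
  by (simp add: sc_def)

lemma sc_tendsto: "(sc \<longlongrightarrow> 0) at_top"
proof -
  have "((\<lambda>r. of_real (r powr (- 1 / real (2 * m + 1))) :: complex) \<longlongrightarrow> of_real 0) at_top"
    by (intro tendsto_of_real tendsto_neg_powr filterlim_ident) (simp add: divide_neg_pos)
  thus ?thesis by (simp add: sc_def[abs_def])
qed

lemma sc_bounded: "sc \<in> O(\<lambda>_. 1)"
  using sc_tendsto by (intro bigoI_tendsto[of _ _ 0]) auto

lemma close_sc: "close at_top sc sc (\<lambda>_. 0)"
  by (simp add: close_def sc_bounded)

text \<open>Row \<open>2 i + 1\<close> of \<open>spiral_fps\<close> after the rescaling and division
  by \<open>\<alpha> r / sc^(2 i)\<close>. The original odd row survives only with the factor
  \<open>sc^(2 m) / \<alpha>\<close>, because \<open>1 / sc = r sc^(2 m)\<close>.\<close>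

definition scaled :: "real \<Rightarrow> nat \<Rightarrow> nat \<Rightarrow> complex" where
  "scaled r i l = toep (schur_fps (\<lambda>k. sc r ^ k * (of_real r * b k))) (2 * i) l +
     sc r ^ (2 * m) / \<alpha> * toep (schur_fps (\<lambda>k. sc r ^ k * (of_real r * b k))) (2 * i + 1) l"

definition limit :: "nat \<Rightarrow> nat \<Rightarrow> complex" where
  "limit i l = toep (schur_fps (\<lambda>k. if k = 2 * m + 1 then b (2 * m + 1) else 0)) (2 * i) l"

lemma close_scaled: "close at_top sc (\<lambda>r. scaled r i l) (\<lambda>_. limit i l)"
proof -
  have coeff: "close at_top sc (\<lambda>r. sc r ^ k * (of_real r * b k)) (\<lambda>_. if k = 2 * m + 1 then b (2 * m + 1) else 0)" for k
  proof (cases k "2 * m + 1" rule: linorder_cases)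
    case less
    thus ?thesis by (simp add: b_low)
  next
    case equal
    have "eventually (\<lambda>r. b k = sc r ^ k * (of_real r * b k)) at_top"
      using eventually_gt_at_top[of 0]
    proof eventually_elim
      case (elim r) thus ?case using sc_power[of r] by (simp add: equal flip: mult.assoc)
    qed
    hence "close at_top sc (\<lambda>r. sc r ^ k * (of_real r * b k)) (\<lambda>_. b k)"
      by (rule close_cong[OF close_const[of at_top sc "b k"]]) simp
    thus ?thesis using equal by simp
  next
    case greater
    then obtain e where e: "k = 2 * m + 1 + Suc e" by (metis less_iff_Suc_add add_Suc_right)
    have ev: "eventually (\<lambda>r. (\<Prod>i<Suc e. sc r) * b k = sc r ^ k * (of_real r * b k)) at_top"
      using eventually_gt_at_top[of 0]
    proof eventually_elim
      case (elim r)
      have *: "sc r ^ k * (of_real r * b k) = sc r ^ Suc e * (sc r ^ (2 * m + 1) * of_real r) * b k"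
        unfolding e power_add by (simp only: mult_ac)
      show ?case unfolding * sc_power[OF elim] by (simp only: prod_constant card_lessThan mult_1_right)
    qed
    have "close at_top sc (\<lambda>r. (\<Prod>i<Suc e. sc r) * b k) (\<lambda>r. (\<Prod>i<Suc e. 0) * b k)"
      by (intro close_mult close_prod close_sc close_const)
    hence "close at_top sc (\<lambda>r. sc r ^ k * (of_real r * b k)) (\<lambda>r. (\<Prod>i<Suc e. 0) * b k)"
      by (rule close_cong[OF _ ev]) simp
    thus ?thesis using greater by simp
  qed
  have "close at_top sc (\<lambda>r. (\<Prod>i<2 * m. sc r) * (1 / \<alpha>)) (\<lambda>_. (\<Prod>i<2 * m. 0) * (1 / \<alpha>))"
    by (intro close_mult close_prod close_sc close_const)
  hence "close at_top sc (\<lambda>r. sc r ^ (2 * m) / \<alpha>) (\<lambda>_. 0)" using m_pos by (simp add: power_0_left)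
  hence "close at_top sc (\<lambda>r. scaled r i l) (\<lambda>r. limit i l + 0 * toep (schur_fps (\<lambda>k. if k = 2 * m + 1 then b (2 * m + 1) else 0)) (2 * i + 1) l)"
    unfolding scaled_def limit_def by (intro close_add close_mult close_toep close_schur_fps coeff)
  thus ?thesis by simp
qed

lemma toep_spiral_fps_scaled:
  assumes "r > 0"
  shows "toep (spiral_fps (of_real r)) (2 * i + 1) l = (\<alpha> * of_real r / sc r ^ (2 * i)) * scaled r i l * sc r ^ l"
proof -
  have T: "toep (schur_fps (\<lambda>k. of_real r * b k)) i l =
      sc r ^ l / sc r ^ i * toep (schur_fps (\<lambda>k. sc r ^ k * (of_real r * b k))) i l" for i
  proof (cases "l \<le> i")
    case True
    hence "sc r ^ i = sc r ^ (i - l) * sc r ^ l" by (simp flip: power_add)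
    thus ?thesis using True sc_nonzero[OF assms] by (simp add: toep_def schur_fps_scale)
  qed (simp add: toep_def)
  have inv: "1 / sc r = of_real r * sc r ^ (2 * m)"
    using sc_power[OF assms] sc_nonzero[OF assms] by (simp add: field_simps)
  have "toep (spiral_fps (of_real r)) (2 * i + 1) l = sc r ^ l / sc r ^ (2 * i) *
     ((1 / sc r) * toep (schur_fps (\<lambda>k. sc r ^ k * (of_real r * b k))) (2 * i + 1) l +
      \<alpha> * of_real r * toep (schur_fps (\<lambda>k. sc r ^ k * (of_real r * b k))) (2 * i) l)"
    unfolding toep_spiral_fps T using sc_nonzero[OF assms] by (simp add: field_simps)
  also have "\<dots> = (\<alpha> * of_real r / sc r ^ (2 * i)) * scaled r i l * sc r ^ l"
    unfolding inv scaled_def using \<alpha>_nz sc_nonzero[OF assms] by (simp add: field_simps)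
  finally show ?thesis .
qed

lemma minor_scaled:
  assumes "r > 0"
  shows "minor f (of_real r) = (\<Prod>i<N. \<alpha> * of_real r / sc r ^ (2 * i)) * sc r ^ (\<Sum>k<N. f k) *
    fdet N (\<lambda>i k. scaled r i (f k))"
  unfolding minor_def toep_spiral_fps_scaled[OF assms]
  by (subst fdet_scale) (simp add: power_sum)

lemma close_minor: "close at_top sc (\<lambda>r. fdet N (\<lambda>i k. scaled r i (f k))) (\<lambda>_. fdet N (\<lambda>i k. limit i (f k)))"
  by (intro close_fdet close_scaled)

lemma limit_minor: "fdet N (\<lambda>i k. limit i (\<iota> k)) \<noteq> 0"
  unfolding limit_def \<iota>_def by (rule iota_minor_nonzero[OF m_pos N_pos b_nondeg])

lemma minor_bounded_below:
  obtains c where "c > 0" "eventually (\<lambda>r. c \<le> cmod (fdet N (\<lambda>i k. scaled r i (\<iota> k)))) at_top"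
proof
  let ?L = "cmod (fdet N (\<lambda>i k. limit i (\<iota> k)))"
  show "?L / 2 > 0" using limit_minor by simp
  have lim: "((\<lambda>r. cmod (fdet N (\<lambda>i k. scaled r i (\<iota> k)))) \<longlongrightarrow> ?L) at_top"
    by (intro tendsto_norm close_tendsto[OF close_minor sc_tendsto])
  have "?L / 2 < ?L" using limit_minor by simp
  from order_tendstoD(1)[OF lim this] show "eventually (\<lambda>r. ?L / 2 \<le> cmod (fdet N (\<lambda>i k. scaled r i (\<iota> k)))) at_top"
    by (rule eventually_mono) simp
qed

lemma minor_\<iota>_nonzero: "eventually (\<lambda>r. minor \<iota> (of_real r) \<noteq> 0) at_top"
proof -
  obtain c where "c > 0" and c: "eventually (\<lambda>r. c \<le> cmod (fdet N (\<lambda>i k. scaled r i (\<iota> k)))) at_top"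
    by (rule minor_bounded_below)
  show ?thesis using c eventually_gt_at_top[of 0]
  proof eventually_elim
    case (elim r)
    hence "fdet N (\<lambda>i k. scaled r i (\<iota> k)) \<noteq> 0" using \<open>c > 0\<close> by auto
    thus ?case using elim(2) \<alpha>_nz sc_nonzero[of r] by (simp add: minor_scaled)
  qed
qed

text \<open>The coefficient matrix multiplied by the inverse of its staircase block, written out by
  Cramer's rule. On a staircase column the result is a unit vector, which is put in
  directly.\<close>

definition reduced :: "complex \<Rightarrow> nat \<Rightarrow> nat \<Rightarrow> complex" where
  "reduced r k l = (if l \<in> \<iota> ` {..<N} then (if l = \<iota> k then 1 else 0) else minor (\<iota>(k := l)) r / minor \<iota> r)"

lemma toep_reduced:
  assumes "minor \<iota> r \<noteq> 0" "i < N"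
  shows "toep (spiral_fps r) (2 * i + 1) l = (\<Sum>k<N. toep (spiral_fps r) (2 * i + 1) (\<iota> k) * reduced r k l)"
proof (cases "l \<in> \<iota> ` {..<N}")
  case True
  then obtain k where k: "k < N" "l = \<iota> k" by auto
  have "reduced r k' l = (if k' = k then 1 else 0)" for k'
    using True k by (simp add: reduced_def \<iota>_def iota_inj eq_commute)
  hence "(\<Sum>k'<N. toep (spiral_fps r) (2 * i + 1) (\<iota> k') * reduced r k' l) =
      (\<Sum>k'<N. if k' = k then toep (spiral_fps r) (2 * i + 1) (\<iota> k) else 0)"
    by (intro sum.cong) auto
  thus ?thesis using k by simp
next
  case False
  have minor: "minor (\<iota>(k := l)) r = fdet N (\<lambda>i' j. if j = k then toep (spiral_fps r) (2 * i' + 1) l else toep (spiral_fps r) (2 * i' + 1) (\<iota> j))" for k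
    unfolding minor_def by (intro fdet_cong) auto
  have "(\<Sum>k<N. toep (spiral_fps r) (2 * i + 1) (\<iota> k) * minor (\<iota>(k := l)) r) = minor \<iota> r * toep (spiral_fps r) (2 * i + 1) l"
    unfolding minor unfolding minor_def by (rule fdet_cramer[OF assms(2)])
  thus ?thesis using assms(1) False by (simp add: reduced_def flip: sum_divide_distrib)
qed

lemma sum_upd: "k < N \<Longrightarrow> (\<Sum>j<N. (f(k := l)) j) + f k = (\<Sum>j<N. f j) + (l::nat)"
  by (subst (1 2) sum.remove[of _ k]) auto

lemma reduced_close:
  assumes "k < N"
  shows "close at_top (\<lambda>r. of_real (1 / r)) (\<lambda>r. reduced (of_real r) k l) (\<lambda>_. if l = \<iota> k then 1 else 0)"
proof (cases "l \<in> \<iota> ` {..<N}")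
  case True
  thus ?thesis by (simp add: reduced_def)
next
  case False
  hence ne: "l \<noteq> \<iota> k" using assms by auto
  define J where "J = real (2 * m + 1)"
  \<comment> \<open>In the quotient of minors the scaling leaves
    \<open>sc^(l - \<iota> k) = r^s\<close> times a bounded quotient.\<close>
  define s where "s = (real (\<iota> k) - real l) / J"
  have J: "J > 0" by (simp add: J_def)
  obtain c where c: "c > 0" "eventually (\<lambda>r. c \<le> cmod (fdet N (\<lambda>i k. scaled r i (\<iota> k)))) at_top"
    by (rule minor_bounded_below)
  have gap: "odd (\<iota> k - l)" "\<iota> k - l < 2 * m + 1" if "l < \<iota> k"
    using iota_gap[of "N0_of (N - 1) m" m N k l] N0_of_le[of "N - 1" m] False that assms
    by (auto simp: \<iota>_def)
  have s: "s < 1"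
  proof (cases "l < \<iota> k")
    case True
    hence "real (\<iota> k) - real l < J" using gap(2) unfolding J_def by linarith
    thus ?thesis using J by (simp add: s_def)
  next
    case False
    hence "s \<le> 0" using J by (auto simp: s_def divide_nonpos_pos)
    thus ?thesis by simp
  qed
  have eq: "eventually (\<lambda>r. of_real (r powr s) * (fdet N (\<lambda>i j. scaled r i ((\<iota>(k := l)) j)) * (1 / fdet N (\<lambda>i j. scaled r i (\<iota> j)))) =
      minor (\<iota>(k := l)) (of_real r) / minor \<iota> (of_real r)) at_top"
    using eventually_gt_at_top[of 0]
  proof eventually_elim
    case (elim r)
    have "sc r ^ (\<Sum>j<N. (\<iota>(k := l)) j) * sc r ^ \<iota> k = sc r ^ (\<Sum>j<N. \<iota> j) * sc r ^ l"
      using sum_upd[OF assms, of \<iota> l] by (simp only: power_add[symmetric])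
    hence "sc r ^ (\<Sum>j<N. (\<iota>(k := l)) j) / sc r ^ (\<Sum>j<N. \<iota> j) = sc r ^ l / sc r ^ \<iota> k"
      using sc_nonzero[OF elim] by (simp add: field_simps)
    also have "\<dots> = of_real (r powr s)"
    proof -
      have "sc r ^ n = of_real (r powr (- real n / J))" for n
        using powr_pow[OF elim, of "- 1 / J" n] by (simp add: sc_def J_def flip: of_real_power)
      moreover have "r powr (- real l / J) / r powr (- real (\<iota> k) / J) = r powr s"
        unfolding powr_diff[symmetric] s_def by (simp add: diff_divide_distrib)
      ultimately show ?thesis by (simp only: of_real_divide[symmetric])
    qed
    finally have *: "sc r ^ (\<Sum>j<N. (\<iota>(k := l)) j) / sc r ^ (\<Sum>j<N. \<iota> j) = of_real (r powr s)" .
    have "minor (\<iota>(k := l)) (of_real r) / minor \<iota> (of_real r) =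
      (sc r ^ (\<Sum>j<N. (\<iota>(k := l)) j) / sc r ^ (\<Sum>j<N. \<iota> j)) *
      (fdet N (\<lambda>i j. scaled r i ((\<iota>(k := l)) j)) / fdet N (\<lambda>i j. scaled r i (\<iota> j)))"
    proof -
      have "(\<Prod>i<N. \<alpha> * of_real r / sc r ^ (2 * i)) \<noteq> 0"
        using elim \<alpha>_nz sc_nonzero[OF elim] by simp
      from mult_divide_mult_cancel_left[OF this] show ?thesis
        unfolding minor_scaled[OF elim] times_divide_times_eq mult.assoc by blast
    qed
    thus ?case unfolding * by simp
  qed
  have "(\<lambda>r. of_real (r powr s) * (fdet N (\<lambda>i j. scaled r i ((\<iota>(k := l)) j)) * (1 / fdet N (\<lambda>i j. scaled r i (\<iota> j)))))
      \<in> O(\<lambda>r. of_real (r powr s) * (1 * 1))"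
    using close_minor[of "\<iota>(k := l)"] bigo_1_inverse[OF c]
    by (intro landau_o.big.mult landau_o.big_refl) (auto simp: close_def)
  hence O: "(\<lambda>r. minor (\<iota>(k := l)) (of_real r) / minor \<iota> (of_real r)) \<in> O(\<lambda>r. of_real (r powr s))"
    using landau_o.big.in_cong[OF eq] by simp
  obtain P Q where P: "\<And>r. poly P r = minor (\<iota>(k := l)) r" and Q: "\<And>r. poly Q r = minor \<iota> r"
    using minor_poly by metis
  have "Q \<noteq> 0" using eventually_happens[OF minor_\<iota>_nonzero] by (auto simp flip: Q)
  \<comment> \<open>Below the step, the two column sums differ by the odd number
    \<open>\<iota> k - l\<close>, so the minors have opposite parity in \<open>r\<close> up to a
    common sign; above the step, \<open>s\<close> is negative.\<close>
  have odd: "s < 0 \<or> (\<forall>x. poly P (- x) * poly Q x = - (poly P x * poly Q (- x)))"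
  proof (cases "l < \<iota> k")
    case True
    have "(\<Sum>j<N. (\<iota>(k := l)) j) + (\<iota> k - l) = (\<Sum>j<N. \<iota> j)"
      using sum_upd[OF assms, of \<iota> l] True by linarith
    hence "(-1) ^ (\<Sum>j<N. \<iota> j) = - ((-1) ^ (\<Sum>j<N. (\<iota>(k := l)) j) :: complex)"
      using gap(1)[OF True] by (metis power_add uminus_power_if mult_minus1_right power_one)
    hence "minor (\<iota>(k := l)) (- x) * minor \<iota> x = - (minor (\<iota>(k := l)) x * minor \<iota> (- x))" for x
      unfolding minor_parity[of _ x] by (simp only: mult_minus_left mult_minus_right minus_minus mult_ac)
    thus ?thesis unfolding P Q by blast
  next
    case False
    hence "s < 0" using ne J by (auto simp: s_def divide_neg_pos)
    thus ?thesis ..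
  qed
  have "(\<lambda>r. poly P (of_real r) / poly Q (of_real r)) \<in> O(\<lambda>r. of_real (1 / r))"
    by (rule poly_ratio_bigo[OF \<open>Q \<noteq> 0\<close> s _ odd]) (use O in \<open>simp add: P Q\<close>)
  hence reduced: "(\<lambda>r. reduced (of_real r) k l) \<in> O(\<lambda>r. of_real (1 / r))"
    using False by (simp add: P Q reduced_def)
  moreover have "(\<lambda>r. of_real (1 / r) :: complex) \<in> O(\<lambda>_. 1)"
    by (rule bigoI[of _ 1], rule eventually_mono[OF eventually_ge_at_top[of 1]]) (simp add: norm_divide)
  ultimately show ?thesis using ne landau_o.big_trans by (auto simp: close_def)
qed

end

section \<open>Asymptotics near the centre\<close>

lemma close_schur_mat:
  assumes "\<And>k. 1 \<le> k \<Longrightarrow> close F h (\<lambda>x. e x k) (\<lambda>x. e' x k)"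
  shows "close F h (\<lambda>x. schur_mat (schur_fps (e x)) i v) (\<lambda>x. schur_mat (schur_fps (e' x)) i v)"
  unfolding schur_mat_def svec_exp_def schur_fps_add[symmetric]
  by (intro close_mult close_const close_toep close_schur_fps close_add assms)

text \<open>Row reduction of the \<open>r\<close>-dependent Toeplitz factors on both sides extracts
  the staircase minors. These do not involve \<open>e\<close> and \<open>e'\<close> and are
  therefore common to \<open>n = 0\<close> and \<open>n = 1\<close>; what is left tends to the rows
  of \<open>schur_mat\<close> selected by the staircase.\<close>

lemma center_gram:
  assumes sp: "spiral N m \<alpha> b" and sm: "spiral N m \<beta> c"
    and R: "filterlim R at_top F"
    and e: "\<And>k. (\<lambda>x. e x k) \<in> O[F](\<lambda>_. 1)" and e': "\<And>k. (\<lambda>x. e' x k) \<in> O[F](\<lambda>_. 1)"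
  obtains T where
    "close F (\<lambda>x. of_real (1 / R x)) T (\<lambda>x. gram N (2 * N)
      (\<lambda>k. schur_mat (schur_fps (e x)) (iota (N - N0_of (N - 1) m) k)) (\<lambda>k. schur_mat (schur_fps (e' x)) (iota (N - N0_of (N - 1) m) k)))"
    "eventually (\<lambda>x. gram N (2 * N)
        (odd_row (spiral.spiral_fps \<alpha> b (of_real (R x)) * schur_fps (e x))) (odd_row (spiral.spiral_fps \<beta> c (of_real (R x)) * schur_fps (e' x)))
      = spiral.minor N \<alpha> b (iota (N - N0_of (N - 1) m)) (of_real (R x)) *
        spiral.minor N \<beta> c (iota (N - N0_of (N - 1) m)) (of_real (R x)) * T x) F"
    "eventually (\<lambda>x. spiral.minor N \<alpha> b (iota (N - N0_of (N - 1) m)) (of_real (R x)) \<noteq> 0) F"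
    "eventually (\<lambda>x. spiral.minor N \<beta> c (iota (N - N0_of (N - 1) m)) (of_real (R x)) \<noteq> 0) F"
proof -
  interpret sp: spiral N m \<alpha> b by fact
  interpret sm: spiral N m \<beta> c by fact
  let ?\<iota> = "iota (N - N0_of (N - 1) m)"
  define A where "A = (\<lambda>x k v. \<Sum>l<2*N. sp.reduced (of_real (R x)) k l * schur_mat (schur_fps (e x)) l v)"
  define B where "B = (\<lambda>x k v. \<Sum>l<2*N. sm.reduced (of_real (R x)) k l * schur_mat (schur_fps (e' x)) l v)"
  have iota: "?\<iota> k < 2 * N" if "k < N" for k
    using iota_bound[of "N0_of (N - 1) m" N k] N0_of_le(2)[of "N - 1" m] that by simp
  have delta: "(\<Sum>l<2*N. (if l = ?\<iota> k then 1 else 0) * P l v) = P (?\<iota> k) v" if "k < N" for k v and P :: "nat \<Rightarrow> nat \<Rightarrow> complex"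
    using iota[OF that] by (simp add: if_distrib[of "\<lambda>x. x * _"] cong: if_cong)
  have schur_mat: "close F h (\<lambda>x. schur_mat (schur_fps (e x)) l v) (\<lambda>x. schur_mat (schur_fps (e x)) l v)"
      "close F h (\<lambda>x. schur_mat (schur_fps (e' x)) l v) (\<lambda>x. schur_mat (schur_fps (e' x)) l v)" for h l v
    by (intro close_schur_mat close_refl e e')+
  have A: "close F (\<lambda>x. of_real (1 / R x)) (\<lambda>x. A x k v) (\<lambda>x. schur_mat (schur_fps (e x)) (?\<iota> k) v)" if "k < N" for k v
  proof -
    have "close F (\<lambda>x. of_real (1 / R x)) (\<lambda>x. A x k v)
        (\<lambda>x. \<Sum>l<2*N. (if l = sp.\<iota> k then 1 else 0) * schur_mat (schur_fps (e x)) l v)"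
      unfolding A_def by (intro close_sum close_mult schur_mat close_filtermap[OF sp.reduced_close[OF that] R])
    thus ?thesis unfolding sp.\<iota>_def delta[OF that] .
  qed
  have B: "close F (\<lambda>x. of_real (1 / R x)) (\<lambda>x. B x k v) (\<lambda>x. schur_mat (schur_fps (e' x)) (?\<iota> k) v)" if "k < N" for k v
  proof -
    have "close F (\<lambda>x. of_real (1 / R x)) (\<lambda>x. B x k v)
        (\<lambda>x. \<Sum>l<2*N. (if l = sm.\<iota> k then 1 else 0) * schur_mat (schur_fps (e' x)) l v)"
      unfolding B_def by (intro close_sum close_mult schur_mat close_filtermap[OF sm.reduced_close[OF that] R])
    thus ?thesis unfolding sm.\<iota>_def delta[OF that] .
  qed
  have odd_row_eq: "odd_row (S * E) i v = (\<Sum>k<N. toep S (2 * i + 1) (?\<iota> k) * (\<Sum>l<2*N. d k l * schur_mat E l v))"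
    if "i < N" "\<And>l. toep S (2 * i + 1) l = (\<Sum>k<N. toep S (2 * i + 1) (?\<iota> k) * d k l)" for S E i v d
  proof -
    have "odd_row (S * E) i v = (\<Sum>l<2*N. toep S (2 * i + 1) l * schur_mat E l v)"
      unfolding odd_row_def using that(1) by (intro schur_mat_mult) auto
    also have "\<dots> = (\<Sum>l<2*N. \<Sum>k<N. toep S (2 * i + 1) (?\<iota> k) * (d k l * schur_mat E l v))"
      by (subst that(2)) (simp add: sum_distrib_right mult.assoc)
    also have "\<dots> = (\<Sum>k<N. toep S (2 * i + 1) (?\<iota> k) * (\<Sum>l<2*N. d k l * schur_mat E l v))"
      by (subst sum.swap) (simp add: sum_distrib_left)
    finally show ?thesis .
  qed
  have evp: "eventually (\<lambda>x. sp.minor ?\<iota> (of_real (R x)) \<noteq> 0) F"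
    using filterlim_iff[THEN iffD1, OF R] sp.minor_\<iota>_nonzero unfolding sp.\<iota>_def by blast
  have evm: "eventually (\<lambda>x. sm.minor ?\<iota> (of_real (R x)) \<noteq> 0) F"
    using filterlim_iff[THEN iffD1, OF R] sm.minor_\<iota>_nonzero unfolding sm.\<iota>_def by blast
  show thesis
  proof (rule that[of "\<lambda>x. gram N (2 * N) (A x) (B x)"])
    show "close F (\<lambda>x. of_real (1 / R x)) (\<lambda>x. gram N (2 * N) (A x) (B x)) (\<lambda>x. gram N (2 * N)
      (\<lambda>k. schur_mat (schur_fps (e x)) (?\<iota> k)) (\<lambda>k. schur_mat (schur_fps (e' x)) (?\<iota> k)))"
      by (intro close_gram A B)
    show "eventually (\<lambda>x. gram N (2 * N) (odd_row (sp.spiral_fps (of_real (R x)) * schur_fps (e x))) (odd_row (sm.spiral_fps (of_real (R x)) * schur_fps (e' x)))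
      = sp.minor ?\<iota> (of_real (R x)) * sm.minor ?\<iota> (of_real (R x)) * gram N (2 * N) (A x) (B x)) F"
      using evp evm
    proof eventually_elim
      case (elim x)
      have "gram N (2 * N) (odd_row (sp.spiral_fps (of_real (R x)) * schur_fps (e x))) (odd_row (sm.spiral_fps (of_real (R x)) * schur_fps (e' x))) =
        sp.minor ?\<iota> (of_real (R x)) * gram N (2 * N) (A x) (odd_row (sm.spiral_fps (of_real (R x)) * schur_fps (e' x)))"
        unfolding sp.minor_def A_def
        by (rule gram_left, rule odd_row_eq, assumption, rule sp.toep_reduced[unfolded sp.\<iota>_def]) (use elim in auto)
      also have "gram N (2 * N) (A x) (odd_row (sm.spiral_fps (of_real (R x)) * schur_fps (e' x))) =
        sm.minor ?\<iota> (of_real (R x)) * gram N (2 * N) (A x) (B x)"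
        unfolding sm.minor_def B_def
        by (rule gram_right, rule odd_row_eq, assumption, rule sm.toep_reduced[unfolded sm.\<iota>_def]) (use elim in auto)
      finally show ?case by (simp add: mult_ac)
    qed
  qed (rule evp evm)+
qed

text \<open>Encodes \<open>r -> \<infinity>\<close> uniformly over a box: a big-O along this filter
  means one constant and one threshold for all \<xi> and \<eta>.\<close>

definition strip :: "real \<Rightarrow> (real \<times> real \<times> real) filter" where
  "strip R = at_top \<times>\<^sub>F principal {(\<xi>, \<eta>). \<bar>\<xi>\<bar> \<le> R \<and> \<bar>\<eta>\<bar> \<le> R}"

lemma eventually_strip: "eventually P (strip R) \<longleftrightarrow> (\<exists>r0. \<forall>r\<ge>r0. \<forall>\<xi> \<eta>. \<bar>\<xi>\<bar> \<le> R \<and> \<bar>\<eta>\<bar> \<le> R \<longrightarrow> P (r, \<xi>, \<eta>))"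
proof
  assume "eventually P (strip R)"
  then obtain Pf Pg where "eventually Pf (at_top :: real filter)" "eventually Pg (principal {(\<xi>, \<eta>). \<bar>\<xi>\<bar> \<le> R \<and> \<bar>\<eta>\<bar> \<le> R})"
    "\<And>x y. Pf x \<Longrightarrow> Pg y \<Longrightarrow> P (x, y)"
    unfolding strip_def eventually_prod_filter by blast
  moreover from this obtain r0 where "\<And>r. r \<ge> r0 \<Longrightarrow> Pf r"
    unfolding eventually_at_top_linorder by blast
  ultimately have "\<forall>r\<ge>r0. \<forall>\<xi> \<eta>. \<bar>\<xi>\<bar> \<le> R \<and> \<bar>\<eta>\<bar> \<le> R \<longrightarrow> P (r, \<xi>, \<eta>)"
    unfolding eventually_principal by simp
  thus "\<exists>r0. \<forall>r\<ge>r0. \<forall>\<xi> \<eta>. \<bar>\<xi>\<bar> \<le> R \<and> \<bar>\<eta>\<bar> \<le> R \<longrightarrow> P (r, \<xi>, \<eta>)" ..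
next
  assume "\<exists>r0. \<forall>r\<ge>r0. \<forall>\<xi> \<eta>. \<bar>\<xi>\<bar> \<le> R \<and> \<bar>\<eta>\<bar> \<le> R \<longrightarrow> P (r, \<xi>, \<eta>)"
  then obtain r0 where r0: "\<And>r \<xi> \<eta>. r \<ge> r0 \<Longrightarrow> \<bar>\<xi>\<bar> \<le> R \<and> \<bar>\<eta>\<bar> \<le> R \<Longrightarrow> P (r, \<xi>, \<eta>)" by blast
  show "eventually P (strip R)" unfolding strip_def eventually_prod_filter
    by (rule exI[of _ "\<lambda>r. r \<ge> r0"], intro conjI exI[of _ "\<lambda>(\<xi>, \<eta>). \<bar>\<xi>\<bar> \<le> R \<and> \<bar>\<eta>\<bar> \<le> R"])
       (auto simp: eventually_principal eventually_ge_at_top intro: r0)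
qed

lemma bigo_pboxD:
  assumes "f \<in> O[strip R](\<lambda>p. of_real (g (fst p)))"
  shows "\<exists>C r0. \<forall>r\<ge>r0. \<forall>\<xi> \<eta>. \<bar>\<xi>\<bar> \<le> R \<and> \<bar>\<eta>\<bar> \<le> R \<longrightarrow> cmod (f (r, \<xi>, \<eta>)) \<le> C * \<bar>g r\<bar>"
proof -
  obtain C where "eventually (\<lambda>p. cmod (f p) \<le> C * cmod (of_real (g (fst p)))) (strip R)"
    using assms by (elim landau_o.bigE)
  hence "\<exists>r0. \<forall>r\<ge>r0. \<forall>\<xi> \<eta>. \<bar>\<xi>\<bar> \<le> R \<and> \<bar>\<eta>\<bar> \<le> R \<longrightarrow> cmod (f (r, \<xi>, \<eta>)) \<le> C * \<bar>g r\<bar>"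
    unfolding eventually_strip by simp
  thus ?thesis ..
qed

lemma filterlim_fst_strip: "filterlim fst at_top (strip R)"
  unfolding strip_def by (rule filterlim_fst)

lemma strip_bounded:
  assumes "\<And>r \<xi> \<eta>. \<bar>\<xi>\<bar> \<le> R \<Longrightarrow> \<bar>\<eta>\<bar> \<le> R \<Longrightarrow> cmod (f (r, \<xi>, \<eta>)) \<le> C"
  shows "f \<in> O[strip R](\<lambda>_. 1)"
proof (rule bigoI[of _ C])
  show "eventually (\<lambda>x. cmod (f x) \<le> C * cmod 1) (strip R)"
    unfolding eventually_strip using assms by auto
qed

lemma affine_strip:
  fixes c d u :: complex
  shows "(\<lambda>x. (of_real (fst (snd x)) + c * of_real (snd (snd x))) * d + u) \<in> O[strip R](\<lambda>_. 1)"
proof -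
  have *: "close (strip R) (\<lambda>_. 1) (\<lambda>x. of_real (fst (snd x))) (\<lambda>x. of_real (fst (snd x)))"
      "close (strip R) (\<lambda>_. 1) (\<lambda>x. of_real (snd (snd x))) (\<lambda>x. of_real (snd (snd x)))"
    by (auto intro!: close_refl strip_bounded[of R _ R])
  have "close (strip R) (\<lambda>_. 1) (\<lambda>x. (of_real (fst (snd x)) + c * of_real (snd (snd x))) * d + u)
      (\<lambda>x. (of_real (fst (snd x)) + c * of_real (snd (snd x))) * d + u)"
    by (intro close_add close_mult close_const *)
  thus ?thesis unfolding close_def by blast
qed

lemma xplus_strip: "(\<lambda>x. xplus (\<lambda>_. 0) (fst (snd x)) (snd (snd x)) n k) \<in> O[strip R](\<lambda>_. 1)"
proof -
  consider "k = 1" | "odd k" "k \<noteq> 1" | "even k" by blast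
  thus ?thesis
  proof cases
    case 1
    thus ?thesis using affine_strip[of "2 * \<i>" 1 "of_nat n" R] by (simp add: xplus_def)
  next
    case 2
    thus ?thesis using affine_strip[of "2 ^ k * \<i>" "1 / fact k" 0 R] by (simp add: xplus_def)
  next
    case 3
    hence "k \<noteq> 1" by auto
    thus ?thesis using 3 by (simp add: xplus_def)
  qed
qed

lemma xminus_strip: "(\<lambda>x. xminus (\<lambda>_. 0) (fst (snd x)) (snd (snd x)) n k) \<in> O[strip R](\<lambda>_. 1)"
proof -
  consider "k = 1" | "odd k" "k \<noteq> 1" | "even k" by blast
  thus ?thesis
  proof cases
    case 1
    thus ?thesis using affine_strip[of "- 2 * \<i>" 1 "- of_nat n" R] by (simp add: xminus_def)
  next
    case 2
    thus ?thesis using affine_strip[of "- (2 ^ k * \<i>)" "1 / fact k" 0 R] by (simp add: xplus_def xminus_def)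
  next
    case 3
    hence "k \<noteq> 1" by auto
    thus ?thesis using 3 by (simp add: xminus_def)
  qed
qed

text \<open>\<open>r * drift z0 \<phi> k1 k\<close> is what remains of \<open>x\<^sub>k\<^sup>+\<close> at \<open>(x\<^sub>0, t\<^sub>0)\<close> after removing the logarithmic part;
  condition \<open>(\<ast>\<^sub>j)\<close> says that it vanishes for \<open>k = 2 j + 1\<close>.\<close>

definition drift :: "complex \<Rightarrow> real \<Rightarrow> (nat \<Rightarrow> complex) \<Rightarrow> nat \<Rightarrow> complex" where
  "drift z0 \<phi> k1 k = (if odd k \<and> k \<ge> 3 then
     (of_real (Re (z0 * cis \<phi>)) + 2 ^ (k - 1) * \<i> * of_real (Im (z0 * cis \<phi>))) / fact k + k1 ((k - 1) div 2) * cis \<phi> else 0)"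

text \<open>The term of \<open>a j\<close> with \<open>A^(2 j + 1)\<close> is the coefficient of
  index \<open>2 j + 1\<close> in \<open>artanh (z0 A \<epsilon>)\<close>, and the choice of centre
  \<open>z0 A\<close> supplies the coefficient of index 1. What exceeds this series is the drift,
  linear in \<open>r\<close>, plus the vector at the local coordinates.\<close>

lemma xplus_decomp:
  assumes "1 \<le> k" "k < 2 * N"
    and a: "a = (\<lambda>j. (if 1 \<le> j \<and> j \<le> N - 1 then z0 ^ (2 * j + 1) / of_nat (2 * j + 1) else 0) *
      (of_real r * cis \<phi>) ^ (2 * j + 1) + k1 j * (of_real r * cis \<phi>))"
    and x: "x = Re (z0 * (of_real r * cis \<phi>)) + \<xi>" and t: "t = Im (z0 * (of_real r * cis \<phi>)) / 2 + \<eta>"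
  shows "xplus a x t n k = (if odd k then (z0 * cis \<phi> * of_real r) ^ k / of_nat k else 0) +
      (of_real r * drift z0 \<phi> k1 k + xplus (\<lambda>_. 0) \<xi> \<eta> n k)" (is ?A)
    and "xminus a x t n k = (if odd k then (cnj (z0 * cis \<phi>) * of_real r) ^ k / of_nat k else 0) +
      (of_real r * cnj (drift z0 \<phi> k1 k) + xminus (\<lambda>_. 0) \<xi> \<eta> n k)" (is ?B)
proof -
  have Re: "Re (z0 * (of_real r * cis \<phi>)) = r * Re (z0 * cis \<phi>)"
    and Im: "Im (z0 * (of_real r * cis \<phi>)) = r * Im (z0 * cis \<phi>)"
    by (simp_all add: algebra_simps)
  have one: "of_real x + 2 * \<i> * of_real t = z0 * cis \<phi> * of_real r + (of_real \<xi> + 2 * \<i> * of_real \<eta>)"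
    unfolding x t Re Im by (simp add: complex_eq_iff algebra_simps)
  have odd: "xplus a x t n k = (z0 * cis \<phi> * of_real r) ^ k / of_nat k +
      (of_real r * drift z0 \<phi> k1 k + xplus (\<lambda>_. 0) \<xi> \<eta> n k)" if k: "odd k" "k \<noteq> 1"
  proof -
    obtain j where j: "k = 2 * j + 1" using k(1) by (metis oddE)
    have jb: "1 \<le> j" "j \<le> N - 1" using k(2) assms(2) j by auto
    have two: "(2::complex) ^ k = 2 * 2 ^ (2 * j)" by (simp add: j)
    have "a j = (z0 * cis \<phi> * of_real r) ^ k / of_nat k + of_real r * (k1 j * cis \<phi>)"
      using jb unfolding a j by (simp add: power_mult_distrib mult_ac del: of_nat_Suc)
    moreover have "(of_real x + 2 ^ k * \<i> * of_real t) / fact k =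
       of_real r * ((of_real (Re (z0 * cis \<phi>)) + 2 ^ (2 * j) * \<i> * of_real (Im (z0 * cis \<phi>))) / fact k) +
       (of_real \<xi> + 2 ^ k * \<i> * of_real \<eta>) / fact k"
      unfolding x t Re Im two by (simp add: add_divide_distrib[symmetric] algebra_simps del: fact_Suc)
    ultimately show ?thesis using k jb by (simp add: xplus_def drift_def j algebra_simps del: fact_Suc power_Suc of_nat_Suc)
  qed
  show A: ?A
  proof (cases "k = 1")
    case True
    thus ?thesis using one by (simp add: xplus_def drift_def)
  next
    case False
    thus ?thesis using odd by (cases "odd k") (auto simp: xplus_def drift_def)
  qed
  \<comment> \<open>Index 1 is a case of its own because \<open>n\<close> enters there with the
    opposite sign; for the other odd indices the claim is the conjugate of the previous one.\<close>
  show ?B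
  proof (cases "k = 1")
    case True
    thus ?thesis using arg_cong[OF one, of cnj] by (simp add: xminus_def drift_def)
  next
    case False
    show ?thesis
    proof (cases "odd k")
      case True
      have "xminus a x t n k = cnj (xplus a x t n k)" "xminus (\<lambda>_. 0) \<xi> \<eta> n k = cnj (xplus (\<lambda>_. 0) \<xi> \<eta> n k)"
        using True False by (simp_all add: xminus_def)
      thus ?thesis unfolding A using True
        by (simp only: if_True not_False_eq_True complex_cnj_add complex_cnj_divide complex_cnj_mult complex_cnj_power complex_cnj_of_nat complex_cnj_complex_of_real)
    qed (use False in \<open>auto simp: xminus_def drift_def\<close>)
  qed
qed

lemma spiral_fps_schur_fps:
  assumes "spiral N m \<alpha> b"
  shows "(1 + fps_const (\<alpha> * r) * fps_X) * schur_fps (\<lambda>k. r * b k + e k) = spiral.spiral_fps \<alpha> b r * schur_fps e"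
  by (simp add: spiral.spiral_fps_def[OF assms] schur_fps_add mult.assoc)

lemma tau_reduce:
  assumes sp: "spiral N m (z0 * cis \<phi>) (drift z0 \<phi> k1)" and sm: "spiral N m (cnj (z0 * cis \<phi>)) (\<lambda>k. cnj (drift z0 \<phi> k1 k))"
    and a: "a = (\<lambda>j. (if 1 \<le> j \<and> j \<le> N - 1 then z0 ^ (2 * j + 1) / of_nat (2 * j + 1) else 0) *
      (of_real r * cis \<phi>) ^ (2 * j + 1) + k1 j * (of_real r * cis \<phi>))"
    and x: "x = Re (z0 * (of_real r * cis \<phi>)) + \<xi>" and t: "t = Im (z0 * (of_real r * cis \<phi>)) / 2 + \<eta>"
  shows "tau N a x t n = gram N (2 * N)
     (odd_row (spiral.spiral_fps (z0 * cis \<phi>) (drift z0 \<phi> k1) (of_real r) * schur_fps (xplus (\<lambda>_. 0) \<xi> \<eta> n)))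
     (odd_row (spiral.spiral_fps (cnj (z0 * cis \<phi>)) (\<lambda>k. cnj (drift z0 \<phi> k1 k)) (of_real r) * schur_fps (xminus (\<lambda>_. 0) \<xi> \<eta> n)))"
proof -
  note d = xplus_decomp[OF _ _ a x t, where n = n]
  show ?thesis
    unfolding tau_gram spiral_fps_schur_fps[OF sp, symmetric] spiral_fps_schur_fps[OF sm, symmetric]
    by (subst gram_odd_row_reduce(1)[OF d(1)], assumption, assumption,
        subst gram_odd_row_reduce(2)[OF d(2)]) simp_all
qed

text \<open>\<open>D\<close> and \<kappa> cancel in the quotient, the limiting denominator is
  bounded below by \<open>tau_0_lower_bound\<close>, and the exponential has modulus 1. The centre
  \<open>X r\<close>, \<open>Y r\<close> may move with \<open>r\<close>.\<close>

lemma rw_estimate: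
  assumes T1: "close (strip R) (\<lambda>x. of_real (h (fst x))) T1 (\<lambda>x. \<kappa> * tau M (\<lambda>_. 0) (fst (snd x)) (snd (snd x)) 1)"
    and T0: "close (strip R) (\<lambda>x. of_real (h (fst x))) T0 (\<lambda>x. \<kappa> * tau M (\<lambda>_. 0) (fst (snd x)) (snd (snd x)) 0)"
    and h: "(h \<longlongrightarrow> 0) at_top" and \<kappa>: "\<kappa> \<noteq> 0"
    and D: "eventually (\<lambda>x. D x \<noteq> 0) (strip R)"
    and \<tau>1: "eventually (\<lambda>x. tau N (a (fst x)) (X (fst x) + fst (snd x)) (Y (fst x) + snd (snd x)) 1 = D x * T1 x) (strip R)"
    and \<tau>0: "eventually (\<lambda>x. tau N (a (fst x)) (X (fst x) + fst (snd x)) (Y (fst x) + snd (snd x)) 0 = D x * T0 x) (strip R)"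
  shows "\<exists>C r0. \<forall>r\<ge>r0. \<forall>\<xi> \<eta>. \<bar>\<xi>\<bar> \<le> R \<and> \<bar>\<eta>\<bar> \<le> R \<longrightarrow>
    cmod (rw N (a r) (X r + \<xi>) (Y r + \<eta>) - hatq M \<xi> \<eta> * exp (2 * \<i> * of_real (Y r + \<eta>))) \<le> C * \<bar>h r\<bar>"
proof -
  define \<tau>' where "\<tau>' = (\<lambda>n (x::real\<times>real\<times>real). tau M (\<lambda>_. 0) (fst (snd x)) (snd (snd x)) n)"
  obtain c where c: "c > 0" "\<And>a x t. c \<le> cmod (tau M a x t 0)" using tau_0_lower_bound[of M] by blast
  have "((\<lambda>r. of_real (h r) :: complex) \<longlongrightarrow> of_real 0) at_top" by (intro tendsto_of_real h)
  hence h0: "((\<lambda>x. of_real (h (fst x)) :: complex) \<longlongrightarrow> 0) (strip R)"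
    using filterlim_compose[OF _ filterlim_fst_strip] by fastforce
  have "(\<lambda>x. T1 x / T0 x - \<kappa> * \<tau>' 1 x / (\<kappa> * \<tau>' 0 x)) \<in> O[strip R](\<lambda>x. of_real (h (fst x)))"
    unfolding \<tau>'_def
  proof (rule close_ratio[OF T1 T0 h0])
    show "cmod \<kappa> * c > 0" using c(1) \<kappa> by simp
    show "eventually (\<lambda>x. cmod \<kappa> * c \<le> cmod (\<kappa> * tau M (\<lambda>_. 0) (fst (snd x)) (snd (snd x)) 0)) (strip R)"
      using c(2) by (auto simp: norm_mult intro!: always_eventually mult_left_mono)
  qed
  from bigo_pboxD[OF this] obtain C r1 where C: "\<And>r \<xi> \<eta>. r \<ge> r1 \<Longrightarrow> \<bar>\<xi>\<bar> \<le> R \<and> \<bar>\<eta>\<bar> \<le> R \<Longrightarrow>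
      cmod (T1 (r, \<xi>, \<eta>) / T0 (r, \<xi>, \<eta>) - \<kappa> * \<tau>' 1 (r, \<xi>, \<eta>) / (\<kappa> * \<tau>' 0 (r, \<xi>, \<eta>))) \<le> C * \<bar>h r\<bar>"
    by blast
  obtain r2 where r2: "\<And>r \<xi> \<eta>. r \<ge> r2 \<Longrightarrow> \<bar>\<xi>\<bar> \<le> R \<and> \<bar>\<eta>\<bar> \<le> R \<Longrightarrow>
      D (r, \<xi>, \<eta>) \<noteq> 0 \<and> tau N (a r) (X r + \<xi>) (Y r + \<eta>) 1 = D (r, \<xi>, \<eta>) * T1 (r, \<xi>, \<eta>) \<and>
      tau N (a r) (X r + \<xi>) (Y r + \<eta>) 0 = D (r, \<xi>, \<eta>) * T0 (r, \<xi>, \<eta>)"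
    using eventually_conj[OF D eventually_conj[OF \<tau>1 \<tau>0]] unfolding eventually_strip by auto
  show ?thesis
  proof (rule exI[of _ C], rule exI[of _ "max r1 r2"], intro allI impI)
    fix r \<xi> \<eta> assume r: "max r1 r2 \<le> r" and \<xi>: "\<bar>\<xi>\<bar> \<le> R \<and> \<bar>\<eta>\<bar> \<le> R"
    let ?x = "(r, \<xi>, \<eta>)"
    have "rw N (a r) (X r + \<xi>) (Y r + \<eta>) = tau N (a r) (X r + \<xi>) (Y r + \<eta>) 1 / tau N (a r) (X r + \<xi>) (Y r + \<eta>) 0
        * exp (2 * \<i> * of_real (Y r + \<eta>))"
      by (simp add: rw_def)
    also have "tau N (a r) (X r + \<xi>) (Y r + \<eta>) 1 / tau N (a r) (X r + \<xi>) (Y r + \<eta>) 0 = T1 ?x / T0 ?x"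
      using r2[of r \<xi> \<eta>] r \<xi> by simp
    finally have 1: "rw N (a r) (X r + \<xi>) (Y r + \<eta>) = T1 ?x / T0 ?x * exp (2 * \<i> * of_real (Y r + \<eta>))" .
    have "hatq M \<xi> \<eta> = \<tau>' 1 ?x / \<tau>' 0 ?x * (exp (2 * \<i> * of_real \<eta>) * exp (- 2 * \<i> * of_real \<eta>))"
      by (simp add: hatq_def rw_def \<tau>'_def)
    also have "exp (2 * \<i> * of_real \<eta>) * exp (- 2 * \<i> * of_real \<eta>) = 1" by (simp flip: exp_add)
    finally have 2: "hatq M \<xi> \<eta> = \<kappa> * \<tau>' 1 ?x / (\<kappa> * \<tau>' 0 ?x)"
      using \<kappa> by simp
    have "cmod (rw N (a r) (X r + \<xi>) (Y r + \<eta>) - hatq M \<xi> \<eta> * exp (2 * \<i> * of_real (Y r + \<eta>))) =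
       cmod (T1 ?x / T0 ?x - hatq M \<xi> \<eta>) * cmod (exp (\<i> * of_real (2 * (Y r + \<eta>))))"
      unfolding 1 norm_mult[symmetric] by (simp add: algebra_simps)
    also have "\<dots> \<le> C * \<bar>h r\<bar>" using C[of r \<xi> \<eta>] r \<xi> unfolding 2 by simp
    finally show "cmod (rw N (a r) (X r + \<xi>) (Y r + \<eta>) - hatq M \<xi> \<eta> * exp (2 * \<i> * of_real (Y r + \<eta>))) \<le> C * \<bar>h r\<bar>" .
  qed
qed

text \<open>Joins the row reduction at the centre with \<open>gram_iota\<close>, which identifies
  the staircase Gram determinant as a constant multiple of the fundamental tau function of order
  \<open>N0_of (N - 1) m\<close>.\<close>

lemma rw_center:
  assumes sp: "spiral N m (z0 * cis \<phi>) (drift z0 \<phi> k1)" and sm: "spiral N m (cnj (z0 * cis \<phi>)) (\<lambda>k. cnj (drift z0 \<phi> k1 k))"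
    and a: "a = (\<lambda>r j. (if 1 \<le> j \<and> j \<le> N - 1 then z0 ^ (2 * j + 1) / of_nat (2 * j + 1) else 0) *
      (of_real r * cis \<phi>) ^ (2 * j + 1) + k1 j * (of_real r * cis \<phi>))"
    and x0: "x0 = (\<lambda>r. Re (z0 * (of_real r * cis \<phi>)))" and t0: "t0 = (\<lambda>r. Im (z0 * (of_real r * cis \<phi>)) / 2)"
  shows "\<exists>C r0. \<forall>r\<ge>r0. \<forall>\<xi> \<eta>. \<bar>\<xi>\<bar> \<le> R \<and> \<bar>\<eta>\<bar> \<le> R \<longrightarrow>
    cmod (rw N (a r) (x0 r + \<xi>) (t0 r + \<eta>) - hatq (N0_of (N - 1) m) \<xi> \<eta> * exp (2 * \<i> * of_real (t0 r + \<eta>))) \<le> C / r"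
proof -
  define M where "M = N0_of (N - 1) m"
  define D where "D = (\<lambda>x::real\<times>real\<times>real. spiral.minor N (z0 * cis \<phi>) (drift z0 \<phi> k1) (iota (N - M)) (of_real (fst x)) *
     spiral.minor N (cnj (z0 * cis \<phi>)) (\<lambda>k. cnj (drift z0 \<phi> k1 k)) (iota (N - M)) (of_real (fst x)))"
  define \<tau> where "\<tau> = (\<lambda>n (x::real\<times>real\<times>real). tau N (a (fst x)) (x0 (fst x) + fst (snd x)) (t0 (fst x) + snd (snd x)) n)"
  define \<tau>' where "\<tau>' = (\<lambda>n (x::real\<times>real\<times>real). tau M (\<lambda>_. 0) (fst (snd x)) (snd (snd x)) n)"
  have MN: "M \<le> N" using N0_of_le(2)[of "N - 1" m] by (simp add: M_def)
  have main: "\<exists>T. close (strip R) (\<lambda>x. of_real (1 / fst x)) T (\<lambda>x. iota_const (N - M) M * \<tau>' n x) \<and>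
     eventually (\<lambda>x. D x \<noteq> 0 \<and> \<tau> n x = D x * T x) (strip R)" for n
  proof -
    obtain T where T: "close (strip R) (\<lambda>x. of_real (1 / fst x)) T (\<lambda>x. gram N (2 * N)
      (\<lambda>k. schur_mat (schur_fps (xplus (\<lambda>_. 0) (fst (snd x)) (snd (snd x)) n)) (iota (N - M) k))
      (\<lambda>k. schur_mat (schur_fps (xminus (\<lambda>_. 0) (fst (snd x)) (snd (snd x)) n)) (iota (N - M) k)))"
      "eventually (\<lambda>x. gram N (2 * N)
        (odd_row (spiral.spiral_fps (z0 * cis \<phi>) (drift z0 \<phi> k1) (of_real (fst x)) * schur_fps (xplus (\<lambda>_. 0) (fst (snd x)) (snd (snd x)) n)))
        (odd_row (spiral.spiral_fps (cnj (z0 * cis \<phi>)) (\<lambda>k. cnj (drift z0 \<phi> k1 k)) (of_real (fst x)) * schur_fps (xminus (\<lambda>_. 0) (fst (snd x)) (snd (snd x)) n)))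
        = D x * T x) (strip R)"
      and D: "eventually (\<lambda>x. spiral.minor N (z0 * cis \<phi>) (drift z0 \<phi> k1) (iota (N - M)) (of_real (fst x)) \<noteq> 0) (strip R)"
       "eventually (\<lambda>x. spiral.minor N (cnj (z0 * cis \<phi>)) (\<lambda>k. cnj (drift z0 \<phi> k1 k)) (iota (N - M)) (of_real (fst x)) \<noteq> 0) (strip R)"
      unfolding D_def
      by (rule center_gram[OF sp sm filterlim_fst_strip[of R] xplus_strip[of n _ R] xminus_strip[of n _ R], folded M_def])
    have T3: "eventually (\<lambda>x. D x \<noteq> 0) (strip R)"
      using D by eventually_elim (simp add: D_def)
    have "gram N (2 * N) (\<lambda>k. schur_mat (schur_fps (xplus (\<lambda>_. 0) \<xi> \<eta> n)) (iota (N - M) k))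
        (\<lambda>k. schur_mat (schur_fps (xminus (\<lambda>_. 0) \<xi> \<eta> n)) (iota (N - M) k)) = iota_const (N - M) M * tau M (\<lambda>_. 0) \<xi> \<eta> n" for \<xi> \<eta>
      using gram_iota[of "schur_fps (xplus (\<lambda>_. 0) \<xi> \<eta> n)" "schur_fps (xminus (\<lambda>_. 0) \<xi> \<eta> n)" "N - M" M] MN
      by (simp add: tau_gram)
    hence "close (strip R) (\<lambda>x. of_real (1 / fst x)) T (\<lambda>x. iota_const (N - M) M * \<tau>' n x)"
      using T(1) by (simp add: \<tau>'_def)
    moreover have "eventually (\<lambda>x. D x \<noteq> 0 \<and> \<tau> n x = D x * T x) (strip R)"
      using T(2) T3
    proof eventually_elim
      case (elim x)
      have "\<tau> n x = D x * T x" unfolding \<tau>_def elim(1)[symmetric]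
        by (rule tau_reduce[OF sp sm]) (simp_all only: a x0 t0)
      thus ?case using elim(2) by simp
    qed
    ultimately show ?thesis by blast
  qed
  obtain T1 where T1: "close (strip R) (\<lambda>x. of_real (1 / fst x)) T1 (\<lambda>x. iota_const (N - M) M * \<tau>' 1 x)"
     "eventually (\<lambda>x. D x \<noteq> 0 \<and> \<tau> 1 x = D x * T1 x) (strip R)" using main by blast
  obtain T0 where T0: "close (strip R) (\<lambda>x. of_real (1 / fst x)) T0 (\<lambda>x. iota_const (N - M) M * \<tau>' 0 x)"
     "eventually (\<lambda>x. D x \<noteq> 0 \<and> \<tau> 0 x = D x * T0 x) (strip R)" using main by blast
  have D: "eventually (\<lambda>x. D x \<noteq> 0) (strip R)" using T1(2) by (rule eventually_mono) simp
  have ev1: "eventually (\<lambda>x. tau N (a (fst x)) (x0 (fst x) + fst (snd x)) (t0 (fst x) + snd (snd x)) 1 = D x * T1 x) (strip R)"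
    using T1(2) by (rule eventually_mono) (simp add: \<tau>_def)
  have ev0: "eventually (\<lambda>x. tau N (a (fst x)) (x0 (fst x) + fst (snd x)) (t0 (fst x) + snd (snd x)) 0 = D x * T0 x) (strip R)"
    using T0(2) by (rule eventually_mono) (simp add: \<tau>_def)
  have "((\<lambda>r::real. 1 / r) \<longlongrightarrow> 0) at_top"
    by (intro tendsto_divide_0[OF tendsto_const] filterlim_at_top_imp_at_infinity filterlim_ident)
  from rw_estimate[OF T1(1)[unfolded \<tau>'_def] T0(1)[unfolded \<tau>'_def] this iota_const_nonzero D ev1 ev0]
  obtain C r0 where C: "\<And>r \<xi> \<eta>. r \<ge> r0 \<Longrightarrow> \<bar>\<xi>\<bar> \<le> R \<and> \<bar>\<eta>\<bar> \<le> R \<Longrightarrow>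
     cmod (rw N (a r) (x0 r + \<xi>) (t0 r + \<eta>) - hatq M \<xi> \<eta> * exp (2 * \<i> * of_real (t0 r + \<eta>))) \<le> C * \<bar>1 / r\<bar>"
    by blast
  show ?thesis
  proof (rule exI[of _ C], rule exI[of _ "max 1 r0"], intro allI impI)
    fix r \<xi> \<eta> assume "max 1 r0 \<le> r" "\<bar>\<xi>\<bar> \<le> R \<and> \<bar>\<eta>\<bar> \<le> R"
    thus "cmod (rw N (a r) (x0 r + \<xi>) (t0 r + \<eta>) - hatq (N0_of (N - 1) m) \<xi> \<eta> * exp (2 * \<i> * of_real (t0 r + \<eta>))) \<le> C / r"
      using C[of r \<xi> \<eta>] by (simp add: M_def)
  qed
qed

section \<open>Yablonskii-Vorob'ev polynomials\<close>

definition yv_const :: "nat \<Rightarrow> complex" where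
  "yv_const m = - (2 ^ (2 * m)) / of_nat (2 * m + 1)"

lemma yv_const_nonzero: "yv_const m \<noteq> 0"
  by (simp add: yv_const_def del: of_nat_Suc)

definition yv_base :: "nat \<Rightarrow> complex fps" where
  "yv_base m = schur_fps (\<lambda>k. if k = 2 * m + 1 then yv_const m else 0)"

definition theta :: "nat \<Rightarrow> complex \<Rightarrow> complex fps" where
  "theta m w = schur_fps (\<lambda>k. if k = 1 then w else if k = 2 * m + 1 then yv_const m else 0)"

definition theta_poly :: "nat \<Rightarrow> nat \<Rightarrow> complex poly" where
  "theta_poly m l = (\<Sum>i\<le>l. monom (fps_nth (yv_base m) (l - i) / fact i) i)"

text \<open>\<open>qpoly m (M + 1)\<close> is the Yablonskii-Vorob'ev polynomial \<open>Q\<^sub>M\<close> up to a constant: the first row of its matrix is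
  \<open>(1, 0, \<dots>, 0)\<close>.\<close>

definition qpoly :: "nat \<Rightarrow> nat \<Rightarrow> complex poly" where
  "qpoly m N = fdet N (\<lambda>i j. if j \<le> 2 * i then theta_poly m (2 * i - j) else 0)"

lemma theta_eq:
  assumes "m \<ge> 1"
  shows "theta m w = schur_fps (\<lambda>k. if k = 1 then w else 0) * yv_base m"
proof -
  have "(\<lambda>k. if k = 1 then w else if k = 2 * m + 1 then yv_const m else 0) =
      (\<lambda>k. (if k = 1 then w else 0) + (if k = 2 * m + 1 then yv_const m else 0))"
    using assms by (auto simp: fun_eq_iff)
  thus ?thesis unfolding theta_def yv_base_def by (simp only: schur_fps_add)
qed

lemma poly_theta_poly:
  assumes "m \<ge> 1"
  shows "poly (theta_poly m l) w = fps_nth (theta m w) l"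
  unfolding theta_eq[OF assms] yv_base_def theta_poly_def schur_fps_add[symmetric] schur_fps_linear
  by (simp add: poly_sum poly_monom mult_ac)

lemma poly_qpoly:
  assumes "m \<ge> 1"
  shows "poly (qpoly m N) w = fdet N (\<lambda>i j. toep (theta m w) (2 * i) j)"
  unfolding qpoly_def poly_fdet by (intro fdet_cong) (simp add: toep_def poly_theta_poly[OF assms])

lemma pderiv_sum: "pderiv (\<Sum>i\<in>S. f i) = (\<Sum>i\<in>S. pderiv (f i))"
  by (induction S rule: infinite_finite_induct) (simp_all add: pderiv_add)

lemma pderiv_theta_poly: "pderiv (theta_poly m l) = (if l = 0 then 0 else theta_poly m (l - 1))"
proof (cases l)
  case (Suc n)
  have "pderiv (theta_poly m (Suc n)) = (\<Sum>i\<le>Suc n. monom (of_nat i * (fps_nth (yv_base m) (Suc n - i) / fact i)) (i - 1))"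
    by (simp only: theta_poly_def pderiv_sum pderiv_monom)
  also have "\<dots> = (\<Sum>i\<le>n. monom (of_nat (Suc i) * (fps_nth (yv_base m) (n - i) / fact (Suc i))) i)"
    by (subst sum.atMost_Suc_shift) simp
  also have "\<dots> = theta_poly m n" unfolding theta_poly_def
    by (intro sum.cong refl arg_cong2[where f = monom]) (simp add: field_simps del: of_nat_Suc)
  finally show ?thesis by (simp add: Suc)
qed (simp add: theta_poly_def monom_0)

lemma pderiv_signof [simp]: "pderiv (signof p :: 'a::idom poly) = 0"
  by (simp add: sign_def pderiv_minus)

lemma pderiv_fdet:
  fixes A :: "nat \<Rightarrow> nat \<Rightarrow> 'a::idom poly"
  shows "pderiv (fdet n A) = (\<Sum>v<n. fdet n (\<lambda>i j. if j = v then pderiv (A i j) else A i j))"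
proof -
  have prod: "pderiv (\<Prod>j<n. A (p j) j) = (\<Sum>v<n. \<Prod>j<n. if j = v then pderiv (A (p j) j) else A (p j) j)" for p
    unfolding pderiv_prod
  proof (intro sum.cong refl)
    fix v assume "v \<in> {..<n}"
    thus "(\<Prod>j\<in>{..<n} - {v}. A (p j) j) * pderiv (A (p v) v) =
        (\<Prod>j<n. if j = v then pderiv (A (p j) j) else A (p j) j)"
      by (subst (2) prod.remove[of _ v]) (auto simp: mult.commute)
  qed
  show ?thesis
    by (simp add: fdet_leibniz_col pderiv_sum pderiv_mult prod sum_distrib_left)
       (rule sum.swap)
qed

definition last_shift :: "nat \<Rightarrow> nat \<Rightarrow> nat" where
  "last_shift N j = (if j = N - 1 then N else j)"

text \<open>Each coefficient of \<open>theta\<close> differentiates to its predecessor, so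
  differentiation turns column \<open>j\<close> into column \<open>j + 1\<close>, and every term
  except the one for the last column has a repeated column. The derivative is thus itself a minor,
  on the columns \<open>0, ..., N - 2, N\<close>.\<close>

lemma poly_pderiv_qpoly:
  assumes "m \<ge> 1" "N \<ge> 1"
  shows "poly (pderiv (qpoly m N)) w = fdet N (\<lambda>i j. toep (theta m w) (2 * i) (last_shift N j))"
proof -
  let ?T = "\<lambda>i j. if j \<le> 2 * i then theta_poly m (2 * i - j) else 0"
  have pd: "pderiv (?T i j) = ?T i (Suc j)" for i j
    by (auto simp: pderiv_theta_poly)
  have "pderiv (qpoly m N) = (\<Sum>v<N. fdet N (\<lambda>i j. if j = v then ?T i (Suc j) else ?T i j))"
    unfolding qpoly_def pderiv_fdet pd ..
  also have "\<dots> = (\<Sum>v<N. if v = N - 1 then fdet N (\<lambda>i j. ?T i (last_shift N j)) else 0)"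
  proof (intro sum.cong refl)
    fix v assume v: "v \<in> {..<N}"
    show "fdet N (\<lambda>i j. if j = v then ?T i (Suc j) else ?T i j) = (if v = N - 1 then fdet N (\<lambda>i j. ?T i (last_shift N j)) else 0)"
    proof (cases "v = N - 1")
      case True
      have "fdet N (\<lambda>i j. if j = v then ?T i (Suc j) else ?T i j) = fdet N (\<lambda>i j. ?T i (last_shift N j))"
        by (rule fdet_cong) (use True assms(2) in \<open>simp add: last_shift_def\<close>)
      thus ?thesis using True by simp
    next
      case False
      have "fdet N (\<lambda>i j. if j = v then ?T i (Suc j) else ?T i j) = 0"
        by (rule fdet_identical_cols[of v _ "Suc v"]) (use v False in auto)
      thus ?thesis using False by simp
    qed
  qed
  also have "\<dots> = fdet N (\<lambda>i j. ?T i (last_shift N j))" using assms(2) by simp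
  finally show ?thesis
    by (simp only: poly_fdet) (intro fdet_cong, simp add: toep_def poly_theta_poly[OF assms(1)])
qed

lemma yablonskii_vorobev_qpoly:
  assumes "m \<ge> 1"
  shows "yablonskii_vorobev m M w = (\<Prod>k=1..M. dfact_odd k) * poly (qpoly m (Suc M)) w"
proof -
  have "am_theta (\<lambda>j. if j = m then - (2 ^ (2 * m)) / of_nat (2 * m + 1) else 0) k w =
      schur (\<lambda>k. if k = 1 then w else if k = 2 * m + 1 then yv_const m else 0) k" for k
    unfolding am_theta_def
    by (intro arg_cong2[where f = schur] refl ext) (use assms in \<open>auto simp: yv_const_def elim!: oddE\<close>)
  moreover have "2 * (int i + 1) - (int j + 1) = int (2 * i + 1) - int j" for i j by simp
  ultimately have "yablonskii_vorobev m M w = (\<Prod>k=1..M. dfact_odd k) * fdet M (\<lambda>i j. toep (theta m w) (2 * i + 1) j)"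
    unfolding yablonskii_vorobev_def adler_moser_def fdet_def theta_def by (simp only: toep_schur)
  also have "fdet M (\<lambda>i j. toep (theta m w) (2 * i + 1) j) = fdet M (\<lambda>i j. toep (theta m w) (2 * Suc i) (Suc j))"
    by (intro fdet_cong) (simp add: toep_def)
  also have "\<dots> = fdet (Suc M) (\<lambda>i j. toep (theta m w) (2 * i) j)"
    using fdet_first_row[of M "\<lambda>i j. toep (theta m w) (2 * i) j"] by (simp add: toep_def theta_def)
  finally show ?thesis by (simp add: poly_qpoly[OF assms])
qed

lemma dfact_odd_nonzero: "dfact_odd k \<noteq> 0"
proof -
  have "of_nat (2 * i - 1) \<noteq> (0 :: complex)" if "i \<ge> 1" for i :: nat
    using that by (simp del: of_nat_diff)
  thus ?thesis by (simp add: dfact_odd_def del: of_nat_diff)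
qed

section \<open>Degree, order at zero and number of nonzero roots\<close>

lemma fdet_reciprocal_factorials:
  fixes d :: "nat \<Rightarrow> nat"
  assumes "inj_on d {..<N}"
  shows "fdet N (\<lambda>i k. if k \<le> d i then 1 / fact (d i - k) else 0 :: complex) \<noteq> 0"
proof (rule fdet_nonzeroI)
  fix y :: "nat \<Rightarrow> complex" and j
  assume eq: "\<And>i. i < N \<Longrightarrow> (\<Sum>k<N. (if k \<le> d i then 1 / fact (d i - k) else 0) * y k) = 0" and j: "j < N"
  show "y j = 0"
  proof (rule ccontr)
    assume "y j \<noteq> 0"
    define L where "L = Max {k. k < N \<and> y k \<noteq> 0}"
    have "L \<in> {k. k < N \<and> y k \<noteq> 0}" unfolding L_def
      by (rule Max_in) (use j \<open>y j \<noteq> 0\<close> in auto)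
    hence L: "L < N" "y L \<noteq> 0" by auto
    have max: "y k = 0" if "L < k" "k < N" for k
      using Max_ge[of "{k. k < N \<and> y k \<noteq> 0}" k] that unfolding L_def[symmetric] by auto
    have "y L = 0"
    proof (rule reciprocal_factorials_independent[where S = "d ` {..<N}"])
      show "L < card (d ` {..<N})" using L card_image[OF assms] by simp
      fix p assume "p \<in> d ` {..<N}"
      then obtain i where i: "i < N" "p = d i" by auto
      have "(\<Sum>l\<le>L. y l * (if l \<le> p then 1 / fact (p - l) else 0)) =
          (\<Sum>k<N. (if k \<le> d i then 1 / fact (d i - k) else 0) * y k)"
        using L max by (intro sum.mono_neutral_cong_left) (auto simp: i)
      thus "(\<Sum>l\<le>L. y l * (if l \<le> p then 1 / fact (p - l) else 0)) = 0" using eq[OF i(1)] by simp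
    qed simp
    thus False using L by simp
  qed
qed

lemma degree_eqI:
  fixes p :: "complex poly"
  assumes "((\<lambda>r::real. poly p (of_real r) / of_real r ^ E) \<longlongrightarrow> \<kappa>) at_top" "\<kappa> \<noteq> 0"
  shows "degree p = E"
proof -
  have "p \<noteq> 0"
  proof
    assume "p = 0"
    hence "((\<lambda>r::real. 0 :: complex) \<longlongrightarrow> \<kappa>) at_top" using assms(1) by simp
    thus False using assms(2) tendsto_unique[OF _ tendsto_const] by (metis trivial_limit_at_top_linorder)
  qed
  have inv: "((\<lambda>r::real. 1 / of_real r ^ Suc e :: complex) \<longlongrightarrow> 0) at_top" for e
  proof -
    have "((\<lambda>r::real. inverse r ^ Suc e) \<longlongrightarrow> 0 ^ Suc e) at_top"
      by (intro tendsto_intros tendsto_inverse_0_at_top filterlim_ident)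
    hence "((\<lambda>r::real. of_real (inverse r ^ Suc e) :: complex) \<longlongrightarrow> of_real (0 ^ Suc e)) at_top"
      by (intro tendsto_of_real)
    thus ?thesis by (simp add: field_simps)
  qed
  show ?thesis
  proof (cases "degree p" E rule: linorder_cases)
    case less
    then obtain e where e: "E = degree p + Suc e" by (metis less_iff_Suc_add add_Suc_right)
    have "((\<lambda>r::real. (poly p (of_real r) / of_real r ^ degree p) * (1 / of_real r ^ Suc e)) \<longlongrightarrow> lead_coeff p * 0) at_top"
      by (intro tendsto_mult poly_asymp inv)
    moreover have "(\<lambda>r::real. (poly p (of_real r) / of_real r ^ degree p) * (1 / of_real r ^ Suc e)) =
        (\<lambda>r. poly p (of_real r) / of_real r ^ E)"
      by (simp add: e power_add mult_ac)
    ultimately have "\<kappa> = lead_coeff p * 0"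
      using assms(1) by (intro tendsto_unique[OF trivial_limit_at_top_linorder]) simp_all
    thus ?thesis using assms(2) by simp
  next
    case greater
    then obtain e where e: "degree p = E + Suc e" by (metis less_iff_Suc_add add_Suc_right)
    have "((\<lambda>r::real. (poly p (of_real r) / of_real r ^ E) * (1 / of_real r ^ Suc e)) \<longlongrightarrow> \<kappa> * 0) at_top"
      by (intro tendsto_mult assms(1) inv)
    moreover have "(\<lambda>r::real. (poly p (of_real r) / of_real r ^ E) * (1 / of_real r ^ Suc e)) =
        (\<lambda>r. poly p (of_real r) / of_real r ^ degree p)"
      by (simp add: e power_add mult_ac)
    ultimately have "lead_coeff p = \<kappa> * 0"
      using poly_asymp[of p] by (intro tendsto_unique[OF trivial_limit_at_top_linorder]) simp_all
    thus ?thesis using \<open>p \<noteq> 0\<close> by simp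
  qed simp
qed

text \<open>At \<open>w = r\<close>, rescaling \<epsilon> by \<open>1/r\<close> turns the
  coefficient of index 1 into 1 and kills the other one, so the determinant tends to one of
  reciprocal factorials. Row and column factors give the exponent, the sum of
  \<open>2 i - i\<close>.\<close>

lemma degree_qpoly:
  assumes "m \<ge> 1"
  shows "degree (qpoly m N) = (\<Sum>i<N. i)"
proof (rule degree_eqI)
  define y where "y = (\<lambda>(r::real) k. (1 / of_real r :: complex) ^ k * (if k = 1 then of_real r else if k = 2 * m + 1 then yv_const m else 0))"
  define h where "h = (\<lambda>r::real. 1 / of_real r :: complex)"
  have h0: "(h \<longlongrightarrow> 0) at_top"
  proof -
    have "((\<lambda>r::real. of_real (inverse r) :: complex) \<longlongrightarrow> of_real 0) at_top"
      by (intro tendsto_of_real tendsto_inverse_0_at_top filterlim_ident)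
    thus ?thesis by (simp add: h_def field_simps)
  qed
  have ah: "close at_top h h (\<lambda>_. 0)"
    using h0 by (auto simp: close_def intro!: bigoI_tendsto[of _ _ 0])
  have y: "close at_top h (\<lambda>r. y r k) (\<lambda>_. if k = 1 then 1 else 0)" for k
  proof (cases "k = 1")
    case True
    have "eventually (\<lambda>r. 1 = y r k) at_top"
      using eventually_gt_at_top[of 0] by eventually_elim (simp add: y_def True)
    from close_cong[OF close_const this] show ?thesis using True by simp
  next
    case False
    have "close at_top h (\<lambda>r. (\<Prod>i<k. h r) * (if k = 2 * m + 1 then yv_const m else 0))
        (\<lambda>r. (\<Prod>i<k. 0) * (if k = 2 * m + 1 then yv_const m else 0))"
      by (intro close_mult close_prod ah close_const)
    thus ?thesis using False by (simp add: y_def h_def power_0_left split: if_splits)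
  qed
  define \<kappa> where "\<kappa> = fdet N (\<lambda>i k. if k \<le> 2 * i then 1 / fact (2 * i - k) else 0 :: complex)"
  show "\<kappa> \<noteq> 0" unfolding \<kappa>_def by (rule fdet_reciprocal_factorials) (simp add: inj_on_def)
  have "close at_top h (\<lambda>r. fdet N (\<lambda>i j. toep (schur_fps (y r)) (2 * i) j))
      (\<lambda>_. fdet N (\<lambda>i j. toep (schur_fps (\<lambda>k. if k = 1 then 1 else 0)) (2 * i) j))"
    by (intro close_fdet close_toep close_schur_fps y)
  also have "fdet N (\<lambda>i j. toep (schur_fps (\<lambda>k. if k = 1 then 1 else 0)) (2 * i) j) = \<kappa>"
    unfolding \<kappa>_def using schur_fps_single[of 1 1] by (intro fdet_cong) (simp add: toep_def)
  finally have lim: "((\<lambda>r. fdet N (\<lambda>i j. toep (schur_fps (y r)) (2 * i) j)) \<longlongrightarrow> \<kappa>) at_top"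
    using h0 by (rule close_tendsto)
  have "eventually (\<lambda>r. fdet N (\<lambda>i j. toep (schur_fps (y r)) (2 * i) j) = poly (qpoly m N) (of_real r) / of_real r ^ (\<Sum>i<N. i)) at_top"
    using eventually_gt_at_top[of 0]
  proof eventually_elim
    case (elim r)
    have "toep (schur_fps (y r)) i j = (1 / of_real r) ^ i * toep (theta m (of_real r)) i j * of_real r ^ j" for i j
    proof (cases "j \<le> i")
      case True
      hence "(1 / of_real r :: complex) ^ i = (1 / of_real r) ^ (i - j) * (1 / of_real r) ^ j"
        by (simp only: power_add[symmetric] le_add_diff_inverse2)
      hence "(1 / of_real r :: complex) ^ i * of_real r ^ j = (1 / of_real r) ^ (i - j)"
        using elim by (simp add: field_simps)
      thus ?thesis using True by (simp add: toep_def y_def theta_def schur_fps_scale mult_ac)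
    qed (simp add: toep_def)
    hence "fdet N (\<lambda>i j. toep (schur_fps (y r)) (2 * i) j) =
        (\<Prod>i<N. (1 / of_real r) ^ (2 * i)) * (\<Prod>i<N. of_real r ^ i) * poly (qpoly m N) (of_real r)"
      by (simp only: fdet_scale poly_qpoly[OF assms])
    also have "(\<Prod>i<N. (1 / of_real r :: complex) ^ (2 * i)) * (\<Prod>i<N. of_real r ^ i) = (1 / of_real r) ^ (\<Sum>i<N. i)"
      using elim unfolding power_sum prod.distrib[symmetric]
      by (intro prod.cong refl) (simp add: power_mult power2_eq_square field_simps power_mult_distrib mult_2 power_add)
    finally show ?case by (simp add: field_simps)
  qed
  thus "((\<lambda>r::real. poly (qpoly m N) (of_real r) / of_real r ^ (\<Sum>i<N. i)) \<longlongrightarrow> \<kappa>) at_top"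
    using lim by (rule Lim_transform_eventually[rotated])
qed

text \<open>Step number \<open>s\<close> among the last \<open>M\<close> is displaced by
  \<open>s + 1\<close>; the total displacement \<open>M (M + 1) / 2\<close> becomes the multiplicity
  of the zero root.\<close>

lemma sum_iota:
  assumes "M \<le> N"
  shows "(\<Sum>i<N. iota (N - M) i) = (\<Sum>i<N. i) + (\<Sum>s<M. Suc s)"
proof -
  have "{..<N} = {..<N - M} \<union> {N - M..<N}" by auto
  hence split: "sum f {..<N} = sum f {..<N - M} + sum f {N - M..<N}" for f :: "nat \<Rightarrow> nat"
    by (metis sum.union_disjoint finite_lessThan finite_atLeastLessThan ivl_disj_int(2) atLeast0LessThan ivl_disj_int_two(3))
  have "(\<Sum>i=N-M..<N. iota (N - M) i) = (\<Sum>s<M. N - M + 1 + 2 * s)"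
    by (rule sum.reindex_bij_witness[of _ "\<lambda>s. N - M + s" "\<lambda>i. i - (N - M)"]) (use assms in \<open>auto simp: iota_def\<close>)
  also have "\<dots> = (\<Sum>s<M. (N - M + s) + Suc s)" by (intro sum.cong) auto
  also have "\<dots> = (\<Sum>s<M. N - M + s) + (\<Sum>s<M. Suc s)" by (rule sum.distrib)
  also have "(\<Sum>s<M. N - M + s) = (\<Sum>i=N-M..<N. i)"
    by (rule sum.reindex_bij_witness[of _ "\<lambda>i. i - (N - M)" "\<lambda>s. N - M + s"]) (use assms in auto)
  finally show ?thesis unfolding split[of "iota (N - M)"] split[of "\<lambda>i. i"] by (simp add: iota_def)
qed

lemma yv_base_nth: "fps_nth (yv_base m) n \<noteq> 0 \<Longrightarrow> 2 * m + 1 dvd n"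
  unfolding yv_base_def by (subst (asm) schur_fps_single) (auto split: if_splits)

text \<open>\<open>yv_base\<close> is a series in \<open>\<epsilon>^(2 m + 1)\<close>, so a single
  nonvanishing Leibniz term fixes the column sum modulo \<open>2 m + 1\<close>.\<close>

lemma fdet_yv_base_dvd:
  assumes "fdet N (\<lambda>i k. toep (yv_base m) (2 * i) (f k)) \<noteq> 0"
  obtains t where "(\<Sum>i<N. 2 * i) = (\<Sum>k<N. f k) + (2 * m + 1) * t"
proof -
  from assms obtain p where p: "p permutes {..<N}" "(\<Prod>i<N. toep (yv_base m) (2 * i) (f (p i))) \<noteq> 0"
    unfolding fdet_leibniz by (metis (mono_tags, lifting) mem_Collect_eq mult_zero_right sum.neutral)
  have "\<exists>t. 2 * i = f (p i) + (2 * m + 1) * t" if "i < N" for i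
  proof -
    have "toep (yv_base m) (2 * i) (f (p i)) \<noteq> 0" using p(2) that by auto
    hence "f (p i) \<le> 2 * i" "2 * m + 1 dvd 2 * i - f (p i)"
      using yv_base_nth by (auto simp: toep_def split: if_splits)
    thus ?thesis by (metis dvdE le_add_diff_inverse)
  qed
  then obtain t where "\<And>i. i < N \<Longrightarrow> 2 * i = f (p i) + (2 * m + 1) * t i" by metis
  hence "(\<Sum>i<N. 2 * i) = (\<Sum>i<N. f (p i) + (2 * m + 1) * t i)" by (intro sum.cong) auto
  also have "\<dots> = (\<Sum>i<N. f (p i)) + (2 * m + 1) * (\<Sum>i<N. t i)"
    by (simp only: sum.distrib sum_distrib_left)
  also have "(\<Sum>i<N. f (p i)) = (\<Sum>k<N. f k)" using sum.permute[OF p(1), of f] by (simp add: o_def)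
  finally show thesis by (rule that)
qed

text \<open>\<open>theta\<close> is \<open>yv_base\<close> times \<open>exp (w \<epsilon>)\<close>,
  and the first factor is normalised by its staircase minor. The normalised row \<open>k\<close>
  starts at column \<open>\<iota> k\<close>, so up to column factors \<open>w^v\<close> it
  contributes \<open>w^(\<iota> k)\<close> times polynomials, and these have a nonzero determinant
  at \<open>w = 0\<close>. The order is the sum of the \<open>\<iota> k\<close> minus the sum of the
  \<open>k\<close>.\<close>

lemma order_qpoly:
  assumes m: "m \<ge> 1" and N: "N \<ge> 1" and "qpoly m N \<noteq> 0"
  shows "order 0 (qpoly m N) = (\<Sum>s<N0_of (N - 1) m. Suc s)"
proof -
  define \<iota> where "\<iota> = iota (N - N0_of (N - 1) m)"
  define d where "d = (\<lambda>f. fdet N (\<lambda>i k. toep (yv_base m) (2 * i) (f k)))"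
  have d: "d \<iota> \<noteq> 0" unfolding d_def \<iota>_def yv_base_def
    by (rule iota_minor_nonzero[OF m N]) (simp add: yv_const_nonzero)
  have iota2: "\<iota> k < 2 * N" if "k < N" for k
    using iota_bound[of "N0_of (N - 1) m" N k] N0_of_le(2)[of "N - 1" m] that by (simp add: \<iota>_def)
  define \<phi> where "\<phi> = (\<lambda>k l. d (\<iota>(k := l)) / d \<iota>)"
  have \<phi>_diag: "\<phi> k (\<iota> k) = 1" for k using d by (simp add: \<phi>_def)
  have \<phi>_low: "\<phi> k l = 0" if k: "k < N" and l: "l < \<iota> k" for k l
  proof (cases "l \<in> \<iota> ` {..<N}")
    case True
    then obtain k' where k': "k' < N" "l = \<iota> k'" by auto
    have "d (\<iota>(k := l)) = 0" unfolding d_def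
      by (rule fdet_identical_cols[of k _ k']) (use k k' l in auto)
    thus ?thesis by (simp add: \<phi>_def)
  next
    case False
    have gap: "\<iota> k - l < 2 * m + 1"
      using iota_gap(2)[of "N0_of (N - 1) m" m N k l] N0_of_le[of "N - 1" m] False k l by (simp add: \<iota>_def)
    show ?thesis
    proof (rule ccontr)
      assume "\<phi> k l \<noteq> 0"
      hence "d (\<iota>(k := l)) \<noteq> 0" by (simp add: \<phi>_def)
      then obtain t where t: "(\<Sum>i<N. 2 * i) = (\<Sum>j<N. (\<iota>(k := l)) j) + (2 * m + 1) * t"
        unfolding d_def by (rule fdet_yv_base_dvd)
      obtain u where u: "(\<Sum>i<N. 2 * i) = (\<Sum>j<N. \<iota> j) + (2 * m + 1) * u"
        using d unfolding d_def by (rule fdet_yv_base_dvd)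
      have upd: "(\<Sum>j<N. (\<iota>(k := l)) j) + \<iota> k = (\<Sum>j<N. \<iota> j) + l"
        using k by (subst (1 2) sum.remove[of _ k]) auto
      \<comment> \<open>Two nonzero minors force \<open>\<iota> k - l\<close> to be a multiple of
        \<open>2 m + 1\<close>, but it is positive and smaller.\<close>
      have eq: "(2 * m + 1) * u + \<iota> k = (2 * m + 1) * t + l" using t u upd by linarith
      hence "(2 * m + 1) * u < (2 * m + 1) * t" using l by linarith
      hence "u < t" by (simp only: mult_less_cancel1)
      hence "(2 * m + 1) * (u + 1) \<le> (2 * m + 1) * t" by (intro mult_le_mono) auto
      hence "(2 * m + 1) * u + (2 * m + 1) \<le> (2 * m + 1) * t" by (simp add: distrib_left)
      thus False using eq gap l by linarith
    qed
  qed
  have cramer: "toep (yv_base m) (2 * i) l = (\<Sum>k<N. toep (yv_base m) (2 * i) (\<iota> k) * \<phi> k l)" if i: "i < N" for i l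
  proof -
    have upd: "d (\<iota>(k := l)) = fdet N (\<lambda>i' j. if j = k then toep (yv_base m) (2 * i') l else toep (yv_base m) (2 * i') (\<iota> j))" for k
      unfolding d_def by (intro fdet_cong) auto
    have "(\<Sum>k<N. toep (yv_base m) (2 * i) (\<iota> k) * d (\<iota>(k := l))) = d \<iota> * toep (yv_base m) (2 * i) l"
      unfolding upd unfolding d_def by (rule fdet_cramer[OF i])
    thus ?thesis using d by (simp add: \<phi>_def flip: sum_divide_distrib)
  qed
  \<comment> \<open>The subtraction \<open>l - \<iota> k\<close> is exact on this range of
    summation; the terms with smaller \<open>l\<close> vanish by \<open>\<phi>_low\<close>.\<close>
  define B where "B = (\<lambda>k v. \<Sum>l\<in>{\<iota> k..<2*N}. monom (if v \<le> l then \<phi> k l / fact (l - v) else 0) (l - \<iota> k))"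
  have poly_B: "poly (B k v) w * w ^ \<iota> k = w ^ v * (\<Sum>l<2*N. \<phi> k l * toep (schur_fps (\<lambda>j. if j = 1 then w else 0)) l v)"
    if k: "k < N" for k v w
  proof -
    have "poly (B k v) w * w ^ \<iota> k = (\<Sum>l\<in>{\<iota> k..<2*N}. (if v \<le> l then \<phi> k l / fact (l - v) else 0) * w ^ l)"
      unfolding B_def poly_sum sum_distrib_right
    proof (intro sum.cong refl)
      fix l assume "l \<in> {\<iota> k..<2*N}"
      hence "w ^ l = w ^ (l - \<iota> k) * w ^ \<iota> k" by (simp flip: power_add)
      thus "poly (monom (if v \<le> l then \<phi> k l / fact (l - v) else 0) (l - \<iota> k)) w * w ^ \<iota> k =
          (if v \<le> l then \<phi> k l / fact (l - v) else 0) * w ^ l" by (simp add: poly_monom)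
    qed
    also have "\<dots> = (\<Sum>l<2*N. (if v \<le> l then \<phi> k l / fact (l - v) else 0) * w ^ l)"
      by (rule sum.mono_neutral_left) (auto simp: \<phi>_low[OF k])
    also have "\<dots> = (\<Sum>l<2*N. w ^ v * (\<phi> k l * toep (schur_fps (\<lambda>j. if j = 1 then w else 0)) l v))"
    proof (intro sum.cong refl)
      fix l
      show "(if v \<le> l then \<phi> k l / fact (l - v) else 0) * w ^ l =
          w ^ v * (\<phi> k l * toep (schur_fps (\<lambda>j. if j = 1 then w else 0)) l v)"
      proof (cases "v \<le> l")
        case True
        hence "w ^ l = w ^ v * w ^ (l - v)" by (simp flip: power_add)
        thus ?thesis using True schur_fps_single[of 1 w "l - v"] by (simp add: toep_def)
      qed (simp add: toep_def)
    qed
    finally show ?thesis by (simp add: sum_distrib_left)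
  qed
  have B0: "poly (fdet N B) 0 \<noteq> 0"
  proof -
    have "poly (B k v) 0 = (if v \<le> \<iota> k then 1 / fact (\<iota> k - v) else 0)" if "k < N" for k v
    proof -
      have "poly (B k v) 0 = (\<Sum>l\<in>{\<iota> k..<2*N}. if l = \<iota> k then (if v \<le> l then \<phi> k l / fact (l - v) else 0) else 0)"
        unfolding B_def poly_sum by (intro sum.cong) (auto simp: poly_monom)
      thus ?thesis using iota2[OF that] by (simp add: \<phi>_diag)
    qed
    hence "poly (fdet N B) 0 = fdet N (\<lambda>k v. if v \<le> \<iota> k then 1 / fact (\<iota> k - v) else 0)"
      unfolding poly_fdet by (intro fdet_cong)
    also have "\<dots> \<noteq> 0" by (rule fdet_reciprocal_factorials) (simp add: inj_on_def \<iota>_def iota_inj)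
    finally show ?thesis .
  qed
  have "monom 1 (\<Sum>i<N. i) * qpoly m N = Polynomial.smult (d \<iota>) (monom 1 (\<Sum>k<N. \<iota> k) * fdet N B)"
  proof (rule poly_ext)
    fix w
    have row: "toep (theta m w) (2 * i) v = (\<Sum>k<N. toep (yv_base m) (2 * i) (\<iota> k) *
        (\<Sum>l<2*N. \<phi> k l * toep (schur_fps (\<lambda>j. if j = 1 then w else 0)) l v))" if "i < N" for i v
    proof -
      have "toep (theta m w) (2 * i) v = (\<Sum>l<2*N. toep (yv_base m) (2 * i) l * toep (schur_fps (\<lambda>j. if j = 1 then w else 0)) l v)"
        unfolding theta_eq[OF m] mult.commute[of _ "yv_base m"] using that by (intro toep_mult) auto
      also have "\<dots> = (\<Sum>l<2*N. \<Sum>k<N. toep (yv_base m) (2 * i) (\<iota> k) * (\<phi> k l * toep (schur_fps (\<lambda>j. if j = 1 then w else 0)) l v))"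
        by (subst cramer[OF that]) (simp add: sum_distrib_right mult.assoc)
      finally show ?thesis by (subst (asm) sum.swap) (simp add: sum_distrib_left)
    qed
    have "poly (qpoly m N) w = d \<iota> * fdet N (\<lambda>k v. \<Sum>l<2*N. \<phi> k l * toep (schur_fps (\<lambda>j. if j = 1 then w else 0)) l v)"
      unfolding poly_qpoly[OF m] d_def fdet_mult[symmetric] by (intro fdet_cong row)
    moreover have "(\<Prod>k<N. w ^ \<iota> k) * poly (fdet N B) w =
        (\<Prod>v<N. w ^ v) * fdet N (\<lambda>k v. \<Sum>l<2*N. \<phi> k l * toep (schur_fps (\<lambda>j. if j = 1 then w else 0)) l v)"
    proof -
      have "fdet N (\<lambda>k v. w ^ \<iota> k * poly (B k v) w * 1) =
          fdet N (\<lambda>k v. 1 * (\<Sum>l<2*N. \<phi> k l * toep (schur_fps (\<lambda>j. if j = 1 then w else 0)) l v) * w ^ v)"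
      proof (intro fdet_cong)
        fix k v assume k: "k < N"
        have "w ^ \<iota> k * poly (B k v) w * 1 = poly (B k v) w * w ^ \<iota> k"
          unfolding mult_1_right by (rule mult.commute)
        also note poly_B[OF k, of v w]
        finally show "w ^ \<iota> k * poly (B k v) w * 1 =
            1 * (\<Sum>l<2*N. \<phi> k l * toep (schur_fps (\<lambda>j. if j = 1 then w else 0)) l v) * w ^ v"
          unfolding mult_1_left by (subst (2) mult.commute)
      qed
      thus ?thesis unfolding fdet_scale by (simp add: poly_fdet)
    qed
    ultimately show "poly (monom 1 (\<Sum>i<N. i) * qpoly m N) w =
        poly (Polynomial.smult (d \<iota>) (monom 1 (\<Sum>k<N. \<iota> k) * fdet N B)) w"
      by (simp add: poly_monom power_sum mult_ac)
  qed
  hence "order 0 (monom 1 (\<Sum>i<N. i) * qpoly m N) = order 0 (monom 1 (\<Sum>k<N. \<iota> k) * fdet N B)"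
    using d by (simp add: order_smult)
  moreover have "fdet N B \<noteq> 0" using B0 by auto
  moreover have "order 0 (fdet N B) = 0" using B0 by (simp add: order_0I)
  ultimately have "(\<Sum>i<N. i) + order 0 (qpoly m N) = (\<Sum>k<N. \<iota> k)"
    using assms(3) by (simp add: order_mult monom_eq_0_iff)
  thus ?thesis using sum_iota[of "N0_of (N - 1) m" N] N0_of_le(2)[of "N - 1" m] by (simp add: \<iota>_def)
qed

lemma sum_Suc_gauss: "2 * (\<Sum>s<M. Suc s) = M * (M + 1)"
  by (induction M) simp_all

lemma sum_gauss: "2 * (\<Sum>i<N. i) = (N - 1) * (N::nat)"
proof (cases N)
  case (Suc n)
  thus ?thesis using sum_Suc_gauss[of n] by (simp add: sum.lessThan_Suc_shift del: sum.lessThan_Suc)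
qed simp

text \<open>Degree minus order at zero, since every other root has order 1; both numbers are
  triangular, which gives the form of \<open>Gamma_of\<close>.\<close>

lemma card_nonzero_roots:
  assumes m: "m \<ge> 1" and N: "N \<ge> 1"
    and simple: "\<And>w. w \<noteq> 0 \<Longrightarrow> poly (qpoly m N) w = 0 \<Longrightarrow> order w (qpoly m N) = 1"
    and nz: "qpoly m N \<noteq> 0"
  shows "card {w. w \<noteq> 0 \<and> poly (qpoly m N) w = 0} = Gamma_of (N - 1) m"
proof -
  let ?q = "qpoly m N" and ?Z = "{w. w \<noteq> 0 \<and> poly (qpoly m N) w = 0}"
  have fin: "finite ?Z" using poly_roots_finite[OF nz] by (rule rev_finite_subset) auto
  have "degree ?q = size (proots ?q)" by (simp add: size_proots_complex)
  also have "\<dots> = (\<Sum>w\<in>set_mset (proots ?q). order w ?q)"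
    by (simp add: size_multiset_overloaded_eq nz)
  also have "\<dots> = (\<Sum>w\<in>insert 0 ?Z. order w ?q)"
    by (rule sum.mono_neutral_left) (use fin nz in \<open>auto simp: order_root\<close>)
  also have "\<dots> = order 0 ?q + (\<Sum>w\<in>?Z. order w ?q)" using fin by simp
  also have "(\<Sum>w\<in>?Z. order w ?q) = card ?Z" using simple by simp
  finally have "(\<Sum>i<N. i) = (\<Sum>s<N0_of (N - 1) m. Suc s) + card ?Z"
    by (simp only: degree_qpoly[OF m] order_qpoly[OF m N nz])
  hence "(N - 1) * N = N0_of (N - 1) m * (N0_of (N - 1) m + 1) + 2 * card ?Z"
    using sum_gauss[of N] sum_Suc_gauss[of "N0_of (N - 1) m"] by linarith
  moreover have "N - 1 + 1 = N" using N by simp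
  ultimately show ?thesis by (simp only: Gamma_of_def) simp
qed

section \<open>Leading terms of the Cauchy-Binet expansion\<close>

text \<open>Later, column \<open>v\<close> carries the weight \<open>S^v\<close>, so column sums are
  the orders of the Cauchy-Binet terms. The lowest order belongs to one column set only.\<close>

lemma sum_ge_initial_segment:
  fixes S :: "nat set"
  assumes "finite S" "card S = N"
  shows "\<Sum>{..<N} \<le> \<Sum>S" "\<Sum>S = \<Sum>{..<N} \<Longrightarrow> S = {..<N}"
proof -
  have "\<Sum>{..<N} \<le> \<Sum>S \<and> (\<Sum>S = \<Sum>{..<N} \<longrightarrow> S = {..<N})" using assms
  proof (induction N arbitrary: S)
    case (Suc N)
    define x where "x = Max S"
    have "S \<noteq> {}" using Suc.prems by auto
    hence x: "x \<in> S" "\<And>y. y \<in> S \<Longrightarrow> y \<le> x" using Suc.prems by (auto simp: x_def)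
    have "card S \<le> card {..x}" using x by (intro card_mono) auto
    hence xN: "N \<le> x" using Suc.prems by simp
    have sum: "\<Sum>S = x + \<Sum>(S - {x})" using x(1) Suc.prems by (simp add: sum.remove)
    have IH: "\<Sum>{..<N} \<le> \<Sum>(S - {x})" "\<Sum>(S - {x}) = \<Sum>{..<N} \<longrightarrow> S - {x} = {..<N}"
      using Suc.IH[of "S - {x}"] Suc.prems x(1) by auto
    show ?case
    proof (intro conjI impI)
      show "\<Sum>{..<Suc N} \<le> \<Sum>S" using sum IH(1) xN by simp
      assume "\<Sum>S = \<Sum>{..<Suc N}"
      hence "x = N" "\<Sum>(S - {x}) = \<Sum>{..<N}" using sum IH(1) xN by auto
      hence "S - {N} = {..<N}" using IH(2) by simp
      moreover have "insert N (S - {N}) = S" using x(1) \<open>x = N\<close> by (simp add: insert_absorb)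
      ultimately show "S = {..<Suc N}" by (simp add: lessThan_Suc)
    qed
  qed simp
  thus "\<Sum>{..<N} \<le> \<Sum>S" "\<Sum>S = \<Sum>{..<N} \<Longrightarrow> S = {..<N}" by auto
qed

text \<open>The second lowest order also belongs to one column set only: the maximum cannot be
  \<open>N - 1\<close>, so it is \<open>N\<close>, and the rest has minimal sum.\<close>

lemma sum_initial_segment_plus_one:
  fixes S :: "nat set"
  assumes "finite S" "card S = N" "N \<ge> 1" "\<Sum>S = \<Sum>{..<N} + 1"
  shows "S = insert N {..<N - 1}"
proof -
  obtain n where n: "N = Suc n" using assms(3) by (cases N) auto
  define x where "x = Max S"
  have "S \<noteq> {}" using assms by auto
  hence x: "x \<in> S" "\<And>y. y \<in> S \<Longrightarrow> y \<le> x" using assms by (auto simp: x_def)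
  have "card S \<le> card {..x}" using x by (intro card_mono) auto
  hence xn: "n \<le> x" using assms n by simp
  have "x \<noteq> n"
  proof
    assume "x = n"
    hence "S \<subseteq> {..<N}" using x n by (auto simp: less_Suc_eq_le)
    hence "S = {..<N}" using assms by (intro card_subset_eq) auto
    thus False using assms(4) by simp
  qed
  have sum: "\<Sum>S = x + \<Sum>(S - {x})" using x(1) assms by (simp add: sum.remove)
  have c: "finite (S - {x})" "card (S - {x}) = n" using assms x(1) n by auto
  have "\<Sum>(S - {x}) = \<Sum>{..<n}" "x = N"
    using sum_ge_initial_segment(1)[OF c] sum assms(4) xn \<open>x \<noteq> n\<close> n by auto
  hence "S - {N} = {..<n}" using sum_ge_initial_segment(2)[OF c] by simp
  moreover have "insert N (S - {N}) = S" using x(1) \<open>x = N\<close> by (simp add: insert_absorb)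
  ultimately show ?thesis by (simp add: n)
qed

lemma last_shift_image: "N \<ge> 1 \<Longrightarrow> last_shift N ` {..<N} = insert N {..<N - 1}"
  by (auto simp: last_shift_def image_iff)

lemma last_shift_inj: "inj_on (last_shift N) {..<N}"
  by (auto simp: inj_on_def last_shift_def split: if_splits)

text \<open>Orderings, rather than sets, of columns with total weight \<open>e\<close>, to match the
  ordered form of the Cauchy-Binet sum.\<close>

definition level :: "nat \<Rightarrow> nat \<Rightarrow> (nat \<Rightarrow> nat) set" where
  "level N e = {f \<in> {..<N} \<rightarrow>\<^sub>E {..<2*N}. inj_on f {..<N} \<and> (\<Sum>i<N. f i) = e}"

lemma sum_image: "inj_on f {..<N} \<Longrightarrow> \<Sum>(f ` {..<N}) = (\<Sum>i<N. f (i::nat) :: nat)"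
  by (simp add: sum.reindex)

lemma level_image:
  assumes "f \<in> level N e"
  shows "\<Sum>{..<N} \<le> e" "e = \<Sum>{..<N} \<Longrightarrow> f ` {..<N} = {..<N}"
    "N \<ge> 1 \<Longrightarrow> e = \<Sum>{..<N} + 1 \<Longrightarrow> f ` {..<N} = last_shift N ` {..<N}"
proof -
  have f: "inj_on f {..<N}" "\<Sum>(f ` {..<N}) = e" using assms by (auto simp: level_def sum_image)
  have c: "finite (f ` {..<N})" "card (f ` {..<N}) = N" using f(1) by (auto simp: card_image)
  show "\<Sum>{..<N} \<le> e" "e = \<Sum>{..<N} \<Longrightarrow> f ` {..<N} = {..<N}"
    using sum_ge_initial_segment[OF c] f by auto
  show "N \<ge> 1 \<Longrightarrow> e = \<Sum>{..<N} + 1 \<Longrightarrow> f ` {..<N} = last_shift N ` {..<N}"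
    using sum_initial_segment_plus_one[OF c] f by (simp add: last_shift_image)
qed

text \<open>Both minors change by the same sign, which squares to 1.\<close>

lemma fdet_product_permuted:
  fixes u u' :: "nat \<Rightarrow> nat \<Rightarrow> complex"
  assumes f: "inj_on f {..<N}" "f ` {..<N} = g ` {..<N}" and g: "inj_on g {..<N}"
  shows "fdet N (\<lambda>i j. u i (f j)) * fdet N (\<lambda>i j. u' i (f j)) = fdet N (\<lambda>i j. u i (g j)) * fdet N (\<lambda>i j. u' i (g j))"
proof -
  define \<pi> where "\<pi> = (\<lambda>j. if j < N then inv_into {..<N} g (f j) else j)"
  have g\<pi>: "g (\<pi> j) = f j" if "j < N" for j
    using f_inv_into_f[of "f j" g "{..<N}"] f(2) that by (auto simp: \<pi>_def)
  have \<pi>N: "\<pi> j < N" if "j < N" for j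
    using inv_into_into[of "f j" g "{..<N}"] f(2) that by (auto simp: \<pi>_def)
  have "inj_on \<pi> {..<N}"
    using f(1) g\<pi> unfolding inj_on_def by (metis lessThan_iff)
  moreover from this have "\<pi> ` {..<N} = {..<N}"
    using \<pi>N by (intro endo_inj_surj) auto
  ultimately have "bij_betw \<pi> {..<N} {..<N}"
    by (simp add: bij_betw_def)
  hence \<pi>: "\<pi> permutes {..<N}" by (rule bij_imp_permutes) (auto simp: \<pi>_def)
  have "fdet N (\<lambda>i j. u i (f j)) = signof \<pi> * fdet N (\<lambda>i j. u i (g j))" for u :: "nat \<Rightarrow> nat \<Rightarrow> complex"
  proof -
    have "fdet N (\<lambda>i j. u i (f j)) = fdet N (\<lambda>i j. u i (g (\<pi> j)))" by (intro fdet_cong) (simp add: g\<pi>)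
    thus ?thesis using fdet_permute_cols[OF \<pi>, of "\<lambda>i j. u i (g j)"] by simp
  qed
  thus ?thesis by (simp add: sign_def)
qed

text \<open>Each of the two levels consists of the orderings of a single set, and replacing the
  entry \<open>N - 1\<close> by \<open>N\<close> is a bijection. Equal cardinalities preserve the
  ratio of the two leading terms; the number itself goes into a nonzero constant that
  cancels.\<close>

lemma card_level:
  assumes "N \<ge> 1"
  shows "card (level N (\<Sum>{..<N} + 1)) = card (level N (\<Sum>{..<N}))" "card (level N (\<Sum>{..<N})) > 0"
proof -
  define unshift where "unshift = (\<lambda>x. if x = N then N - 1 else x)"
  have shift_neq: "last_shift N x \<noteq> last_shift N y" if "x < N" "y < N" "x \<noteq> y" for x y
    using last_shift_inj[of N] that by (auto simp: inj_on_def)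
  have bl: "unshift (last_shift N x) = x" if "x < N" for x using that by (auto simp: unshift_def last_shift_def)
  have lb: "last_shift N (unshift x) = x" if "x \<in> last_shift N ` {..<N}" for x using that bl by auto
  have sum_ls: "\<Sum>(last_shift N ` {..<N}) = \<Sum>{..<N} + 1"
    using assms by (cases N) (auto simp: last_shift_image)
  have fin: "finite (level N e)" for e unfolding level_def
    by (rule finite_subset[of _ "{..<N} \<rightarrow>\<^sub>E {..<2*N}"]) (auto intro: finite_PiE)
  have "bij_betw (\<lambda>f. \<lambda>i\<in>{..<N}. last_shift N (f i)) (level N (\<Sum>{..<N})) (level N (\<Sum>{..<N} + 1))"
  proof (rule bij_betw_byWitness[of _ "\<lambda>f. \<lambda>i\<in>{..<N}. unshift (f i)"])
    show "\<forall>f\<in>level N (\<Sum>{..<N}). (\<lambda>i\<in>{..<N}. unshift ((\<lambda>i\<in>{..<N}. last_shift N (f i)) i)) = f"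
    proof
      fix f assume f: "f \<in> level N (\<Sum>{..<N})"
      hence "f i < N" if "i < N" for i using level_image(2)[OF f refl] that by auto
      thus "(\<lambda>i\<in>{..<N}. unshift ((\<lambda>i\<in>{..<N}. last_shift N (f i)) i)) = f"
        using f by (auto simp: fun_eq_iff bl level_def PiE_iff extensional_def)
    qed
    show "\<forall>f\<in>level N (\<Sum>{..<N} + 1). (\<lambda>i\<in>{..<N}. last_shift N ((\<lambda>i\<in>{..<N}. unshift (f i)) i)) = f"
    proof
      fix f assume f: "f \<in> level N (\<Sum>{..<N} + 1)"
      hence "f i \<in> last_shift N ` {..<N}" if "i < N" for i using level_image(3)[OF f assms refl] that by auto
      thus "(\<lambda>i\<in>{..<N}. last_shift N ((\<lambda>i\<in>{..<N}. unshift (f i)) i)) = f"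
        using f by (auto simp: fun_eq_iff lb level_def PiE_iff extensional_def)
    qed
    show "(\<lambda>f. \<lambda>i\<in>{..<N}. last_shift N (f i)) ` level N (\<Sum>{..<N}) \<subseteq> level N (\<Sum>{..<N} + 1)"
    proof safe
      fix f assume f: "f \<in> level N (\<Sum>{..<N})"
      let ?g = "\<lambda>i\<in>{..<N}. last_shift N (f i)"
      have im: "f ` {..<N} = {..<N}" using level_image(2)[OF f refl] .
      hence fN: "f i < N" if "i < N" for i using that by auto
      have injf: "inj_on f {..<N}" using f by (simp add: level_def)
      have inj: "inj_on ?g {..<N}"
      proof (rule inj_onI)
        fix i j assume ij: "i \<in> {..<N}" "j \<in> {..<N}" "?g i = ?g j"
        hence "f i = f j" using shift_neq[of "f i" "f j"] fN by auto
        thus "i = j" using inj_onD[OF injf] ij by blast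
      qed
      have "?g ` {..<N} = last_shift N ` (f ` {..<N})" by (auto simp: image_iff)
      hence "(\<Sum>i<N. ?g i) = \<Sum>{..<N} + 1" using sum_image[OF inj] im sum_ls by simp
      moreover have "last_shift N (f i) < 2 * N" if "i < N" for i
        using fN[OF that] assms by (simp add: last_shift_def)
      hence "?g \<in> {..<N} \<rightarrow>\<^sub>E {..<2*N}" by (intro PiE_I) auto
      ultimately show "?g \<in> level N (\<Sum>{..<N} + 1)" using inj by (simp add: level_def)
    qed
    show "(\<lambda>f. \<lambda>i\<in>{..<N}. unshift (f i)) ` level N (\<Sum>{..<N} + 1) \<subseteq> level N (\<Sum>{..<N})"
    proof safe
      fix f assume f: "f \<in> level N (\<Sum>{..<N} + 1)"
      let ?g = "\<lambda>i\<in>{..<N}. unshift (f i)"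
      have im: "f ` {..<N} = last_shift N ` {..<N}" using level_image(3)[OF f assms refl] .
      hence fN: "f i \<in> last_shift N ` {..<N}" if "i < N" for i using that by auto
      have injf: "inj_on f {..<N}" using f by (simp add: level_def)
      have inj: "inj_on ?g {..<N}"
      proof (rule inj_onI)
        fix i j assume ij: "i \<in> {..<N}" "j \<in> {..<N}" "?g i = ?g j"
        hence "last_shift N (unshift (f i)) = last_shift N (unshift (f j))" by simp
        moreover have "last_shift N (unshift (f i)) = f i" "last_shift N (unshift (f j)) = f j"
          by (rule lb, rule fN, use ij in simp)+
        ultimately have "f i = f j" by (simp only:)
        thus "i = j" using inj_onD[OF injf] ij by blast
      qed
      have "?g ` {..<N} = unshift ` (f ` {..<N})" by (auto simp: image_iff)
      also have "\<dots> = {..<N}" unfolding im image_image using bl by simp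
      finally have "?g ` {..<N} = {..<N}" .
      moreover have "unshift (f i) < N" if "i < N" for i using fN[OF that] bl by auto
      hence "unshift (f i) < 2 * N" if "i < N" for i using that by fastforce
      hence "?g \<in> {..<N} \<rightarrow>\<^sub>E {..<2*N}" by (intro PiE_I) auto
      ultimately show "?g \<in> level N (\<Sum>{..<N})" using inj sum_image[OF inj] by (simp add: level_def)
    qed
  qed
  thus "card (level N (\<Sum>{..<N} + 1)) = card (level N (\<Sum>{..<N}))" by (rule bij_betw_same_card[symmetric])
  have "(\<lambda>i\<in>{..<N}. i) \<in> level N (\<Sum>{..<N})" by (auto simp: level_def inj_on_def)
  thus "card (level N (\<Sum>{..<N})) > 0" using fin by (auto simp: card_gt_0_iff)
qed

lemma bigo_divide:
  fixes f S :: "'a \<Rightarrow> complex"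
  assumes "f \<in> O[F](\<lambda>x. S x * S x)"
  shows "(\<lambda>x. f x / S x) \<in> O[F](S)"
proof -
  obtain C where "eventually (\<lambda>x. cmod (f x) \<le> C * cmod (S x * S x)) F"
    using assms by (elim landau_o.bigE)
  thus ?thesis
  proof (intro bigoI[of _ C], eventually_elim)
    case (elim x)
    thus ?case by (cases "S x = 0") (auto simp: norm_divide norm_mult field_simps)
  qed
qed

text \<open>Permutations of the columns \<open>0, \<dots>, N - 1\<close> and of \<open>0, \<dots>, N - 2, N\<close> contribute at the same order, because the
  first minor vanishes to leading order at a root.\<close>

lemma root_gram:
  fixes S :: "'a \<Rightarrow> complex" and u u' :: "'a \<Rightarrow> nat \<Rightarrow> nat \<Rightarrow> complex"
  assumes N: "N \<ge> 1" and S: "S \<in> O[F](\<lambda>_. 1)" "eventually (\<lambda>x. S x \<noteq> 0) F" and a: "a \<noteq> 0" "a' \<noteq> 0"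
    and u: "\<And>i v. i < N \<Longrightarrow> (\<lambda>x. u x i v) \<in> O[F](\<lambda>_. 1)" "\<And>i v. i < N \<Longrightarrow> (\<lambda>x. u' x i v) \<in> O[F](\<lambda>_. 1)"
    and d0: "close F S (\<lambda>x. fdet N (u x) / S x) (\<lambda>x. a * p * \<zeta> x)" "close F S (\<lambda>x. fdet N (u' x) / S x) (\<lambda>x. a' * p' * \<zeta>' x)"
    and d1: "close F S (\<lambda>x. fdet N (\<lambda>i j. u x i (last_shift N j))) (\<lambda>_. p / 2)"
       "close F S (\<lambda>x. fdet N (\<lambda>i j. u' x i (last_shift N j))) (\<lambda>_. p' / 2)"
  obtains T where
    "close F S T (\<lambda>x. of_nat (card (level N (\<Sum>{..<N}))) * p * p' / fact N * (\<zeta> x * \<zeta>' x + 1 / 4))"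
    "eventually (\<lambda>x. gram N (2 * N) (\<lambda>i v. (a * S x) ^ v * u x i v) (\<lambda>i v. (a' * S x) ^ v * u' x i v)
      = (a * a' * (S x * S x)) ^ (\<Sum>{..<N} + 1) * T x) F"
proof -
  define E where "E = \<Sum>{..<N}"
  let ?PE = "{..<N} \<rightarrow>\<^sub>E {..<2*N}"
  define d d' where "d = (\<lambda>f x. fdet N (\<lambda>i j. u x i (f j)))" and "d' = (\<lambda>f x. fdet N (\<lambda>i j. u' x i (f j)))"
  define q where "q = (\<lambda>x. a * a' * (S x * S x))"
  \<comment> \<open>\<open>W f\<close> is the term of \<open>f\<close> divided by
    \<open>q^(E + 1)\<close>. On the lowest level this removes one factor \<open>q\<close> too many;
    the two minors there, each of order \<open>S\<close>, make up for it.\<close>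
  define W where "W = (\<lambda>f x. if \<not> inj_on f {..<N} then 0 else if (\<Sum>i<N. f i) = E then d f x * d' f x / q x
     else q x ^ ((\<Sum>i<N. f i) - E - 1) * (d f x * d' f x))"
  define L where "L = (\<lambda>f x. if \<not> inj_on f {..<N} then 0 else if (\<Sum>i<N. f i) = E then p * p' * (\<zeta> x * \<zeta>' x)
     else if (\<Sum>i<N. f i) = E + 1 then p * p' / 4 else 0 :: complex)"
  have aS: "close F S S (\<lambda>_. 0)" using S(1) by (simp add: close_def)
  have W: "close F S (W f) (L f)" if f: "f \<in> ?PE" for f
  proof (cases "inj_on f {..<N}")
    case False
    thus ?thesis by (simp add: W_def L_def)
  next
    case inj: True
    hence lev: "f \<in> level N (\<Sum>i<N. f i)" using f by (simp add: level_def)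
    consider "(\<Sum>i<N. f i) = E" | "(\<Sum>i<N. f i) = E + 1" | "(\<Sum>i<N. f i) \<ge> E + 2"
      using level_image(1)[OF lev] by (auto simp: E_def) linarith
    thus ?thesis
    proof cases
      case 1
      have "f ` {..<N} = (\<lambda>j. j) ` {..<N}" using level_image(2)[OF lev] 1 by (simp add: E_def)
      hence "d f x * d' f x = fdet N (u x) * fdet N (u' x)" for x
        unfolding d_def d'_def using fdet_product_permuted[OF inj, of "\<lambda>j. j" "u x" "u' x"] by simp
      hence Wf: "W f = (\<lambda>x. 1 / (a * a') * (fdet N (u x) / S x * (fdet N (u' x) / S x)))"
        using inj 1 by (simp add: W_def q_def fun_eq_iff)
      have "close F S (W f) (\<lambda>x. 1 / (a * a') * (a * p * \<zeta> x * (a' * p' * \<zeta>' x)))"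
        unfolding Wf by (intro close_mult close_const d0)
      moreover have "(\<lambda>x. 1 / (a * a') * (a * p * \<zeta> x * (a' * p' * \<zeta>' x))) = L f"
        using inj 1 a by (simp add: L_def fun_eq_iff field_simps)
      ultimately show ?thesis by simp
    next
      case 2
      have "f ` {..<N} = last_shift N ` {..<N}" using level_image(3)[OF lev N] 2 by (simp add: E_def)
      hence "d f x * d' f x = fdet N (\<lambda>i j. u x i (last_shift N j)) * fdet N (\<lambda>i j. u' x i (last_shift N j))" for x
        unfolding d_def d'_def using fdet_product_permuted[OF inj _ last_shift_inj, of "u x" "u' x"] by simp
      hence "W f = (\<lambda>x. fdet N (\<lambda>i j. u x i (last_shift N j)) * fdet N (\<lambda>i j. u' x i (last_shift N j)))"
        using inj 2 by (simp add: W_def fun_eq_iff)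
      moreover have "L f = (\<lambda>x. p / 2 * (p' / 2))" using inj 2 by (simp add: L_def fun_eq_iff)
      ultimately show ?thesis by (simp only:) (intro close_mult d1)
    next
      \<comment> \<open>At least one factor \<open>q\<close> remains while the minors are bounded,
        so all higher levels are absorbed by the error.\<close>
      case 3
      then obtain e where e: "(\<Sum>i<N. f i) - E - 1 = Suc e" by (auto dest!: le_Suc_ex)
      have O1: "close F S (d f) (d f)" "close F S (d' f) (d' f)" unfolding d_def d'_def
        by (intro close_fdet close_refl u; simp)+
      have "close F S (\<lambda>x. (\<Prod>i<Suc e. a * a' * (S x * S x)) * (d f x * d' f x)) (\<lambda>x. (\<Prod>i<Suc e. a * a' * (0 * 0)) * (d f x * d' f x))"
        by (intro close_mult close_prod close_const aS O1)
      moreover have "(\<lambda>x. (\<Prod>i<Suc e. a * a' * (S x * S x)) * (d f x * d' f x)) = W f"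
        using inj 3 e by (simp add: W_def q_def fun_eq_iff)
      moreover have "(\<lambda>x. (\<Prod>i<Suc e. a * a' * (0 * 0)) * (d f x * d' f x)) = L f"
        using inj 3 by (simp add: L_def fun_eq_iff)
      ultimately show ?thesis by simp
    qed
  qed
  have fin: "finite ?PE" by (rule finite_PiE) auto
  have L: "(\<Sum>f\<in>?PE. L f x) / fact N = of_nat (card (level N E)) * p * p' / fact N * (\<zeta> x * \<zeta>' x + 1 / 4)" for x
  proof -
    have "(\<Sum>f\<in>?PE. L f x) = (\<Sum>f\<in>?PE. (if f \<in> level N E then p * p' * (\<zeta> x * \<zeta>' x) else 0) + (if f \<in> level N (E + 1) then p * p' / 4 else 0))"
      by (intro sum.cong) (auto simp: L_def level_def)
    also have "\<dots> = of_nat (card (level N E)) * (p * p' * (\<zeta> x * \<zeta>' x)) + of_nat (card (level N (E + 1))) * (p * p' / 4)"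
    proof -
      have "?PE \<inter> {f. f \<in> level N e} = level N e" for e by (auto simp: level_def)
      thus ?thesis using fin by (simp add: sum.distrib sum.If_cases)
    qed
    finally show ?thesis using card_level(1)[OF N] by (simp add: E_def algebra_simps add_divide_distrib)
  qed
  show thesis
  proof (rule that[of "\<lambda>x. (\<Sum>f\<in>?PE. W f x) / fact N"])
    have "close F S (\<lambda>x. (\<Sum>f\<in>?PE. W f x) * (1 / fact N)) (\<lambda>x. (\<Sum>f\<in>?PE. L f x) * (1 / fact N))"
      by (intro close_mult close_sum W close_const)
    thus "close F S (\<lambda>x. (\<Sum>f\<in>?PE. W f x) / fact N)
        (\<lambda>x. of_nat (card (level N (\<Sum>{..<N}))) * p * p' / fact N * (\<zeta> x * \<zeta>' x + 1 / 4))"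
      unfolding E_def[symmetric] L[symmetric] by simp
    show "eventually (\<lambda>x. gram N (2 * N) (\<lambda>i v. (a * S x) ^ v * u x i v) (\<lambda>i v. (a' * S x) ^ v * u' x i v)
      = (a * a' * (S x * S x)) ^ (\<Sum>{..<N} + 1) * ((\<Sum>f\<in>?PE. W f x) / fact N)) F"
      using S(2)
    proof eventually_elim
      case (elim x)
      have q0: "q x \<noteq> 0" using elim a by (simp add: q_def)
      have summand: "fdet N (\<lambda>i j. (a * S x) ^ f j * u x i (f j)) * fdet N (\<lambda>i j. (a' * S x) ^ f j * u' x i (f j)) =
          q x ^ (E + 1) * W f x" if f: "f \<in> ?PE" for f
      proof -
        have sc: "fdet N (\<lambda>i j. c ^ f j * w i (f j)) = c ^ (\<Sum>i<N. f i) * fdet N (\<lambda>i j. w i (f j))" for c and w :: "nat \<Rightarrow> nat \<Rightarrow> complex"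
          using fdet_scale[of N "\<lambda>_. 1" "\<lambda>i j. w i (f j)" "\<lambda>j. c ^ f j"] by (simp add: power_sum mult.commute)
        have eq: "fdet N (\<lambda>i j. (a * S x) ^ f j * u x i (f j)) * fdet N (\<lambda>i j. (a' * S x) ^ f j * u' x i (f j)) =
            q x ^ (\<Sum>i<N. f i) * (d f x * d' f x)"
          unfolding sc d_def d'_def q_def by (simp add: power_mult_distrib mult_ac)
        show ?thesis
        proof (cases "inj_on f {..<N}")
          case False
          then obtain j k where "j < N" "k < N" "j \<noteq> k" "f j = f k" by (auto simp: inj_on_def)
          hence "d f x = 0" unfolding d_def by (intro fdet_identical_cols[of j N k]) auto
          thus ?thesis unfolding eq using False by (simp add: W_def)
        next
          case True
          hence "f \<in> level N (\<Sum>i<N. f i)" using f by (simp add: level_def)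
          hence le: "E \<le> (\<Sum>i<N. f i)" using level_image(1) by (simp add: E_def)
          show ?thesis
          proof (cases "(\<Sum>i<N. f i) = E")
            case True
            thus ?thesis unfolding eq using \<open>inj_on f _\<close> q0 by (simp add: W_def)
          next
            case False
            hence "(\<Sum>i<N. f i) = (E + 1) + ((\<Sum>i<N. f i) - E - 1)" using le by linarith
            hence "q x ^ (\<Sum>i<N. f i) = q x ^ (E + 1) * q x ^ ((\<Sum>i<N. f i) - E - 1)" by (metis power_add)
            thus ?thesis unfolding eq using \<open>inj_on f _\<close> False by (simp only: W_def if_True if_False not_False_eq_True simp_thms mult.assoc)
          qed
        qed
      qed
      show ?case unfolding cauchy_binet E_def[symmetric]
        by (simp add: summand sum_distrib_left[symmetric]) (simp add: q_def)
    qed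
  qed
qed

section \<open>Asymptotics near the roots\<close>

lemma close_poly:
  assumes "close F h f g" shows "close F h (\<lambda>x. poly p (f x)) (\<lambda>x. poly p (g x))"
  by (induction p) (auto intro!: close_add close_mult assms)

lemma close_bigo_left:
  assumes "(\<lambda>x. f x - g x) \<in> O[F](h)" "h \<in> O[F](\<lambda>_. 1)" "close F h g g'"
  shows "close F h f g'"
proof -
  have "(\<lambda>x. (f x - g x) + (g x - g' x)) \<in> O[F](h)"
    using sum_in_bigo(1)[OF assms(1), of "\<lambda>x. g x - g' x"] assms(3) by (simp add: close_def)
  moreover have "(\<lambda>x. (f x - g x) + g x) \<in> O[F](\<lambda>_. 1)"
    using sum_in_bigo(1)[OF landau_o.big_trans[OF assms(1,2)], of g] assms(3) by (simp add: close_def)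
  ultimately show ?thesis using assms(3) by (simp add: close_def)
qed

text \<open>Second-order Taylor expansion as a polynomial identity, with a polynomial remainder that
  stays bounded near \<open>z\<close>.\<close>

lemma simple_root_expansion:
  fixes q :: "complex poly"
  assumes "poly q z = 0"
  obtains p where "\<And>h. poly q (z + h) = h * (poly (pderiv q) z + h * poly p (z + h))"
proof -
  obtain r where r: "q = [:- z, 1:] * r" using assms by (auto simp: poly_eq_0_iff_dvd elim: dvdE)
  have "poly (r - [:poly r z:]) z = 0" by simp
  then obtain p where p: "r - [:poly r z:] = [:- z, 1:] * p" by (meson poly_eq_0_iff_dvd dvdE)
  have "poly (pderiv q) z = poly r z" unfolding r pderiv_mult by (simp add: pderiv_pCons)
  hence pd: "poly r z = poly (pderiv q) z" ..
  have "poly q (z + h) = h * (poly r z + h * poly p (z + h))" for h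
  proof -
    have "poly r (z + h) = poly r z + h * poly p (z + h)"
      using arg_cong[OF p, of "\<lambda>p. poly p (z + h)"] by (simp add: algebra_simps)
    moreover have "poly [:- z, 1:] (z + h) = h" by simp
    ultimately show ?thesis unfolding r poly_mult by (simp only:)
  qed
  thus thesis unfolding pd by (rule that)
qed

context spiral
begin

text \<open>With the scale \<open>\<sigma> = sc / c\<close>, the coordinate
  \<open>z c / sc + \<zeta>\<close> becomes \<open>z + \<sigma> \<zeta>\<close> and the leading
  drift becomes \<open>yv_const m\<close>, so the rows turn into those of
  \<open>theta m (z + \<sigma> \<zeta>)\<close>. The error must be \<open>S^2\<close> rather than
  \<open>S\<close>, because the minor on the initial columns is itself of order \<open>S\<close> at
  a root and is divided by \<open>S\<close>.\<close>

lemma root_side: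
  fixes F :: "'a filter" and R :: "'a \<Rightarrow> real"
  assumes R: "filterlim R at_top F"
    and c: "c \<noteq> 0" "c ^ (2 * m + 1) = - (of_nat (2 * m + 1) / 2 ^ (2 * m)) * b (2 * m + 1)"
    and e1: "eventually (\<lambda>x. e x 1 = z * c / sc (R x) + \<zeta> x) F" and \<zeta>: "\<zeta> \<in> O[F](\<lambda>_. 1)"
    and e_even: "\<And>x k. even k \<Longrightarrow> e x k = 0" and e: "\<And>k. (\<lambda>x. sc (R x) * e x k) \<in> O[F](\<lambda>_. 1)"
    and z: "poly (qpoly m N) z = 0"
  defines "p \<equiv> (1/2) ^ (\<Sum>{..<N}) * poly (pderiv (qpoly m N)) z"
  obtains u where "\<And>i v. (\<lambda>x. u x i v) \<in> O[F](\<lambda>_. 1)"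
    "close F (\<lambda>x. sc (R x)) (\<lambda>x. fdet N (u x) / sc (R x)) (\<lambda>x. 1 / c * p * \<zeta> x)"
    "close F (\<lambda>x. sc (R x)) (\<lambda>x. fdet N (\<lambda>i j. u x i (last_shift N j))) (\<lambda>_. p / 2)"
    "eventually (\<lambda>x. \<forall>i v. odd_row (spiral_fps (of_real (R x)) * schur_fps (e x)) i v =
        (\<alpha> * of_real (R x) / (sc (R x) / c) ^ (2 * i)) * ((1 / c * sc (R x)) ^ v * u x i v)) F"
proof -
  define S where "S = (\<lambda>x. sc (R x))"
  define \<sigma> where "\<sigma> = (\<lambda>x. 1 / c * S x)"
  define S2 where "S2 = (\<lambda>x. S x * S x)"
  have evR: "eventually (\<lambda>x. R x > 0) F"
    using filterlim_iff[THEN iffD1, OF R] eventually_gt_at_top[of "0::real"] by blast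
  have SO: "S \<in> O[F](\<lambda>_. 1)" unfolding S_def using landau_o.big.compose[OF sc_bounded R] by simp
  have aS: "close F S S (\<lambda>_. 0)" using SO by (simp add: close_def)
  have S2S: "S2 \<in> O[F](S)" using landau_o.big.mult[OF SO, of S S] by (simp add: S2_def)
  have a\<sigma>: "close F S \<sigma> (\<lambda>_. 0)" using close_mult[OF close_const[of F S "1/c"] aS] by (simp add: \<sigma>_def)
  have pow: "close F S2 (\<lambda>x. \<sigma> x ^ n * g x) (\<lambda>_. 0)" if n: "n \<ge> 2" and g: "g \<in> O[F](\<lambda>_. 1)" for n g
  proof -
    obtain k where k: "n = 2 + k" using n le_Suc_ex by blast
    have S2': "close F S2 S2 (\<lambda>_. 0)" unfolding close_def
      using landau_o.big_trans[OF S2S SO] by simp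
    have refl: "close F S2 \<sigma> \<sigma>" "close F S2 g g" using a\<sigma> g by (auto simp: close_def)
    have "close F S2 (\<lambda>x. 1 / (c * c) * S2 x * (\<Prod>i<k. \<sigma> x) * g x) (\<lambda>x. 1 / (c * c) * 0 * (\<Prod>i<k. \<sigma> x) * g x)"
      by (intro close_mult close_const close_prod refl S2')
    moreover have "(\<lambda>x. 1 / (c * c) * S2 x * (\<Prod>i<k. \<sigma> x) * g x) = (\<lambda>x. \<sigma> x ^ n * g x)"
      by (simp add: k S2_def \<sigma>_def fun_eq_iff power_add power2_eq_square)
    ultimately show ?thesis by simp
  qed
  \<comment> \<open>The hypothesis on \<open>c\<close> says
    \<open>b (2 m + 1) = c^(2 m + 1) yv_const m\<close>; this is the origin of the factor
    \<open>- (2 m + 1) / 2^(2 m)\<close>.\<close>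
  have scJ: "\<sigma> x ^ (2 * m + 1) * (of_real (R x) * b (2 * m + 1)) = yv_const m" if "R x > 0" for x
  proof -
    have b: "b (2 * m + 1) = c ^ (2 * m + 1) * yv_const m"
      using c(2) by (simp add: yv_const_def field_simps del: of_nat_Suc power_Suc)
    have "\<sigma> x ^ (2 * m + 1) * (of_real (R x) * b (2 * m + 1)) =
        (1 / c) ^ (2 * m + 1) * c ^ (2 * m + 1) * (S x ^ (2 * m + 1) * of_real (R x)) * yv_const m"
      unfolding b \<sigma>_def power_mult_distrib by (simp only: mult_ac)
    also have "(1 / c) ^ (2 * m + 1) * c ^ (2 * m + 1) = 1" using c(1) by (simp flip: power_mult_distrib)
    also have "S x ^ (2 * m + 1) * of_real (R x) = 1" unfolding S_def by (rule sc_power[OF that])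
    finally show ?thesis by simp
  qed
  define y where "y = (\<lambda>x v k. \<sigma> x ^ k * (of_real (R x) * b k + e x k + of_nat v * svec k))"
  \<comment> \<open>All corrections carry at least \<open>\<sigma>^2\<close>: even indices start at
    2, odd indices from 3 on lose only one power to the growth of \<open>e\<close>, and drift terms
    beyond \<open>2 m + 1\<close> are at least two indices higher because those of even index
    vanish.\<close>
  have ay: "close F S2 (\<lambda>x. y x v k) (\<lambda>x. if k = 1 then z + \<sigma> x * \<zeta> x else if k = 2 * m + 1 then yv_const m else 0)" (is "close F S2 _ ?y'")
    if k: "1 \<le> k" for v k
  proof -
    consider "k = 1" | "even k" "k \<ge> 2" | "odd k" "k \<ge> 3" using k by (cases "k = 1"; cases "even k") (auto elim!: evenE oddE)
    thus ?thesis
    proof cases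
      case 1
      have "(\<lambda>x. z + \<sigma> x * \<zeta> x) \<in> O[F](\<lambda>_. 1)"
      proof -
        have "close F S (\<lambda>x. z + \<sigma> x * \<zeta> x) (\<lambda>x. z + 0 * \<zeta> x)" by (intro close_add close_mult close_const a\<sigma> close_refl \<zeta>)
        thus ?thesis by (simp add: close_def)
      qed
      hence refl: "close F S2 (\<lambda>x. z + \<sigma> x * \<zeta> x) (\<lambda>x. z + \<sigma> x * \<zeta> x)" by (rule close_refl)
      have "eventually (\<lambda>x. z + \<sigma> x * \<zeta> x = y x v k) F"
        using e1 evR
      proof eventually_elim
        case (elim x)
        have "S x \<noteq> 0" unfolding S_def using elim(2) by (rule sc_nonzero)
        thus ?case using 1 m_pos c(1) elim(1) by (simp add: y_def \<sigma>_def S_def b_low svec_odd field_simps)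
      qed
      from close_cong[OF refl this] show ?thesis using 1 by simp
    next
      case 2
      have "(\<lambda>_. of_nat v * svec k) \<in> O[F](\<lambda>_. 1)" by simp
      moreover have "k \<noteq> 2 * m + 1" "k \<noteq> 1" using 2(1) by auto
      ultimately show ?thesis using pow[OF 2(2), of "\<lambda>_. of_nat v * svec k"] 2
        by (simp add: y_def b_even e_even)
    next
      case 3
      have ev: "close F S2 (\<lambda>x. \<sigma> x ^ k * e x k) (\<lambda>_. 0)"
      proof -
        have "(\<lambda>x. 1 / c * (S x * e x k)) \<in> O[F](\<lambda>_. 1)" using e[of k] c(1) by (simp add: S_def)
        from pow[OF _ this, of "k - 1"] have "close F S2 (\<lambda>x. \<sigma> x ^ (k - 1) * (1 / c * (S x * e x k))) (\<lambda>_. 0)" using 3 by simp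
        moreover have "\<sigma> x ^ k = \<sigma> x ^ (k - 1) * \<sigma> x" for x using 3 by (simp flip: power_Suc2)
        ultimately show ?thesis by (simp add: \<sigma>_def mult_ac)
      qed
      have rb: "close F S2 (\<lambda>x. \<sigma> x ^ k * (of_real (R x) * b k)) (\<lambda>_. if k = 2 * m + 1 then yv_const m else 0)"
      proof (cases k "2 * m + 1" rule: linorder_cases)
        case less
        thus ?thesis by (simp add: b_low)
      next
        case equal
        have "eventually (\<lambda>x. yv_const m = \<sigma> x ^ k * (of_real (R x) * b k)) F"
          using evR by eventually_elim (simp only: equal scJ)
        from close_cong[OF close_const this] show ?thesis using equal by simp
      next
        case greater
        show ?thesis
        proof (cases "b (2 * m + 1) = 0")
          case True
          hence False using c by simp
          thus ?thesis ..
        next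
          case False
          define n where "n = k - (2 * m + 1)"
          have kn: "k = (2 * m + 1) + n" using greater by (simp add: n_def)
          have "even n" "n > 0" using 3(1) kn greater by auto
          hence n2: "n \<ge> 2" by (auto elim!: evenE)
          have "eventually (\<lambda>x. \<sigma> x ^ n * (yv_const m * (b k / b (2 * m + 1))) = \<sigma> x ^ k * (of_real (R x) * b k)) F"
            using evR
          proof eventually_elim
            case (elim x)
            have "\<sigma> x ^ k * (of_real (R x) * b k) =
               \<sigma> x ^ n * ((\<sigma> x ^ (2 * m + 1) * (of_real (R x) * b (2 * m + 1))) * (b k / b (2 * m + 1)))"
              using False unfolding kn power_add by (simp add: field_simps del: power_Suc)
            thus ?case by (simp only: scJ[OF elim])
          qed
          from close_cong[OF pow[OF n2, of "\<lambda>_. yv_const m * (b k / b (2 * m + 1))"] this]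
          show ?thesis using greater by simp
        qed
      qed
      have "close F S2 (\<lambda>x. \<sigma> x ^ k * (of_real (R x) * b k) + \<sigma> x ^ k * e x k)
          (\<lambda>_. (if k = 2 * m + 1 then yv_const m else 0) + 0)"
        by (intro close_add rb ev)
      thus ?thesis using 3 by (simp add: y_def svec_odd distrib_left)
    qed
  qed
  \<comment> \<open>The row without its row factor and the weight \<open>\<sigma>^v\<close>. The
    leftover odd row has the factor \<open>\<sigma>^(2 m)\<close>, which is again
    \<open>O(S^2)\<close> because \<open>m \<ge> 1\<close>.\<close>
  define u where "u = (\<lambda>x i v. (1/2) ^ v * (toep (schur_fps (y x v)) (2 * i) v +
     \<sigma> x ^ (2 * m) * (c ^ (2 * m + 1) / \<alpha>) * toep (schur_fps (y x v)) (2 * i + 1) v))"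
  have au: "close F S2 (\<lambda>x. u x i v) (\<lambda>x. (1/2) ^ v * toep (theta m (z + \<sigma> x * \<zeta> x)) (2 * i) v)" for i v
  proof -
    have t: "close F S2 (\<lambda>x. toep (schur_fps (y x v)) j v) (\<lambda>x. toep (theta m (z + \<sigma> x * \<zeta> x)) j v)" for j
      unfolding theta_def by (intro close_toep close_schur_fps ay)
    have "2 * m \<ge> 2" using m_pos by simp
    hence "close F S2 (\<lambda>x. \<sigma> x ^ (2 * m) * (c ^ (2 * m + 1) / \<alpha>)) (\<lambda>_. 0)" by (rule pow) simp
    hence "close F S2 (\<lambda>x. u x i v) (\<lambda>x. (1/2) ^ v * (toep (theta m (z + \<sigma> x * \<zeta> x)) (2 * i) v +
        0 * toep (theta m (z + \<sigma> x * \<zeta> x)) (2 * i + 1) v))"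
      unfolding u_def by (intro close_mult close_add close_const t)
    thus ?thesis by simp
  qed
  have uO: "(\<lambda>x. u x i v) \<in> O[F](\<lambda>_. 1)" for i v using au by (simp add: close_def)
  have half: "fdet N (\<lambda>i j. (1/2) ^ f j * w i (f j)) = (1/2) ^ (\<Sum>j<N. f j) * fdet N (\<lambda>i j. w i (f j))"
    for f and w :: "nat \<Rightarrow> nat \<Rightarrow> complex"
    using fdet_scale[of N "\<lambda>_. 1" "\<lambda>i j. w i (f j)" "\<lambda>j. (1/2) ^ f j"] by (simp add: power_sum mult.commute)
  have S2O: "S2 \<in> O[F](\<lambda>_. 1)" by (rule landau_o.big_trans[OF S2S SO])
  obtain q where q: "\<And>h. poly (qpoly m N) (z + h) = h * (poly (pderiv (qpoly m N)) z + h * poly q (z + h))"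
    using simple_root_expansion[OF z] by blast
  have d0: "close F S (\<lambda>x. fdet N (u x) / S x) (\<lambda>x. 1 / c * p * \<zeta> x)"
  proof (rule close_bigo_left[OF _ SO])
    let ?g = "\<lambda>x. (1/2) ^ (\<Sum>{..<N}) * poly (qpoly m N) (z + \<sigma> x * \<zeta> x)"
    have "close F S2 (\<lambda>x. fdet N (u x)) (\<lambda>x. fdet N (\<lambda>i j. (1/2) ^ j * toep (theta m (z + \<sigma> x * \<zeta> x)) (2 * i) j))"
      by (intro close_fdet au)
    hence "close F S2 (\<lambda>x. fdet N (u x)) ?g"
      using half[of "\<lambda>j. j"] by (simp only: poly_qpoly[OF m_pos])
    hence "(\<lambda>x. fdet N (u x) - ?g x) \<in> O[F](\<lambda>x. S x * S x)" by (simp add: close_def S2_def)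
    from bigo_divide[OF this] show "(\<lambda>x. fdet N (u x) / S x - ?g x / S x) \<in> O[F](S)"
      by (simp add: diff_divide_distrib)
    have az: "close F S (\<lambda>x. z + \<sigma> x * \<zeta> x) (\<lambda>x. z + \<sigma> x * \<zeta> x)"
    proof (rule close_refl)
      have "close F S (\<lambda>x. z + \<sigma> x * \<zeta> x) (\<lambda>x. z + 0 * \<zeta> x)" by (intro close_add close_mult close_const a\<sigma> close_refl \<zeta>)
      thus "(\<lambda>x. z + \<sigma> x * \<zeta> x) \<in> O[F](\<lambda>_. 1)" by (simp add: close_def)
    qed
    have "close F S (\<lambda>x. 1 / c * (1/2) ^ (\<Sum>{..<N}) * \<zeta> x * (poly (pderiv (qpoly m N)) z + \<sigma> x * (\<zeta> x * poly q (z + \<sigma> x * \<zeta> x))))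
       (\<lambda>x. 1 / c * (1/2) ^ (\<Sum>{..<N}) * \<zeta> x * (poly (pderiv (qpoly m N)) z + 0 * (\<zeta> x * poly q (z + \<sigma> x * \<zeta> x))))"
      by (intro close_mult close_add close_const a\<sigma> close_refl[OF \<zeta>] close_poly az)
    moreover have "eventually (\<lambda>x. 1 / c * (1/2) ^ (\<Sum>{..<N}) * \<zeta> x * (poly (pderiv (qpoly m N)) z + \<sigma> x * (\<zeta> x * poly q (z + \<sigma> x * \<zeta> x)))
        = ?g x / S x) F"
      using evR
    proof eventually_elim
      case (elim x)
      have S0: "S x \<noteq> 0" unfolding S_def using elim by (rule sc_nonzero)
      have "?g x / S x = (1/2) ^ (\<Sum>{..<N}) * (\<sigma> x / S x) * \<zeta> x * (poly (pderiv (qpoly m N)) z + \<sigma> x * \<zeta> x * poly q (z + \<sigma> x * \<zeta> x))"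
        unfolding q[of "\<sigma> x * \<zeta> x"] by simp
      also have "\<sigma> x / S x = 1 / c" using S0 by (simp add: \<sigma>_def)
      finally show ?case by (simp only: mult_ac)
    qed
    ultimately show "close F S (\<lambda>x. ?g x / S x) (\<lambda>x. 1 / c * p * \<zeta> x)"
      by (rule close_cong) (simp add: p_def mult_ac)
  qed
  have d1: "close F S (\<lambda>x. fdet N (\<lambda>i j. u x i (last_shift N j))) (\<lambda>_. p / 2)"
  proof -
    have th: "close F S (\<lambda>x. toep (theta m (z + \<sigma> x * \<zeta> x)) i v) (\<lambda>_. toep (theta m z) i v)" for i v
      unfolding theta_def
    proof (intro close_toep close_schur_fps)
      fix k
      have "close F S (\<lambda>x. z + \<sigma> x * \<zeta> x) (\<lambda>x. z + 0)"
      proof -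
        have "close F S (\<lambda>x. \<sigma> x * \<zeta> x) (\<lambda>x. 0 * \<zeta> x)" by (intro close_mult a\<sigma> close_refl \<zeta>)
        thus ?thesis by (intro close_add close_const) simp
      qed
      thus "close F S (\<lambda>x. if k = 1 then z + \<sigma> x * \<zeta> x else if k = 2 * m + 1 then yv_const m else 0)
         (\<lambda>_. if k = 1 then z else if k = 2 * m + 1 then yv_const m else 0)" by simp
    qed
    have "close F S (\<lambda>x. fdet N (\<lambda>i j. u x i (last_shift N j)))
        (\<lambda>x. fdet N (\<lambda>i j. (1/2) ^ last_shift N j * toep (theta m z) (2 * i) (last_shift N j)))"
    proof (intro close_fdet)
      fix i j
      have A: "close F S (\<lambda>x. (1/2) ^ last_shift N j * toep (theta m (z + \<sigma> x * \<zeta> x)) (2 * i) (last_shift N j))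
          (\<lambda>x. (1/2) ^ last_shift N j * toep (theta m z) (2 * i) (last_shift N j))"
        by (intro close_mult close_const th)
      have B: "(\<lambda>x. u x i (last_shift N j) - (1/2) ^ last_shift N j * toep (theta m (z + \<sigma> x * \<zeta> x)) (2 * i) (last_shift N j)) \<in> O[F](S)"
        using close_mono[OF au S2S] by (simp add: close_def)
      show "close F S (\<lambda>x. u x i (last_shift N j)) (\<lambda>x. (1/2) ^ last_shift N j * toep (theta m z) (2 * i) (last_shift N j))"
        by (rule close_bigo_left[OF B SO A])
    qed
    \<comment> \<open>The columns \<open>0, ..., N - 2, N\<close> carry one more factor
      \<open>1/2\<close> than the initial segment, hence \<open>p / 2\<close>.\<close>
    also have "fdet N (\<lambda>i j. (1/2) ^ last_shift N j * toep (theta m z) (2 * i) (last_shift N j)) = p / 2"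
    proof -
      have "(\<Sum>j<N. last_shift N j) = \<Sum>{..<N} + 1"
      proof -
        have "(\<Sum>j<N. last_shift N j) = \<Sum>(last_shift N ` {..<N})" using sum_image[OF last_shift_inj] by simp
        also have "\<dots> = \<Sum>{..<N} + 1" using N_pos by (cases N) (auto simp: last_shift_image)
        finally show ?thesis .
      qed
      thus ?thesis using half[of "last_shift N" "\<lambda>i. toep (theta m z) (2 * i)"]
        unfolding p_def poly_pderiv_qpoly[OF m_pos N_pos] by simp
    qed
    finally show ?thesis .
  qed
  have row: "odd_row (spiral_fps (of_real (R x)) * schur_fps (e x)) i v =
        (\<alpha> * of_real (R x) / (sc (R x) / c) ^ (2 * i)) * ((1 / c * sc (R x)) ^ v * u x i v)" if Rx: "R x > 0" for x i v
  proof -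
    define G where "G = schur_fps (\<lambda>k. of_real (R x) * b k + e x k + of_nat v * svec k)"
    have G: "spiral_fps (of_real (R x)) * schur_fps (e x) * svec_exp v = (1 + fps_const (\<alpha> * of_real (R x)) * fps_X) * G"
      by (simp add: spiral_fps_def G_def svec_exp_def schur_fps_add mult.assoc)
    have \<sigma>0: "\<sigma> x \<noteq> 0" using sc_nonzero[OF Rx] c(1) by (simp add: \<sigma>_def S_def)
    have T: "toep G j v = \<sigma> x ^ v / \<sigma> x ^ j * toep (schur_fps (y x v)) j v" for j
    proof (cases "v \<le> j")
      case True
      hence "\<sigma> x ^ j = \<sigma> x ^ (j - v) * \<sigma> x ^ v" by (simp flip: power_add)
      thus ?thesis using True \<sigma>0 by (simp add: toep_def schur_fps_scale G_def y_def)
    qed (simp add: toep_def)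
    have inv: "1 / \<sigma> x = of_real (R x) * (\<sigma> x ^ (2 * m) * c ^ (2 * m + 1))"
    proof -
      have "\<sigma> x * (of_real (R x) * (\<sigma> x ^ (2 * m) * c ^ (2 * m + 1))) = (\<sigma> x * c) ^ (2 * m + 1) * of_real (R x)"
        by (simp add: power_mult_distrib mult_ac)
      also have "\<sigma> x * c = sc (R x)" using c(1) by (simp add: \<sigma>_def S_def)
      also note sc_power[OF Rx]
      finally show ?thesis using \<sigma>0 by (metis nonzero_mult_div_cancel_left)
    qed
    have "odd_row (spiral_fps (of_real (R x)) * schur_fps (e x)) i v = (1/2) ^ v * (toep G (2 * i + 1) v + \<alpha> * of_real (R x) * toep G (2 * i) v)"
      unfolding odd_row_def schur_mat_def G toep_linear_mult ..
    also have "\<dots> = (1/2) ^ v * (\<sigma> x ^ v / \<sigma> x ^ (2 * i)) *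
       ((1 / \<sigma> x) * toep (schur_fps (y x v)) (2 * i + 1) v + \<alpha> * of_real (R x) * toep (schur_fps (y x v)) (2 * i) v)"
      unfolding T using \<sigma>0 by (simp add: field_simps)
    also have "\<dots> = (\<alpha> * of_real (R x) / \<sigma> x ^ (2 * i)) * (\<sigma> x ^ v * u x i v)"
      unfolding inv u_def using \<alpha>_nz \<sigma>0 by (simp add: field_simps)
    finally show ?thesis by (simp add: \<sigma>_def S_def)
  qed
  show thesis
    by (rule that[OF uO d0[unfolded S_def] d1[unfolded S_def]])
       (use evR in \<open>eventually_elim, use row in blast\<close>)
qed

end

text \<open>Matches the limit \<open>\<zeta> \<zeta>' + 1/4\<close> in \<open>root_gram\<close> and
  so identifies the wave near a root as the one of order 1.\<close>

lemma tau_1: "tau 1 a x t n = xplus a x t n 1 * xminus a x t n 1 + 1 / 4"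
proof -
  have one: "fps_nth (schur_fps y) 1 = y 1" for y using schur_fps_rec[of 0 y] by simp
  have o: "odd_row (schur_fps y) 0 0 = y 1" "odd_row (schur_fps y) 0 (Suc 0) = 1 / 2" for y
  proof -
    have "svec_exp 0 = 1" unfolding svec_exp_def by (rule schur_fps_uniqueI[symmetric]) simp_all
    thus "odd_row (schur_fps y) 0 0 = y 1" by (simp add: odd_row_def schur_mat_def toep_def one[simplified])
    show "odd_row (schur_fps y) 0 (Suc 0) = 1 / 2" by (simp add: odd_row_def schur_mat_def toep_def)
  qed
  have "fdet (Suc 0) A = A 0 0" for A :: "nat \<Rightarrow> nat \<Rightarrow> complex"
    using fdet_lower_triangular[of 1 A] by simp
  thus ?thesis by (simp add: tau_gram gram_def numeral_2_eq_2 o)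
qed

text \<open>\<open>yv_const m\<close> is real; hence the \<open>x^-\<close> side can be expanded at
  the root \<open>cnj z\<close>.\<close>

lemma cnj_qpoly: "m \<ge> 1 \<Longrightarrow> poly (qpoly m N) (cnj w) = cnj (poly (qpoly m N) w)"
proof -
  assume m: "m \<ge> 1"
  have "fps_nth (theta m (cnj w)) k = cnj (fps_nth (theta m w) k)" for k
    unfolding theta_def schur_fps_cnj[symmetric]
    by (intro arg_cong2[where f = fps_nth] arg_cong[where f = schur_fps] refl) (auto simp: yv_const_def)
  thus ?thesis unfolding poly_qpoly[OF m] cnj_fdet by (intro fdet_cong) (simp add: toep_def)
qed

lemma bigo_affine:
  fixes S f g :: "'a \<Rightarrow> complex"
  assumes "S \<in> O[F](\<lambda>_. 1)" "(\<lambda>x. S x * f x) \<in> O[F](\<lambda>_. 1)" "(\<lambda>x. S x * g x) \<in> O[F](\<lambda>_. 1)"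
  shows "(\<lambda>x. S x * ((f x + c * g x) * d + u)) \<in> O[F](\<lambda>_. 1)"
proof -
  note refl = assms[THEN close_refl, of "\<lambda>_. 1"]
  have "close F (\<lambda>_. 1) (\<lambda>x. (S x * f x + c * (S x * g x)) * d + u * S x) (\<lambda>x. (S x * f x + c * (S x * g x)) * d + u * S x)"
    by (intro close_add close_mult close_const refl)
  thus ?thesis by (simp add: close_def algebra_simps)
qed

lemma bigo_affine_xplus:
  fixes S :: "'a \<Rightarrow> complex" and f g :: "'a \<Rightarrow> real"
  assumes "S \<in> O[F](\<lambda>_. 1)" "(\<lambda>x. S x * of_real (f x)) \<in> O[F](\<lambda>_. 1)" "(\<lambda>x. S x * of_real (g x)) \<in> O[F](\<lambda>_. 1)"
  shows "(\<lambda>x. S x * xplus (\<lambda>_. 0) (f x) (g x) n k) \<in> O[F](\<lambda>_. 1)"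
    and "(\<lambda>x. S x * xminus (\<lambda>_. 0) (f x) (g x) n k) \<in> O[F](\<lambda>_. 1)"
proof -
  note aff = bigo_affine[OF assms]
  consider "k = 1" | "odd k" "k \<noteq> 1" | "even k" "k \<noteq> 1" by fastforce
  hence "(\<lambda>x. S x * xplus (\<lambda>_. 0) (f x) (g x) n k) \<in> O[F](\<lambda>_. 1) \<and>
      (\<lambda>x. S x * xminus (\<lambda>_. 0) (f x) (g x) n k) \<in> O[F](\<lambda>_. 1)"
  proof cases
    case 1
    thus ?thesis using aff[of "2 * \<i>" 1 "of_nat n"] aff[of "- 2 * \<i>" 1 "- of_nat n"] by (simp add: xplus_def xminus_def)
  next
    case 2
    thus ?thesis using aff[of "2 ^ k * \<i>" "1 / fact k" 0] aff[of "- (2 ^ k * \<i>)" "1 / fact k" 0]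
      by (simp add: xplus_def xminus_def)
  next
    case 3
    thus ?thesis by (simp add: xplus_def xminus_def)
  qed
  thus "(\<lambda>x. S x * xplus (\<lambda>_. 0) (f x) (g x) n k) \<in> O[F](\<lambda>_. 1)"
    and "(\<lambda>x. S x * xminus (\<lambda>_. 0) (f x) (g x) n k) \<in> O[F](\<lambda>_. 1)" by auto
qed

text \<open>The decomposition is still taken about \<open>z0 A\<close>, but the local vector now has
  size \<open>1/S\<close>. The \<open>x^+\<close> and \<open>x^-\<close> sides are expanded at
  conjugate roots and recombined by \<open>root_gram\<close>.\<close>

lemma rw_root:
  assumes sp: "spiral N m (z0 * cis \<phi>) (drift z0 \<phi> k1)" and sm: "spiral N m (cnj (z0 * cis \<phi>)) (\<lambda>k. cnj (drift z0 \<phi> k1 k))"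
    and a: "a = (\<lambda>r j. (if 1 \<le> j \<and> j \<le> N - 1 then z0 ^ (2 * j + 1) / of_nat (2 * j + 1) else 0) *
      (of_real r * cis \<phi>) ^ (2 * j + 1) + k1 j * (of_real r * cis \<phi>))"
    and c: "c \<noteq> 0" "c ^ (2 * m + 1) = - (of_nat (2 * m + 1) / 2 ^ (2 * m)) * drift z0 \<phi> k1 (2 * m + 1)"
    and z: "poly (qpoly m N) z = 0" "poly (pderiv (qpoly m N)) z \<noteq> 0" "poly (pderiv (qpoly m N)) (cnj z) \<noteq> 0"
    and P: "P = (\<lambda>r. z * of_real (r powr (1 / real (2 * m + 1))) * c + z0 * (of_real r * cis \<phi>))"
  shows "\<exists>C r0. \<forall>r\<ge>r0. \<forall>\<xi> \<eta>. \<bar>\<xi>\<bar> \<le> R \<and> \<bar>\<eta>\<bar> \<le> R \<longrightarrow>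
    cmod (rw N (a r) (Re (P r) + \<xi>) (Im (P r) / 2 + \<eta>) - hatq 1 \<xi> \<eta> * exp (2 * \<i> * of_real (Im (P r) / 2 + \<eta>)))
      \<le> C * \<bar>r powr (- 1 / real (2 * m + 1))\<bar>"
proof -
  interpret sp: spiral N m "z0 * cis \<phi>" "drift z0 \<phi> k1" by (fact sp)
  interpret sm: spiral N m "cnj (z0 * cis \<phi>)" "\<lambda>k. cnj (drift z0 \<phi> k1 k)" by (fact sm)
  define h where "h = (\<lambda>r::real. r powr (- 1 / real (2 * m + 1)))"
  define S where "S = (\<lambda>x::real\<times>real\<times>real. of_real (h (fst x)) :: complex)"
  have sc: "sp.sc (fst x) = S x" "sm.sc (fst x) = S x" for x :: "real\<times>real\<times>real"
    by (simp_all add: sp.sc_def sm.sc_def S_def h_def)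
  define B where "B = (\<lambda>x::real\<times>real\<times>real. of_real (fst x powr (1 / real (2 * m + 1))) * c)"
  have evr: "eventually (\<lambda>x::real\<times>real\<times>real. fst x > 0) (strip R)"
    using filterlim_iff[THEN iffD1, OF filterlim_fst_strip] eventually_gt_at_top[of "0::real"] by blast
  have BS: "B x = c / S x" "S x \<noteq> 0" if "fst x > 0" for x
  proof -
    show S0: "S x \<noteq> 0" using that by (simp add: S_def h_def)
    have "h (fst x) * fst x powr (1 / real (2 * m + 1)) = 1" using that by (simp add: h_def powr_minus)
    hence "S x * of_real (fst x powr (1 / real (2 * m + 1))) = 1" unfolding S_def by (metis of_real_mult of_real_1)
    hence "of_real (fst x powr (1 / real (2 * m + 1))) = 1 / S x" using S0 by (metis nonzero_mult_div_cancel_left)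
    thus "B x = c / S x" by (simp add: B_def)
  qed
  \<comment> \<open>Coordinates relative to \<open>z0 A\<close>: they grow like \<open>z B\<close>,
    and \<open>tau_reduce\<close> is applied to them in place of \<xi> and \<eta>.\<close>
  define f g where "f = (\<lambda>x. Re (z * B x) + fst (snd x))" and "g = (\<lambda>x. Im (z * B x) / 2 + snd (snd x))"
  have SO: "S \<in> O[strip R](\<lambda>_. 1)"
    using landau_o.big.compose[OF sp.sc_bounded filterlim_fst_strip[of R]] by (simp add: sc)
  have box1: "(\<lambda>x. of_real (fst (snd x)) :: complex) \<in> O[strip R](\<lambda>_. 1)" "(\<lambda>x. of_real (snd (snd x)) :: complex) \<in> O[strip R](\<lambda>_. 1)"
    by (auto intro!: strip_bounded[of R _ R])
  have SB: "(\<lambda>x. S x * of_real (Re (z * B x))) \<in> O[strip R](\<lambda>_. 1)" "(\<lambda>x. S x * of_real (Im (z * B x))) \<in> O[strip R](\<lambda>_. 1)"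
  proof -
    have "cmod (S x * of_real (Re (z * B x))) \<le> cmod (z * c) * cmod 1 \<and> cmod (S x * of_real (Im (z * B x))) \<le> cmod (z * c) * cmod 1"
      if "fst x > 0" for x
    proof -
      have "cmod (S x) * cmod (z * B x) = cmod (z * c)" using BS[OF that] by (simp add: norm_mult norm_divide)
      thus ?thesis using abs_Re_le_cmod[of "z * B x"] abs_Im_le_cmod[of "z * B x"]
        mult_left_mono[of "\<bar>Re (z * B x)\<bar>" "cmod (z * B x)" "cmod (S x)"]
        mult_left_mono[of "\<bar>Im (z * B x)\<bar>" "cmod (z * B x)" "cmod (S x)"]
        by (simp only: norm_mult norm_of_real norm_one mult_1_right) simp
    qed
    hence "eventually (\<lambda>x. cmod (S x * of_real (Re (z * B x))) \<le> cmod (z * c) * cmod 1 \<and>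
        cmod (S x * of_real (Im (z * B x))) \<le> cmod (z * c) * cmod 1) (strip R)"
      using evr by (auto elim: eventually_mono)
    thus "(\<lambda>x. S x * of_real (Re (z * B x))) \<in> O[strip R](\<lambda>_. 1)" "(\<lambda>x. S x * of_real (Im (z * B x))) \<in> O[strip R](\<lambda>_. 1)"
      by (auto intro!: bigoI[of _ "cmod (z * c)"] elim: eventually_mono)
  qed
  have mult1: "(\<lambda>x. S x * w x) \<in> O[strip R](\<lambda>_. 1)" if "w \<in> O[strip R](\<lambda>_. 1)" for w
    using landau_o.big.mult[OF SO that] by simp
  have Sf: "(\<lambda>x. S x * of_real (f x)) \<in> O[strip R](\<lambda>_. 1)"
    using sum_in_bigo(1)[OF SB(1) mult1[OF box1(1)]] by (simp add: f_def algebra_simps)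
  have Sg: "(\<lambda>x. S x * of_real (g x)) \<in> O[strip R](\<lambda>_. 1)"
  proof -
    have "(\<lambda>x. S x * of_real (Im (z * B x)) / 2 + S x * of_real (snd (snd x))) \<in> O[strip R](\<lambda>_. 1)"
      using SB(2) mult1[OF box1(2)] by (intro sum_in_bigo(1)) auto
    thus ?thesis by (simp add: g_def algebra_simps)
  qed
  define \<zeta> \<zeta>' where "\<zeta> = (\<lambda>n (x::real\<times>real\<times>real). xplus (\<lambda>_. 0) (fst (snd x)) (snd (snd x)) n 1)"
    and "\<zeta>' = (\<lambda>n (x::real\<times>real\<times>real). xminus (\<lambda>_. 0) (fst (snd x)) (snd (snd x)) n 1)"
  define p p' where "p = (1/2) ^ (\<Sum>{..<N}) * poly (pderiv (qpoly m N)) z"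
    and "p' = (1/2) ^ (\<Sum>{..<N}) * poly (pderiv (qpoly m N)) (cnj z)"
  define \<kappa> where "\<kappa> = of_nat (card (level N (\<Sum>{..<N}))) * p * p' / fact N"
  \<comment> \<open>The row factors of both sides and the weight extracted by
    \<open>root_gram\<close>; none of them depends on \<open>n\<close>.\<close>
  define D where "D = (\<lambda>x. (\<Prod>i<N. z0 * cis \<phi> * of_real (fst x) / (S x / c) ^ (2 * i)) *
     (\<Prod>i<N. cnj (z0 * cis \<phi>) * of_real (fst x) / (S x / cnj c) ^ (2 * i)) *
     (1 / c * (1 / cnj c) * (S x * S x)) ^ (\<Sum>{..<N} + 1))"
  have evD: "eventually (\<lambda>x. D x \<noteq> 0) (strip R)"
    using evr
  proof eventually_elim
    case (elim x)
    have "z0 \<noteq> 0" using sp.\<alpha>_nz by simp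
    thus ?case using elim BS(2)[OF elim] c(1) by (simp add: D_def)
  qed
  have c': "cnj c \<noteq> 0" "cnj c ^ (2 * m + 1) = - (of_nat (2 * m + 1) / 2 ^ (2 * m)) * cnj (drift z0 \<phi> k1 (2 * m + 1))"
    using c(1) arg_cong[OF c(2), of cnj] by (simp_all only: complex_cnj_power complex_cnj_mult complex_cnj_minus
      complex_cnj_divide complex_cnj_of_nat complex_cnj_numeral complex_cnj_zero_iff) simp
  have main: "\<exists>T. close (strip R) (\<lambda>x. of_real (h (fst x))) T (\<lambda>x. \<kappa> * tau 1 (\<lambda>_. 0) (fst (snd x)) (snd (snd x)) n) \<and>
     eventually (\<lambda>x. tau N (a (fst x)) (Re (P (fst x)) + fst (snd x)) (Im (P (fst x)) / 2 + snd (snd x)) n = D x * T x) (strip R)" for n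
  proof -
    define e where "e = (\<lambda>x. xplus (\<lambda>_. 0) (f x) (g x) n)"
    define e' where "e' = (\<lambda>x. xminus (\<lambda>_. 0) (f x) (g x) n)"
    have e1: "eventually (\<lambda>x. e x 1 = z * c / sp.sc (fst x) + \<zeta> n x) (strip R)"
      using evr
    proof eventually_elim
      case (elim x)
      have "e x 1 = z * B x + \<zeta> n x"
        by (simp add: e_def \<zeta>_def xplus_def f_def g_def complex_eq_iff)
      thus ?case using BS[OF elim] by (simp add: sc)
    qed
    have e1': "eventually (\<lambda>x. e' x 1 = cnj z * cnj c / sm.sc (fst x) + \<zeta>' n x) (strip R)"
      using evr
    proof eventually_elim
      case (elim x)
      have "e' x 1 = cnj (z * B x) + \<zeta>' n x"
        by (auto simp: e'_def \<zeta>'_def xminus_def f_def g_def complex_eq_iff field_simps)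
      moreover have "cnj (S x) = S x" by (simp add: S_def)
      ultimately show ?case using BS[OF elim] by (simp add: sc)
    qed
    have \<zeta>O: "\<zeta> n \<in> O[strip R](\<lambda>_. 1)" "\<zeta>' n \<in> O[strip R](\<lambda>_. 1)"
      unfolding \<zeta>_def \<zeta>'_def by (rule xplus_strip xminus_strip)+
    have even: "e x k = 0" "e' x k = 0" if "even k" for x k
      using that by (auto simp: e_def e'_def xplus_def xminus_def)
    have bd: "(\<lambda>x. sp.sc (fst x) * e x k) \<in> O[strip R](\<lambda>_. 1)" "(\<lambda>x. sm.sc (fst x) * e' x k) \<in> O[strip R](\<lambda>_. 1)" for k
      unfolding sc e_def e'_def by (rule bigo_affine_xplus[OF SO Sf Sg])+
    obtain u where u: "\<And>i v. (\<lambda>x. u x i v) \<in> O[strip R](\<lambda>_. 1)"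
      "close (strip R) S (\<lambda>x. fdet N (u x) / S x) (\<lambda>x. 1 / c * p * \<zeta> n x)"
      "close (strip R) S (\<lambda>x. fdet N (\<lambda>i j. u x i (last_shift N j))) (\<lambda>_. p / 2)"
      "eventually (\<lambda>x. \<forall>i v. odd_row (sp.spiral_fps (of_real (fst x)) * schur_fps (e x)) i v =
        (z0 * cis \<phi> * of_real (fst x) / (S x / c) ^ (2 * i)) * ((1 / c * S x) ^ v * u x i v)) (strip R)"
      by (rule sp.root_side[where R = fst and e = e and \<zeta> = "\<zeta> n",
            OF filterlim_fst_strip[of R] c e1 \<zeta>O(1) even(1) bd(1) z(1), unfolded sc, folded p_def])
         (assumption, rule that)
    have z': "poly (qpoly m N) (cnj z) = 0" using z(1) by (simp add: cnj_qpoly[OF sp.m_pos])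
    obtain u' where u': "\<And>i v. (\<lambda>x. u' x i v) \<in> O[strip R](\<lambda>_. 1)"
      "close (strip R) S (\<lambda>x. fdet N (u' x) / S x) (\<lambda>x. 1 / cnj c * p' * \<zeta>' n x)"
      "close (strip R) S (\<lambda>x. fdet N (\<lambda>i j. u' x i (last_shift N j))) (\<lambda>_. p' / 2)"
      "eventually (\<lambda>x. \<forall>i v. odd_row (sm.spiral_fps (of_real (fst x)) * schur_fps (e' x)) i v =
        (cnj (z0 * cis \<phi>) * of_real (fst x) / (S x / cnj c) ^ (2 * i)) * ((1 / cnj c * S x) ^ v * u' x i v)) (strip R)"
      by (rule sm.root_side[where R = fst and e = e' and \<zeta> = "\<zeta>' n",
            OF filterlim_fst_strip[of R] c' e1' \<zeta>O(2) even(2) bd(2) z', unfolded sc, folded p'_def])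
         (assumption, rule that)
    have evS: "eventually (\<lambda>x. S x \<noteq> 0) (strip R)" using evr by eventually_elim (rule BS(2))
    obtain T where T: "close (strip R) S T (\<lambda>x. \<kappa> * (\<zeta> n x * \<zeta>' n x + 1 / 4))"
      "eventually (\<lambda>x. gram N (2 * N) (\<lambda>i v. (1 / c * S x) ^ v * u x i v) (\<lambda>i v. (1 / cnj c * S x) ^ v * u' x i v)
      = (1 / c * (1 / cnj c) * (S x * S x)) ^ (\<Sum>{..<N} + 1) * T x) (strip R)"
      unfolding \<kappa>_def
      by (rule root_gram[OF sp.N_pos SO evS _ _ u(1) u'(1) u(2) u'(2) u(3) u'(3)]) (use c(1) in simp_all)
    have "eventually (\<lambda>x. tau N (a (fst x)) (Re (P (fst x)) + fst (snd x)) (Im (P (fst x)) / 2 + snd (snd x)) n = D x * T x) (strip R)"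
      using u(4) u'(4) T(2)
    proof eventually_elim
      case (elim x)
      have "tau N (a (fst x)) (Re (P (fst x)) + fst (snd x)) (Im (P (fst x)) / 2 + snd (snd x)) n =
          gram N (2 * N) (odd_row (sp.spiral_fps (of_real (fst x)) * schur_fps (e x))) (odd_row (sm.spiral_fps (of_real (fst x)) * schur_fps (e' x)))"
        unfolding e_def e'_def
        by (rule tau_reduce[OF sp sm]) (simp_all add: a P f_def g_def B_def mult.assoc add_divide_distrib)
      also have "\<dots> = gram N (2 * N)
          (\<lambda>i v. (z0 * cis \<phi> * of_real (fst x) / (S x / c) ^ (2 * i)) * ((1 / c * S x) ^ v * u x i v))
          (\<lambda>i v. (cnj (z0 * cis \<phi>) * of_real (fst x) / (S x / cnj c) ^ (2 * i)) * ((1 / cnj c * S x) ^ v * u' x i v))"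
        using elim(1,2) by (intro gram_cong) auto
      also have "\<dots> = D x * T x"
        unfolding gram_scale elim(3) D_def by (simp only: mult.assoc)
      finally show ?case .
    qed
    moreover have "close (strip R) (\<lambda>x. of_real (h (fst x))) T (\<lambda>x. \<kappa> * tau 1 (\<lambda>_. 0) (fst (snd x)) (snd (snd x)) n)"
      using T(1) by (simp only: tau_1 \<zeta>_def \<zeta>'_def S_def)
    ultimately show ?thesis by blast
  qed
  obtain T1 where T1: "close (strip R) (\<lambda>x. of_real (h (fst x))) T1 (\<lambda>x. \<kappa> * tau 1 (\<lambda>_. 0) (fst (snd x)) (snd (snd x)) 1)"
     "eventually (\<lambda>x. tau N (a (fst x)) (Re (P (fst x)) + fst (snd x)) (Im (P (fst x)) / 2 + snd (snd x)) 1 = D x * T1 x) (strip R)"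
    using main by blast
  obtain T0 where T0: "close (strip R) (\<lambda>x. of_real (h (fst x))) T0 (\<lambda>x. \<kappa> * tau 1 (\<lambda>_. 0) (fst (snd x)) (snd (snd x)) 0)"
     "eventually (\<lambda>x. tau N (a (fst x)) (Re (P (fst x)) + fst (snd x)) (Im (P (fst x)) / 2 + snd (snd x)) 0 = D x * T0 x) (strip R)"
    using main by blast
  have h0: "(h \<longlongrightarrow> 0) at_top" unfolding h_def
    by (intro tendsto_neg_powr filterlim_ident) (simp add: divide_neg_pos)
  have "\<kappa> \<noteq> 0" using card_level(2)[OF sp.N_pos] z by (simp add: \<kappa>_def p_def p'_def)
  from rw_estimate[OF T1(1) T0(1) h0 this evD T1(2) T0(2)] show ?thesis unfolding h_def .
qed

section \<open>Application to the parameters of the theorem\<close>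

lemma order_1_pderiv:
  fixes q :: "complex poly"
  assumes "order w q = 1" "q \<noteq> 0"
  shows "poly q w = 0" "poly (pderiv q) w \<noteq> 0"
proof -
  show root: "poly q w = 0" using assms by (simp add: order_root)
  have pd: "pderiv q \<noteq> 0"
  proof
    assume "pderiv q = 0"
    hence "degree q = 0" by (simp add: pderiv_eq_0_iff)
    then obtain k where "q = [:k:]" by (rule degree_eq_zeroE)
    thus False using root assms(2) by simp
  qed
  have "order w q = Suc (order w (pderiv q))" using pd assms(1) root by (intro order_pderiv) auto
  thus "poly (pderiv q) w \<noteq> 0" using assms(1) pd by (simp add: order_root)
qed

lemma spiral_drift:
  assumes "N \<ge> 1" "m \<ge> 1" "z0 \<noteq> 0" "\<And>j. 1 \<le> j \<Longrightarrow> j < m \<Longrightarrow> drift z0 \<phi> k1 (2 * j + 1) = 0"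
    and "drift z0 \<phi> k1 (2 * m + 1) \<noteq> 0 \<or> 2 * N - 2 < 2 * m + 1"
  shows "spiral N m (z0 * cis \<phi>) (drift z0 \<phi> k1)" "spiral N m (cnj (z0 * cis \<phi>)) (\<lambda>k. cnj (drift z0 \<phi> k1 k))"
proof -
  have low: "drift z0 \<phi> k1 k = 0" if "k < 2 * m + 1" for k
  proof (cases "odd k \<and> k \<ge> 3")
    case True
    then obtain j where "k = 2 * j + 1" by (metis oddE)
    thus ?thesis using assms(4)[of j] True that by auto
  qed (auto simp: drift_def)
  have even: "even k \<Longrightarrow> drift z0 \<phi> k1 k = 0" for k by (simp add: drift_def)
  show "spiral N m (z0 * cis \<phi>) (drift z0 \<phi> k1)" by unfold_locales (use assms low even in auto)
  show "spiral N m (cnj (z0 * cis \<phi>)) (\<lambda>k. cnj (drift z0 \<phi> k1 k))" by unfold_locales (use assms low even in auto)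
qed

lemma drift_eq_0_iff:
  assumes "j \<ge> 1"
  shows "drift z0 \<phi> k1 (2 * j + 1) = 0 \<longleftrightarrow>
    k1 j = - (of_real (Re (z0 * cis \<phi>)) + 2 ^ (2 * j) * \<i> * of_real (Im (z0 * cis \<phi>))) / fact (2 * j + 1) * cis (- \<phi>)"
    (is "_ \<longleftrightarrow> k1 j = - ?X / _ * _")
proof -
  have inv: "cis \<phi> * cis (- \<phi>) = 1" by (simp add: cis_mult)
  have drift: "drift z0 \<phi> k1 (2 * j + 1) = ?X / fact (2 * j + 1) + k1 j * cis \<phi>"
    using assms by (simp add: drift_def del: fact_Suc)
  show ?thesis
  proof
    assume "drift z0 \<phi> k1 (2 * j + 1) = 0"
    hence "k1 j * cis \<phi> = - ?X / fact (2 * j + 1)"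
      unfolding drift by (simp only: add_eq_0_iff minus_divide_left)
    hence "k1 j * (cis \<phi> * cis (- \<phi>)) = - ?X / fact (2 * j + 1) * cis (- \<phi>)" by (simp only: mult.assoc[symmetric])
    thus "k1 j = - ?X / fact (2 * j + 1) * cis (- \<phi>)" unfolding inv by simp
  next
    assume "k1 j = - ?X / fact (2 * j + 1) * cis (- \<phi>)"
    hence "k1 j * cis \<phi> = - ?X / fact (2 * j + 1) * (cis \<phi> * cis (- \<phi>))" by (simp only: mult_ac)
    hence eq: "k1 j * cis \<phi> = - (?X / fact (2 * j + 1))"
      unfolding inv by (simp only: mult_1_right minus_divide_left)
    show "drift z0 \<phi> k1 (2 * j + 1) = 0" unfolding drift eq by (rule add.right_inverse)
  qed
qed

text \<open>\<open>A\<close> runs along a ray of fixed argument \<phi>, since the conditions on the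
  parameters involve \<open>A\<close> only through \<open>arg A\<close>. The bracket under the root
  is linear in \<open>r\<close>, so one root \<open>c\<close> taken at \<open>r = 1\<close> and
  scaled by \<open>r^(1/(2 m + 1))\<close> is a fixed branch; every choice of \<open>c\<close> is
  covered.\<close>

theorem theorem3:
  fixes N :: nat and z0 :: complex and \<phi> :: real and k1 :: "nat \<Rightarrow> complex"
    and kappa :: "nat \<Rightarrow> complex" and a :: "real \<Rightarrow> nat \<Rightarrow> complex"
    and A :: "real \<Rightarrow> complex" and x0 t0 :: "real \<Rightarrow> real"
    and star :: "nat \<Rightarrow> bool"
  assumes N3: "N \<ge> 3"
    and z0: "z0 \<noteq> 0"
    and kappa_def: "kappa = (\<lambda>j. if 1 \<le> j \<and> j \<le> N - 1 then z0 ^ (2 * j + 1) / of_nat (2 * j + 1) else 0)"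
    and standing: "\<exists>p. (\<forall>z. poly p z = adler_moser kappa N z) \<and>
                       order z0 p = N * (N - 1) div 2 \<and>
                       card {r. poly p r = 0 \<and> r \<noteq> z0} = N \<and>
                       (\<forall>r. poly p r = 0 \<and> r \<noteq> z0 \<longrightarrow> order r p = 1)"
    and k1_last: "k1 (N - 1) = 0"
    and A_def: "A = (\<lambda>r. of_real r * cis \<phi>)"
    and a_def: "a = (\<lambda>r j. kappa j * A r ^ (2 * j + 1) + k1 j * A r)"
    and x0_def: "x0 = (\<lambda>r. Re (z0 * A r))"
    and t0_def: "t0 = (\<lambda>r. Im (z0 * A r) / 2)"
    and star_def: "star = (\<lambda>j. k1 j = - (of_real (Re (z0 * cis \<phi>)) + 2 ^ (2 * j) * \<i> * of_real (Im (z0 * cis \<phi>)))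
                                       / fact (2 * j + 1) * cis (- \<phi>))"
  shows
    "((\<forall>j \<in> {1..N - 2}. star j) \<longrightarrow>
        (\<forall>R > 0. \<exists>C r0. \<forall>r \<ge> r0. \<forall>\<xi> \<eta>. \<bar>\<xi>\<bar> \<le> R \<and> \<bar>\<eta>\<bar> \<le> R \<longrightarrow>
           cmod (rw N (a r) (x0 r + \<xi>) (t0 r + \<eta>)
                 - hatq (N - 1) \<xi> \<eta> * exp (2 * \<i> * of_real (t0 r + \<eta>))) \<le> C / r))
     \<and>
     (\<forall>m. 1 \<le> m \<and> m \<le> N - 2 \<and> (\<forall>j \<in> {1..m - 1}. star j) \<and> \<not> star m \<and>
          (\<exists>p. (\<forall>z. poly p z = yablonskii_vorobev m (N - 1) z) \<and>
               (\<forall>zb. zb \<noteq> 0 \<and> poly p zb = 0 \<longrightarrow> order zb p = 1)) \<longrightarrow>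
        (\<forall>c. c ^ (2 * m + 1) = - (of_nat (2 * m + 1) / 2 ^ (2 * m)) *
                 ((of_real (Re (z0 * A 1)) + 2 ^ (2 * m) * \<i> * of_real (Im (z0 * A 1))) / fact (2 * m + 1)
                  + k1 m * A 1) \<longrightarrow>
           (let P = (\<lambda>zb r. zb * of_real (r powr (1 / real (2 * m + 1))) * c + z0 * A r) in
             (\<forall>zb. zb \<noteq> 0 \<and> yablonskii_vorobev m (N - 1) zb = 0 \<longrightarrow>
                (\<forall>R > 0. \<exists>C r0. \<forall>r \<ge> r0. \<forall>\<xi> \<eta>. \<bar>\<xi>\<bar> \<le> R \<and> \<bar>\<eta>\<bar> \<le> R \<longrightarrow>
                   cmod (rw N (a r) (Re (P zb r) + \<xi>) (Im (P zb r) / 2 + \<eta>)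
                         - hatq 1 \<xi> \<eta> * exp (2 * \<i> * of_real (Im (P zb r) / 2 + \<eta>)))
                     \<le> C * r powr (- 1 / real (2 * m + 1))))
             \<and> (\<forall>R > 0. \<exists>C r0. \<forall>r \<ge> r0. \<forall>\<xi> \<eta>. \<bar>\<xi>\<bar> \<le> R \<and> \<bar>\<eta>\<bar> \<le> R \<longrightarrow>
                   cmod (rw N (a r) (x0 r + \<xi>) (t0 r + \<eta>)
                         - hatq (N0_of (N - 1) m) \<xi> \<eta> * exp (2 * \<i> * of_real (t0 r + \<eta>))) \<le> C / r)
             \<and> (\<forall>r > 0. card ((\<lambda>zb. (Re (P zb r), Im (P zb r) / 2)) `
                         {zb. zb \<noteq> 0 \<and> yablonskii_vorobev m (N - 1) zb = 0}) = Gamma_of (N - 1) m))))"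
proof (intro conjI impI allI)
  have drift_star: "star j \<longleftrightarrow> drift z0 \<phi> k1 (2 * j + 1) = 0" if "j \<ge> 1" for j
    unfolding star_def drift_eq_0_iff[OF that] ..
  have a_eq: "a = (\<lambda>r j. (if 1 \<le> j \<and> j \<le> N - 1 then z0 ^ (2 * j + 1) / of_nat (2 * j + 1) else 0) *
      (of_real r * cis \<phi>) ^ (2 * j + 1) + k1 j * (of_real r * cis \<phi>))"
    unfolding a_def kappa_def A_def ..
  note x0_eq = x0_def[unfolded A_def] and t0_eq = t0_def[unfolded A_def]
  have N1: "N \<ge> 1" "N - 1 \<ge> 1" using N3 by auto
  {
    fix R :: real
    assume "\<forall>j\<in>{1..N - 2}. star j"
    hence low: "drift z0 \<phi> k1 (2 * j + 1) = 0" if "1 \<le> j" "j < N - 1" for j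
      using drift_star[of j] that by auto
    \<comment> \<open>The instance \<open>m = N - 1\<close>: no even row reaches the index
      \<open>2 N - 1\<close>, so the second alternative of \<open>b_nondeg\<close> applies.\<close>
    have "2 * N - 2 < 2 * (N - 1) + 1" using N3 by simp
    note sp = spiral_drift[OF N1 z0 low disjI2[OF this]]
    have "N0_of (N - 1) (N - 1) = N - 1" by (simp add: N0_of_def Let_def)
    with rw_center[OF sp a_eq x0_eq t0_eq, of R]
    show "\<exists>C r0. \<forall>r\<ge>r0. \<forall>\<xi> \<eta>. \<bar>\<xi>\<bar> \<le> R \<and> \<bar>\<eta>\<bar> \<le> R \<longrightarrow>
           cmod (rw N (a r) (x0 r + \<xi>) (t0 r + \<eta>)
                 - hatq (N - 1) \<xi> \<eta> * exp (2 * \<i> * of_real (t0 r + \<eta>))) \<le> C / r"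
      by (simp only:)
  }
  fix m c
  assume hyp: "1 \<le> m \<and> m \<le> N - 2 \<and> (\<forall>j \<in> {1..m - 1}. star j) \<and> \<not> star m \<and>
          (\<exists>p. (\<forall>z. poly p z = yablonskii_vorobev m (N - 1) z) \<and>
               (\<forall>zb. zb \<noteq> 0 \<and> poly p zb = 0 \<longrightarrow> order zb p = 1))"
    and c_eq: "c ^ (2 * m + 1) = - (of_nat (2 * m + 1) / 2 ^ (2 * m)) *
                 ((of_real (Re (z0 * A 1)) + 2 ^ (2 * m) * \<i> * of_real (Im (z0 * A 1))) / fact (2 * m + 1)
                  + k1 m * A 1)"
  have m: "m \<ge> 1" using hyp by blast
  have low: "drift z0 \<phi> k1 (2 * j + 1) = 0" if "1 \<le> j" "j < m" for j
    using drift_star[of j] that hyp by auto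
  have nz: "drift z0 \<phi> k1 (2 * m + 1) \<noteq> 0" using drift_star[OF m] hyp by blast
  note sp = spiral_drift[OF N1(1) m z0 low disjI1[OF nz]]
  have "A 1 = cis \<phi>" by (simp add: A_def)
  hence c: "c ^ (2 * m + 1) = - (of_nat (2 * m + 1) / 2 ^ (2 * m)) * drift z0 \<phi> k1 (2 * m + 1)"
    using m unfolding c_eq by (simp add: drift_def del: fact_Suc)
  have c0: "c \<noteq> 0"
  proof
    assume "c = 0"
    hence "(of_nat (2 * m + 1) / 2 ^ (2 * m) :: complex) * drift z0 \<phi> k1 (2 * m + 1) = 0" using c by simp
    thus False using nz by (simp del: of_nat_Suc)
  qed
  define q where "q = qpoly m N"
  define k where "k = (\<Prod>i=1..N - 1. dfact_odd i)"
  have k: "k \<noteq> 0" by (simp add: k_def dfact_odd_nonzero)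
  have yv: "yablonskii_vorobev m (N - 1) w = k * poly q w" for w
    using yablonskii_vorobev_qpoly[OF m, of "N - 1" w] N1 by (simp add: q_def k_def)
  have roots: "{w. w \<noteq> 0 \<and> yablonskii_vorobev m (N - 1) w = 0} = {w. w \<noteq> 0 \<and> poly q w = 0}"
    using k unfolding yv by simp
  have q0: "q \<noteq> 0"
  proof
    assume "q = 0"
    hence "(\<Sum>i<N. i) = 0" using degree_qpoly[OF m, of N] by (simp add: q_def)
    hence "\<forall>i\<in>{..<N}. i = 0" by simp
    from bspec[OF this, of 1] N3 show False by simp
  qed
  obtain p where p: "\<And>w. poly p w = yablonskii_vorobev m (N - 1) w"
    "\<And>w. w \<noteq> 0 \<Longrightarrow> poly p w = 0 \<Longrightarrow> order w p = 1" using hyp by blast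
  have "p = Polynomial.smult k q" unfolding poly_eq_poly_eq_iff[symmetric] by (rule ext) (simp only: p(1) yv poly_smult)
  hence simple: "order w q = 1" if "w \<noteq> 0" "poly q w = 0" for w
    using p(2)[OF that(1)] that(2) k by (simp add: order_smult)
  define P where "P = (\<lambda>zb r. zb * of_real (r powr (1 / real (2 * m + 1))) * c + z0 * A r)"
  have root: "\<exists>C r0. \<forall>r\<ge>r0. \<forall>\<xi> \<eta>. \<bar>\<xi>\<bar> \<le> R \<and> \<bar>\<eta>\<bar> \<le> R \<longrightarrow>
      cmod (rw N (a r) (Re (P w r) + \<xi>) (Im (P w r) / 2 + \<eta>)
            - hatq 1 \<xi> \<eta> * exp (2 * \<i> * of_real (Im (P w r) / 2 + \<eta>))) \<le> C * r powr (- 1 / real (2 * m + 1))"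
    if w: "w \<noteq> 0" "yablonskii_vorobev m (N - 1) w = 0" for w R
  proof -
    have w0: "poly q w = 0" using w(2) k unfolding yv by simp
    hence w1: "poly q (cnj w) = 0" using cnj_qpoly[OF m, of N w] by (simp add: q_def)
    have pd: "poly (pderiv q) w \<noteq> 0" "poly (pderiv q) (cnj w) \<noteq> 0"
      using order_1_pderiv(2)[OF simple q0] w(1) w0 w1 by auto
    show ?thesis
      using rw_root[OF sp a_eq c0 c w0[unfolded q_def] pd[unfolded q_def], of "P w" R]
      by (simp add: P_def A_def)
  qed
  have center: "\<exists>C r0. \<forall>r\<ge>r0. \<forall>\<xi> \<eta>. \<bar>\<xi>\<bar> \<le> R \<and> \<bar>\<eta>\<bar> \<le> R \<longrightarrow>
      cmod (rw N (a r) (x0 r + \<xi>) (t0 r + \<eta>)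
            - hatq (N0_of (N - 1) m) \<xi> \<eta> * exp (2 * \<i> * of_real (t0 r + \<eta>))) \<le> C / r" for R
    by (rule rw_center[OF sp a_eq x0_eq t0_eq])
  have count: "card ((\<lambda>zb. (Re (P zb r), Im (P zb r) / 2)) ` {zb. zb \<noteq> 0 \<and> yablonskii_vorobev m (N - 1) zb = 0})
      = Gamma_of (N - 1) m" if "r > 0" for r
  proof -
    \<comment> \<open>\<open>P\<close> is affine in \<open>zb\<close> with nonzero slope, so
      distinct roots give distinct points.\<close>
    have "inj (\<lambda>zb. (Re (P zb r), Im (P zb r) / 2))"
    proof (rule injI)
      fix v w assume "(Re (P v r), Im (P v r) / 2) = (Re (P w r), Im (P w r) / 2)"
      hence "P v r = P w r" by (simp add: complex_eq_iff)
      thus "v = w" using c0 that by (simp add: P_def)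
    qed
    hence "card ((\<lambda>zb. (Re (P zb r), Im (P zb r) / 2)) ` {w. w \<noteq> 0 \<and> poly q w = 0}) = card {w. w \<noteq> 0 \<and> poly q w = 0}"
      by (rule card_image[OF inj_on_subset]) simp
    also have "\<dots> = Gamma_of (N - 1) m"
      unfolding q_def by (rule card_nonzero_roots[OF m N1(1) _ q0[unfolded q_def]]) (use simple in \<open>simp add: q_def\<close>)
    finally show ?thesis unfolding roots .
  qed
  show "let P = (\<lambda>zb r. zb * of_real (r powr (1 / real (2 * m + 1))) * c + z0 * A r) in
             (\<forall>zb. zb \<noteq> 0 \<and> yablonskii_vorobev m (N - 1) zb = 0 \<longrightarrow>
                (\<forall>R > 0. \<exists>C r0. \<forall>r \<ge> r0. \<forall>\<xi> \<eta>. \<bar>\<xi>\<bar> \<le> R \<and> \<bar>\<eta>\<bar> \<le> R \<longrightarrow>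
                   cmod (rw N (a r) (Re (P zb r) + \<xi>) (Im (P zb r) / 2 + \<eta>)
                         - hatq 1 \<xi> \<eta> * exp (2 * \<i> * of_real (Im (P zb r) / 2 + \<eta>)))
                     \<le> C * r powr (- 1 / real (2 * m + 1))))
             \<and> (\<forall>R > 0. \<exists>C r0. \<forall>r \<ge> r0. \<forall>\<xi> \<eta>. \<bar>\<xi>\<bar> \<le> R \<and> \<bar>\<eta>\<bar> \<le> R \<longrightarrow>
                   cmod (rw N (a r) (x0 r + \<xi>) (t0 r + \<eta>)
                         - hatq (N0_of (N - 1) m) \<xi> \<eta> * exp (2 * \<i> * of_real (t0 r + \<eta>))) \<le> C / r)
             \<and> (\<forall>r > 0. card ((\<lambda>zb. (Re (P zb r), Im (P zb r) / 2)) `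
                         {zb. zb \<noteq> 0 \<and> yablonskii_vorobev m (N - 1) zb = 0}) = Gamma_of (N - 1) m)"
    unfolding P_def[symmetric] Let_def using root center count by blast
qed

end
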